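(* Let $B\ge 2$ be the block size. Given two B-trees with parameter $B$, of sizes $m$ and $n \ge m$, there exists a parallel algorithm in the fork-join I/O model that returns a new B-tree containing the union of the keys of the two input trees, using $O\!\left(m\log_B\!\left(\frac{n}{m}\right)\right)$ I/O work and $O(\log_B m \cdot \log_2 \log_B n + \log_B n)$ I/O span.
   Context: A B-tree with parameter $B$ over a totally ordered key set is either an empty (external) node, or a node with keys $k_1<\dots<k_b$ and $b+1$ subtrees $T_1,\dots,T_{b+1}$, such that: $\lceil B/2\rceil \le b \le B$ (except at the root, where $2\le b\le B$); each $T_i$ is a B-tree; every key of $T_{i-1}$ is less than $k_i$ and every key of $T_i$ is greater than $k_i$; and all external nodes have the same depth. The size of a B-tree is its number of keys. Cost model (fork-join I/O model): computation is in the shared-memory fork-join model, where a thread may fork up to $B$ parallel child threads and continues once they all finish (a fork or join of up to $B$ threads counts as one step). Memory is organized in blocks of $B$ words; reading or writing one block costs one unit, while each processor can hold $O(\log n)$ blocks locally (its stack) and accessing data in these local blocks is free. The computation forms a DAG; the I/O work is the total number of block transfers, and the I/O span is the maximum number of block transfers along any path of the DAG (the longest chain of dependent block transfers).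
   Formalization: B-tree nodes below the root need only ⌊B/2⌋ keys and the root only 1, since with the stated bounds no B-tree has B+1 keys and some unions would be impossible; logarithms in the bounds are read as at least 1, since for n = m the stated work bound is 0. *)

theory Defs
  imports Complex_Main "HOL-Library.Nat_Bijection"
begin

section \<open>B-trees\<close>

datatype 'k btree = Ext | Node "'k list" "'k btree list"

abbreviation keys :: "'k btree \<Rightarrow> 'k set" where
  "keys \<equiv> set_btree"

fun num_keys :: "'k btree \<Rightarrow> nat" where
  "num_keys Ext = 0"
| "num_keys (Node ks ts) = length ks + sum_list (map num_keys ts)"

fun search_tree :: "'k::linorder btree \<Rightarrow> bool" where
  "search_tree Ext \<longleftrightarrow> True"
| "search_tree (Node ks ts) \<longleftrightarrow>
     sorted_wrt (<) ks \<and> length ts = length ks + 1 \<and>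
     (\<forall>i<length ks. (\<forall>x\<in>keys (ts ! i). x < ks ! i) \<and> (\<forall>x\<in>keys (ts ! Suc i). ks ! i < x)) \<and>
     (\<forall>t\<in>set ts. search_tree t)"

fun ext_depths :: "'k btree \<Rightarrow> nat set" where
  "ext_depths Ext = {0}"
| "ext_depths (Node ks ts) = Suc ` (\<Union>t\<in>set ts. ext_depths t)"

text \<open>The argument \<open>lo\<close> is the least number of keys allowed in the root of the given tree.
  All nodes below the root need at least \<open>B div 2\<close> keys, and the root of a B-tree at least one.
  Asking for half of \<open>B\<close> rounded up below the root, and for two keys in the root, would leave gaps
  in the set of possible sizes and so rule out unions: a tree of height one has at most \<open>B\<close> keys,
  and one of height at least two would have at least \<open>2 + 3 * ((B + 1) div 2) > B + 1\<close> keys, so that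
  no tree has exactly \<open>B + 1\<close> keys. Rounding up for odd \<open>B\<close>, even with one key allowed in the root,
  still leaves out the size \<open>B + 1\<close>, since \<open>1 + 2 * ((B + 1) div 2) = B + 2\<close>; rounding down but
  asking for two keys in the root leaves it out too, since \<open>2 + 3 * (B div 2) > B + 1\<close>.\<close>

fun degrees_ok :: "nat \<Rightarrow> nat \<Rightarrow> 'k btree \<Rightarrow> bool" where
  "degrees_ok B lo Ext \<longleftrightarrow> True"
| "degrees_ok B lo (Node ks ts) \<longleftrightarrow>
     lo \<le> length ks \<and> length ks \<le> B \<and> (\<forall>t\<in>set ts. degrees_ok B (B div 2) t)"

definition is_btree :: "nat \<Rightarrow> 'k::linorder btree \<Rightarrow> bool" where
  "is_btree B t \<longleftrightarrow>
     search_tree t \<and> degrees_ok B 1 t \<and> (\<forall>d\<in>ext_depths t. \<forall>d'\<in>ext_depths t. d = d')"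


section \<open>Memory\<close>

text \<open>Keys and references are indivisible words; \<open>Num\<close> is machine-integer data. A block is a list
  of at most \<open>B\<close> words. Shared memory consists of regions; block \<open>i\<close> of region \<open>r\<close> has the
  location \<open>(r, i)\<close>, so the blocks of one region are contiguous and \<open>Ref r\<close> addresses them all.\<close>

datatype 'k word = Key 'k | Ref nat | Num nat

type_synonym loc = "nat \<times> nat"
type_synonym 'k block = "'k word list"
type_synonym 'k memory = "loc \<rightharpoonup> 'k block"

definition block_memory :: "nat \<Rightarrow> 'k memory \<Rightarrow> bool" where
  "block_memory B \<mu> \<longleftrightarrow> (\<forall>blk\<in>ran \<mu>. length blk \<le> B)"

text \<open>A node with \<open>b \<le> B\<close> keys has \<open>b + 1\<close> child pointers and so does not fit into one block.
  It occupies three: the keys, the first \<open>b\<close> child pointers, and the last child pointer.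
  An external node is the null pointer \<open>Num 0\<close>.\<close>

inductive stored :: "'k memory \<Rightarrow> 'k word \<Rightarrow> 'k btree \<Rightarrow> bool" for \<mu> where
  ext: "stored \<mu> (Num 0) Ext"
| node: "\<lbrakk> \<mu> (r, 0) = Some (map Key ks); \<mu> (r, 1) = Some ps; \<mu> (r, 2) = Some [p];
          list_all2 (stored \<mu>) (ps @ [p]) ts \<rbrakk> \<Longrightarrow> stored \<mu> (Ref r) (Node ks ts)"


section \<open>The fork-join I/O model\<close>

text \<open>The local memory of a thread (program counter and variables included) is a list of words.
  A program maps it to the next instruction. Computation on local memory is free and arbitrary;
  the last argument of an instruction yields the local memory with which the thread continues,
  as a function of what it has received. \<open>Fork\<close> gives the initial local memories of the children,
  and the continuation gets the words which the children return on \<open>Halt\<close>.\<close>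

datatype 'k instr =
    Halt "'k word list"
  | Load nat nat "'k block \<Rightarrow> 'k word list"
  | Store nat nat "'k block" "'k word list"
  | Alloc "nat \<Rightarrow> 'k word list"
  | Fork "'k word list list" "'k word list list \<Rightarrow> 'k word list"

type_synonym 'k program = "'k word list \<Rightarrow> 'k instr"

text \<open>With room for \<open>L\<close> words and with integers below \<open>W\<close>, the words \<open>dst\<close> may be computed from
  the words \<open>src\<close>. Keys and references can only be copied, so information cannot be packed into
  newly made ones.\<close>

definition derivable :: "nat \<Rightarrow> nat \<Rightarrow> 'k word list \<Rightarrow> 'k word list \<Rightarrow> bool" where
  "derivable L W src dst \<longleftrightarrow>
     length src \<le> L \<and> length dst \<le> L \<and> set dst \<subseteq> set src \<union> Num ` {..<W}"

text \<open>The outcome of a computation: the words returned, the locations read, the blocks written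
  (as an update of the memory), the I/O work and the I/O span.\<close>

datatype 'k outcome =
  Outcome (result: "'k word list") (io_reads: "loc set") (io_writes: "'k memory")
          (io_work: nat) (io_span: nat)

text \<open>The children of a fork may run in any interleaving. We admit a fork only if no location
  written by one child is read or written by another, so that all interleavings have the effect
  of running each child on the memory at the time of the fork.\<close>

definition race_free :: "'k outcome list \<Rightarrow> bool" where
  "race_free os \<longleftrightarrow> (\<forall>i<length os. \<forall>j<length os. i \<noteq> j \<longrightarrow>
     dom (io_writes (os ! i)) \<inter> (io_reads (os ! j) \<union> dom (io_writes (os ! j))) = {})"

definition joined_writes :: "'k outcome list \<Rightarrow> 'k memory" where
  "joined_writes os = foldr (\<lambda>out \<mu>. io_writes out ++ \<mu>) os Map.empty"

text \<open>The allocator is an enumeration \<open>f\<close> of free regions; a fork deals \<open>f\<close> out among the parent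
  (share 0) and the children.\<close>

definition share :: "(nat \<Rightarrow> nat) \<Rightarrow> nat \<Rightarrow> nat \<Rightarrow> nat" where
  "share f i = (\<lambda>j. f (prod_encode (i, j)))"

text \<open>\<open>exec B W \<delta> L f \<mu> s out\<close>: a thread of program \<open>\<delta>\<close> with local memory \<open>s\<close>, started in shared
  memory \<open>\<mu>\<close>, terminates with outcome \<open>out\<close>. It has room for \<open>L\<close> local words. During a fork the
  local memory of the parent remains on the stack below that of each child. Each read or write of
  a block costs one unit of work and span; at a fork, work is added up over the children while span
  is maximised.\<close>

inductive exec ::
  "nat \<Rightarrow> nat \<Rightarrow> 'k program \<Rightarrow> nat \<Rightarrow> (nat \<Rightarrow> nat) \<Rightarrow> 'k memory \<Rightarrow> 'k word list \<Rightarrow> 'k outcome \<Rightarrow> bool"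
  for B W \<delta> where
  halt:
    "\<lbrakk> \<delta> s = Halt res; derivable L W s res \<rbrakk>
     \<Longrightarrow> exec B W \<delta> L f \<mu> s (Outcome res {} Map.empty 0 0)"
| load:
    "\<lbrakk> \<delta> s = Load r i k; Ref r \<in> set s; i < W; \<mu> (r, i) = Some blk;
       derivable L W (s @ blk) (k blk);
       exec B W \<delta> L f \<mu> (k blk) (Outcome res R U w d) \<rbrakk>
     \<Longrightarrow> exec B W \<delta> L f \<mu> s (Outcome res (insert (r, i) R) U (Suc w) (Suc d))"
| store:
    "\<lbrakk> \<delta> s = Store r i blk s'; Ref r \<in> set s; i < W; length blk \<le> B;
       derivable L W s blk; derivable L W s s';
       exec B W \<delta> L f (\<mu>((r, i) \<mapsto> blk)) s' (Outcome res R U w d) \<rbrakk>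
     \<Longrightarrow> exec B W \<delta> L f \<mu> s (Outcome res R ([(r, i) \<mapsto> blk] ++ U) (Suc w) (Suc d))"
| alloc:
    "\<lbrakk> \<delta> s = Alloc k; derivable L W (s @ [Ref (f 0)]) (k (f 0));
       exec B W \<delta> L (f \<circ> Suc) \<mu> (k (f 0)) out \<rbrakk>
     \<Longrightarrow> exec B W \<delta> L f \<mu> s out"
| fork:
    "\<lbrakk> \<delta> s = Fork cs k; length cs \<le> B; derivable L W s (concat cs);
       length os = length cs;
       \<forall>i<length cs. exec B W \<delta> (L - length s) (share f (Suc i)) \<mu> (cs ! i) (os ! i);
       race_free os;
       derivable L W (s @ concat (map result os)) (k (map result os));
       exec B W \<delta> L (share f 0) (\<mu> ++ joined_writes os) (k (map result os)) (Outcome res R U w d) \<rbrakk>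
     \<Longrightarrow> exec B W \<delta> L f \<mu> s
           (Outcome res ((\<Union>out\<in>set os. io_reads out) \<union> R) (joined_writes os ++ U)
              (sum_list (map io_work os) + w) (foldr max (map io_span os) 0 + d))"


section \<open>Logarithms in cost bounds\<close>

text \<open>Logarithms in asymptotic bounds are understood to be at least 1.\<close>

definition lg :: "real \<Rightarrow> real \<Rightarrow> real" where
  "lg b x = max 1 (log b x)"

end

theory Submission
  imports Defs
begin

text \<open>Let D = B div 2 + 1 be the least number of children of an inner node. Copy the m keys of the smaller
  tree into an array, one key per block, and distribute array intervals over the larger tree from the
  root downwards. At a node with b keys and k array keys, a sample of stride about sqrt (k / b) is
  compared with all b keys in parallel, and then the gaps between samples are searched, again in
  parallel: constant span and work O(min k (sqrt (k * b))). On a level with N keys in total this is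
  O(min m (sqrt (m * N))); as N decreases by the factor D per level, the sum over all levels is
  O(m * log D (n / m)).

  The touched nodes are not modified. Bottom up, only the number of nodes which will replace each of
  them is computed: the replacements of the children (for an external node, one more than the number
  of keys that have arrived there) are regrouped evenly into as few nodes as possible. A final pass
  from the root builds the i-th replacement of a node from the replacements of its children that
  belong to it, and returns it with the key separating it from the next one. No joins propagate, so
  that every pass has constant span per level.

  All data except the array is written to newly allocated regions, so forks are race-free.\<close>

section \<open>Programs as resumptions over the words received\<close>

text \<open>The stride balances two costs at a node. Array keys lie in separate blocks, so a sample
  of stride \<open>s\<close> costs about \<open>k / s\<close> reads, after which a loaded key is
  compared with the \<open>b\<close> local keys for free; each of the \<open>b\<close> keys then
  needs up to \<open>s - 1\<close> reads in its gap. The sum is about \<open>sqrt (k * b)\<close>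
  when \<open>s\<close> is near \<open>sqrt (k / b)\<close>. Forks move no blocks, so any number of
  independent reads has span one; binary forking pays in stack depth only, which is logarithmic and
  fits into local memory. The span therefore follows the heights alone, and the summand
  \<open>lg B n\<close> of the bound covers it. Every replacement needs a legal number of keys,
  however many units arrive below it. Fixing all counts before anything is built lets a subtree be
  regrouped from these counts, without looking at its neighbours. The smaller tree needs a sizing
  pass as well, because the array position of a key depends on all subtrees to its left. One device
  is forced by the model: a node may have \<open>B + 1\<close> children while a fork admits
  \<open>B\<close> threads, so tasks for children are started through two intermediate
  threads.\<close>

datatype 'k code =
    Ret "'k word list"
  | Ld nat nat "'k block \<Rightarrow> 'k code"
  | St nat nat "'k block" "'k code"
  | Al "nat \<Rightarrow> 'k code"
  | Fk "'k word list list" "'k word list list \<Rightarrow> 'k code"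

text \<open>The local memory of a thread holds its arguments and all responses received so far; its code is
  recovered by replaying them. Hence only stored blocks, arguments and results need to be shown
  derivable. As no pointer is \<open>Num 1\<close>, the initial local memory is not an encoded state.\<close>

definition enc_list :: "'k word list \<Rightarrow> 'k word list" where
  "enc_list ws = Num (length ws) # ws"

definition enc_resp :: "'k word list list \<Rightarrow> 'k word list" where
  "enc_resp rs = Num (length rs) # concat (map enc_list rs)"

definition enc_state :: "'k word list \<Rightarrow> 'k word list list list \<Rightarrow> 'k word list" where
  "enc_state a hs = Num 1 # enc_list a @ concat (map enc_resp hs)"

lemma enc_list_append_inject: "enc_list x @ r = enc_list y @ r' \<longleftrightarrow> x = y \<and> r = r'"
  by (auto simp: enc_list_def)

lemma concat_enc_list_append_inject:
  "length xs = length ys \<Longrightarrow>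
   concat (map enc_list xs) @ r = concat (map enc_list ys) @ r' \<Longrightarrow> xs = ys \<and> r = r'"
proof (induction xs arbitrary: ys)
  case (Cons x xs)
  then obtain y ys' where ys: "ys = y # ys'" by (cases ys) auto
  have "enc_list x @ (concat (map enc_list xs) @ r) = enc_list y @ (concat (map enc_list ys') @ r')"
    using Cons.prems ys by simp
  then show ?case
    unfolding enc_list_append_inject using Cons.IH[of ys'] Cons.prems(1) ys by simp
qed simp

lemma enc_resp_append_inject: "enc_resp xs @ r = enc_resp ys @ r' \<longleftrightarrow> xs = ys \<and> r = r'"
proof
  assume *: "enc_resp xs @ r = enc_resp ys @ r'"
  then have "length xs = length ys" by (simp add: enc_resp_def)
  with * show "xs = ys \<and> r = r'"
    using concat_enc_list_append_inject[of xs ys r r'] by (simp add: enc_resp_def)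
qed simp

lemma concat_enc_resp_inject: "concat (map enc_resp hs) = concat (map enc_resp hs') \<Longrightarrow> hs = hs'"
proof (induction hs arbitrary: hs')
  case Nil
  then show ?case by (cases hs') (auto simp: enc_resp_def)
next
  case (Cons h hs)
  then show ?case
    by (cases hs') (auto simp: enc_resp_append_inject, simp add: enc_resp_def)
qed

lemma enc_state_inject: "enc_state a hs = enc_state a' hs' \<longleftrightarrow> a = a' \<and> hs = hs'"
  using concat_enc_resp_inject by (fastforce simp: enc_state_def enc_list_append_inject)

lemma enc_state_snoc: "enc_state a hs @ enc_resp rs = enc_state a (hs @ [rs])"
  by (simp add: enc_state_def)

text \<open>All responses have one format, a list of word lists: a single list for a loaded block or
  a new reference, none for a store, the children's results for a fork. As \<open>instr_of\<close>
  records an allocation as \<open>[[Ref r]]\<close>, the default region 0 does not arise in a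
  run.\<close>

fun advance :: "'k code \<Rightarrow> 'k word list list \<Rightarrow> 'k code" where
  "advance (Ret ws) rs = Ret ws"
| "advance (Ld r i k) rs = k (hd rs)"
| "advance (St r i blk k) rs = k"
| "advance (Al k) rs = k (case hd (hd rs) of Ref r \<Rightarrow> r | _ \<Rightarrow> 0)"
| "advance (Fk cs k) rs = k rs"

fun instr_of :: "'k word list \<Rightarrow> 'k code \<Rightarrow> 'k instr" where
  "instr_of s (Ret ws) = Halt ws"
| "instr_of s (Ld r i k) = Load r i (\<lambda>blk. s @ enc_resp [blk])"
| "instr_of s (St r i blk k) = Store r i blk (s @ enc_resp [])"
| "instr_of s (Al k) = Alloc (\<lambda>r. s @ enc_resp [[Ref r]])"
| "instr_of s (Fk cs k) = Fork (map (\<lambda>a. enc_state a []) cs) (\<lambda>rs. s @ enc_resp rs)"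

text \<open>The last branch is the entry point, where the local memory holds just the two pointers.
  An allocation moves no block, so it serves as a free step that rewrites this memory into an
  encoded state; \<open>Num 0\<close> selects the main procedure.\<close>

definition program_of :: "('k word list \<Rightarrow> 'k code) \<Rightarrow> 'k program" where
  "program_of body s =
     (if \<exists>a hs. s = enc_state a hs
      then case (SOME (a, hs). s = enc_state a hs) of (a, hs) \<Rightarrow> instr_of s (foldl advance (body a) hs)
      else Alloc (\<lambda>_. enc_state (Num 0 # s) []))"

lemma program_of_enc_state:
  "program_of body (enc_state a hs) = instr_of (enc_state a hs) (foldl advance (body a) hs)"
proof -
  have "(SOME (a', hs'). enc_state a hs = enc_state a' hs') = (a, hs)"
    by (rule some_equality) (auto simp: enc_state_inject)
  then show ?thesis by (auto simp: program_of_def)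
qed

lemma derivable_mono: "derivable L W s t \<Longrightarrow> L \<le> L' \<Longrightarrow> derivable L' W s t"
  by (auto simp: derivable_def)

text \<open>Children of a fork have room \<open>L - length s\<close>, which depends on the exact
  length of the local memory, whereas the rules below only bound that length by some
  \<open>l\<close>. A child verified for room \<open>L - l\<close> must hence be able to run in
  more.\<close>

lemma exec_mono:
  "exec B W \<delta> L f \<mu> s out \<Longrightarrow> L \<le> L' \<Longrightarrow> exec B W \<delta> L' f \<mu> s out"
proof (induction arbitrary: L' rule: exec.induct)
  case (halt s res L f \<mu>)
  then show ?case by (blast intro: exec.halt derivable_mono)
next
  case (load s r i k \<mu> blk L f res R U w d)
  then show ?case by (blast intro: exec.load derivable_mono)
next
  case (store s r i blk s' L f \<mu> res R U w d)
  then show ?case by (blast intro: exec.store derivable_mono)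
next
  case (alloc s k L f \<mu> out)
  then show ?case by (blast intro: exec.alloc derivable_mono)
next
  case (fork s cs k L os f \<mu> res R U w d)
  have "L - length s \<le> L' - length s" using fork.prems by simp
  then have "\<forall>i<length cs. exec B W \<delta> (L' - length s) (share f (Suc i)) \<mu> (cs ! i) (os ! i)"
    using fork.IH(1) by blast
  from exec.fork[OF fork.hyps(1,2) derivable_mono[OF fork.hyps(3) fork.prems] fork.hyps(4) this
      fork.hyps(5) derivable_mono[OF fork.hyps(6) fork.prems] fork.IH(2)[OF fork.prems]]
  show ?case .
qed

section \<open>Separation of writes and a program logic for runs\<close>

definition fresh :: "(nat \<Rightarrow> nat) \<Rightarrow> 'k memory \<Rightarrow> loc set \<Rightarrow> bool" where
  "fresh f \<mu> X \<longleftrightarrow> inj f \<and> X \<inter> dom \<mu> = {} \<and> range f \<times> UNIV \<inter> (dom \<mu> \<union> X) = {}"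

lemma fresh_iff:
  "fresh f \<mu> X \<longleftrightarrow> inj f \<and> X \<inter> dom \<mu> = {} \<and> (\<forall>j i. (f j, i) \<notin> dom \<mu> \<and> (f j, i) \<notin> X)"
  by (fastforce simp: fresh_def)

lemma joined_writes_dom: "dom (joined_writes os) = (\<Union>out\<in>set os. dom (io_writes out))"
  by (induction os) (auto simp: joined_writes_def)

text \<open>In \<open>++\<close> the later child takes precedence, so disjoint domains are what
  keeps the update of every child intact in the join.\<close>

lemma joined_writes_le:
  assumes "i < length os"
    and "\<And>i j. i < length os \<Longrightarrow> j < length os \<Longrightarrow> i \<noteq> j \<Longrightarrow>
           dom (io_writes (os ! i)) \<inter> dom (io_writes (os ! j)) = {}"
  shows "io_writes (os ! i) \<subseteq>\<^sub>m joined_writes os"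
  using assms
proof (induction os arbitrary: i)
  case (Cons out os)
  have IH: "i < length os \<Longrightarrow> io_writes (os ! i) \<subseteq>\<^sub>m joined_writes os" for i
  proof (rule Cons.IH, assumption)
    fix i j assume "i < length os" "j < length os" "i \<noteq> j"
    then show "dom (io_writes (os ! i)) \<inter> dom (io_writes (os ! j)) = {}"
      using Cons.prems(2)[of "Suc i" "Suc j"] by simp
  qed
  have eq: "joined_writes (out # os) = io_writes out ++ joined_writes os"
    by (simp add: joined_writes_def)
  show ?case
  proof (cases i)
    case 0
    have "dom (io_writes out) \<inter> dom (joined_writes os) = {}"
    proof -
      have "dom (io_writes out) \<inter> dom (io_writes o') = {}" if "o' \<in> set os" for o'
      proof -
        from that obtain j where "j < length os" "o' = os ! j" by (metis in_set_conv_nth)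
        then show ?thesis using Cons.prems(2)[of 0 "Suc j"] by simp
      qed
      then show ?thesis by (auto simp: joined_writes_dom)
    qed
    then show ?thesis using 0 eq
      by (auto simp: map_le_def map_add_def dom_def split: option.splits)
  next
    case (Suc j)
    then have "io_writes (os ! j) \<subseteq>\<^sub>m joined_writes os" using IH Cons.prems(1) by simp
    then show ?thesis using Suc eq map_le_map_add map_le_trans by fastforce
  qed
qed simp

locale machine =
  fixes B W :: nat and body :: "'k::linorder word list \<Rightarrow> 'k code"
begin

definition runs_at :: "'k word list \<Rightarrow> 'k code \<Rightarrow> bool" where
  "runs_at s c \<longleftrightarrow> (\<exists>a hs. s = enc_state a hs \<and> foldl advance (body a) hs = c)"

text \<open>\<open>X\<close> contains the locations outside newly allocated regions which the thread may write. Neither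
  these nor the new regions are in use, so that memory only grows. The postcondition is required for
  all later memories because siblings may extend the memory too.\<close>

definition spec :: "nat \<Rightarrow> (nat \<Rightarrow> nat) \<Rightarrow> 'k memory \<Rightarrow> 'k word list \<Rightarrow> loc set \<Rightarrow> nat \<Rightarrow> nat
    \<Rightarrow> ('k word list \<Rightarrow> 'k memory \<Rightarrow> bool) \<Rightarrow> bool" where
  "spec L f \<mu> s X w d Q \<longleftrightarrow> (\<exists>res R U w' d'.
     exec B W (program_of body) L f \<mu> s (Outcome res R U w' d') \<and> w' \<le> w \<and> d' \<le> d \<and>
     dom U \<inter> dom \<mu> = {} \<and> dom U \<subseteq> X \<union> range f \<times> UNIV \<and> R \<subseteq> dom \<mu> \<union> dom U \<and>
     (\<forall>\<mu>'. \<mu> ++ U \<subseteq>\<^sub>m \<mu>' \<longrightarrow> Q res \<mu>'))"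

text \<open>\<open>K\<close> collects words known to be in local memory and \<open>l\<close> bounds
  its length. Quantifying over all states with these two properties hides the recorded history, so
  that derivability and room can be checked without computing it.\<close>

definition run :: "nat \<Rightarrow> 'k memory \<Rightarrow> 'k word set \<Rightarrow> nat \<Rightarrow> 'k code \<Rightarrow> loc set \<Rightarrow> nat \<Rightarrow> nat
    \<Rightarrow> ('k word list \<Rightarrow> 'k memory \<Rightarrow> bool) \<Rightarrow> bool" where
  "run L \<mu> K l c X w d Q \<longleftrightarrow> (\<forall>f s. fresh f \<mu> X \<longrightarrow> runs_at s c \<longrightarrow> K \<subseteq> set s \<longrightarrow> length s \<le> l \<longrightarrow>
     spec L f \<mu> s X w d Q)"

definition call :: "nat \<Rightarrow> 'k memory \<Rightarrow> 'k word list \<Rightarrow> loc set \<Rightarrow> nat \<Rightarrow> nat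
    \<Rightarrow> ('k word list \<Rightarrow> 'k memory \<Rightarrow> bool) \<Rightarrow> bool" where
  "call L \<mu> a X w d Q \<longleftrightarrow> (\<forall>f. fresh f \<mu> X \<longrightarrow> spec L f \<mu> (enc_state a []) X w d Q)"

lemma spec_mono:
  assumes "spec L f \<mu> s X w d Q" "L \<le> L'" "w \<le> w'" "d \<le> d'"
    and "\<And>res \<mu>'. \<mu> \<subseteq>\<^sub>m \<mu>' \<Longrightarrow> Q res \<mu>' \<Longrightarrow> Q' res \<mu>'"
  shows "spec L' f \<mu> s X w' d' Q'"
proof -
  from assms(1) obtain res R U w0 d0 where
    "exec B W (program_of body) L f \<mu> s (Outcome res R U w0 d0)" and *: "w0 \<le> w" "d0 \<le> d"
     "dom U \<inter> dom \<mu> = {}" "dom U \<subseteq> X \<union> range f \<times> UNIV" "R \<subseteq> dom \<mu> \<union> dom U"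
     "\<And>\<mu>'. \<mu> ++ U \<subseteq>\<^sub>m \<mu>' \<Longrightarrow> Q res \<mu>'"
    unfolding spec_def by blast
  moreover have "\<mu> \<subseteq>\<^sub>m \<mu> ++ U" using *(3)
    by (metis map_add_comm map_le_map_add)
  ultimately show ?thesis unfolding spec_def using exec_mono[OF _ assms(2)] assms(3-5)
    by (meson le_trans map_le_trans)
qed

lemma call_mono:
  assumes "call L \<mu> a X w d Q" "L \<le> L'" "w \<le> w'" "d \<le> d'"
    and "\<And>res \<mu>'. \<mu> \<subseteq>\<^sub>m \<mu>' \<Longrightarrow> Q res \<mu>' \<Longrightarrow> Q' res \<mu>'"
  shows "call L' \<mu> a X w' d' Q'"
  using assms spec_mono unfolding call_def by blast

lemma run_mono:
  assumes "run L \<mu> K l c X w d Q" "w \<le> w'" "d \<le> d'"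
    and "\<And>res \<mu>'. \<mu> \<subseteq>\<^sub>m \<mu>' \<Longrightarrow> Q res \<mu>' \<Longrightarrow> Q' res \<mu>'"
  shows "run L \<mu> K l c X w' d' Q'"
  using assms spec_mono[of L _ _ _ _ w d Q L w' d' Q'] unfolding run_def by blast

text \<open>The summand 2 is for the tag of an encoded state and the length word of its
  arguments.\<close>

lemma callI:
  assumes "run L \<mu> (set a) (length a + 2) (body a) X w d Q"
  shows "call L \<mu> a X w d Q"
proof -
  have "runs_at (enc_state a []) (body a)" unfolding runs_at_def by force
  moreover have "set a \<subseteq> set (enc_state a [])" "length (enc_state a []) \<le> length a + 2"
    by (auto simp: enc_state_def enc_list_def)
  ultimately show ?thesis using assms unfolding run_def call_def by blast
qed

lemma runs_at_program: "runs_at s c \<Longrightarrow> program_of body s = instr_of s c"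
  unfolding runs_at_def using program_of_enc_state by blast

lemma runs_at_advance: "runs_at s c \<Longrightarrow> runs_at (s @ enc_resp rs) (advance c rs)"
  unfolding runs_at_def by (force simp: enc_state_snoc)

lemma run_Ret:
  assumes "set ws \<subseteq> K \<union> Num ` {..<W}" "l \<le> L" "length ws \<le> L"
    and "\<And>\<mu>'. \<mu> \<subseteq>\<^sub>m \<mu>' \<Longrightarrow> Q ws \<mu>'"
  shows "run L \<mu> K l (Ret ws) X w d Q"
  unfolding run_def
proof (intro allI impI)
  fix f s assume *: "fresh f \<mu> X" "runs_at s (Ret ws)" "K \<subseteq> set s" "length s \<le> l"
  then have "exec B W (program_of body) L f \<mu> s (Outcome ws {} Map.empty 0 0)"
    using assms by (intro exec.halt) (auto simp: runs_at_program derivable_def)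
  then show "spec L f \<mu> s X w d Q"
    unfolding spec_def using assms(4) by fastforce
qed

lemma run_Ld:
  assumes "Ref r \<in> K" "i < W" "\<mu> (r, i) = Some blk" "l + length blk + 2 \<le> L" "L < W"
    and k: "run L \<mu> (K \<union> set blk) (l + length blk + 2) (k blk) X w d Q"
  shows "run L \<mu> K l (Ld r i k) X (Suc w) (Suc d) Q"
  unfolding run_def
proof (intro allI impI)
  fix f s assume *: "fresh f \<mu> X" "runs_at s (Ld r i k)" "K \<subseteq> set s" "length s \<le> l"
  let ?s = "s @ enc_resp [blk]"
  have "runs_at ?s (k blk)" using runs_at_advance[OF *(2), of "[blk]"] by simp
  moreover have "K \<union> set blk \<subseteq> set ?s" "length ?s \<le> l + length blk + 2"
    using *(3,4) by (auto simp: enc_resp_def enc_list_def)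
  ultimately have "spec L f \<mu> ?s X w d Q"
    using k *(1) unfolding run_def by blast
  then obtain res R U w' d' where e: "exec B W (program_of body) L f \<mu> ?s (Outcome res R U w' d')"
    and **: "w' \<le> w" "d' \<le> d" "dom U \<inter> dom \<mu> = {}" "dom U \<subseteq> X \<union> range f \<times> UNIV"
      "R \<subseteq> dom \<mu> \<union> dom U" "\<forall>\<mu>'. \<mu> ++ U \<subseteq>\<^sub>m \<mu>' \<longrightarrow> Q res \<mu>'"
    unfolding spec_def by blast
  have "exec B W (program_of body) L f \<mu> s (Outcome res (insert (r, i) R) U (Suc w') (Suc d'))"
  proof (rule exec.load)
    show "program_of body s = Load r i (\<lambda>blk. s @ enc_resp [blk])"
      using runs_at_program[OF *(2)] by simp
    show "derivable L W (s @ blk) ?s"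
      using assms(4,5) *(4) by (auto simp: derivable_def enc_resp_def enc_list_def)
  qed (use assms(1-3) *(3) e in auto)
  moreover have "insert (r, i) R \<subseteq> dom \<mu> \<union> dom U" using assms(3) **(5) by auto
  ultimately show "spec L f \<mu> s X (Suc w) (Suc d) Q"
    unfolding spec_def using ** Suc_le_mono by blast
qed

text \<open>A written location leaves \<open>X\<close>, so no location is written twice and the
  memory only grows. The continuation may assume that the location was free, which is how later
  memories are shown to extend earlier ones.\<close>

lemma run_St:
  assumes "Ref r \<in> K" "i < W" "length blk \<le> B" "set blk \<subseteq> K \<union> Num ` {..<W}" "(r, i) \<in> X"
    and "l + 1 \<le> L" "B \<le> L" "0 < W"
    and k: "(r, i) \<notin> dom \<mu> \<Longrightarrow> run L (\<mu>((r, i) \<mapsto> blk)) K (l + 1) c (X - {(r, i)}) w d Q"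
  shows "run L \<mu> K l (St r i blk c) X (Suc w) (Suc d) Q"
  unfolding run_def
proof (intro allI impI)
  fix f s assume *: "fresh f \<mu> X" "runs_at s (St r i blk c)" "K \<subseteq> set s" "length s \<le> l"
  let ?s = "s @ enc_resp []" and ?m = "\<mu>((r, i) \<mapsto> blk)"
  have ni: "(r, i) \<notin> dom \<mu>" using *(1) assms(5) by (auto simp: fresh_def)
  have "runs_at ?s c" using runs_at_advance[OF *(2), of "[]"] by simp
  moreover have "fresh f ?m (X - {(r, i)})" using *(1) assms(5) by (auto simp: fresh_def)
  moreover have "K \<subseteq> set ?s" "length ?s \<le> l + 1" using *(3,4) by (auto simp: enc_resp_def)
  ultimately have "spec L f ?m ?s (X - {(r, i)}) w d Q"
    using k[OF ni] unfolding run_def by blast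
  then obtain res R U w' d' where e: "exec B W (program_of body) L f ?m ?s (Outcome res R U w' d')"
    and **: "w' \<le> w" "d' \<le> d" "dom U \<inter> dom ?m = {}" "dom U \<subseteq> (X - {(r, i)}) \<union> range f \<times> UNIV"
      "R \<subseteq> dom ?m \<union> dom U" "\<And>\<mu>'. ?m ++ U \<subseteq>\<^sub>m \<mu>' \<Longrightarrow> Q res \<mu>'"
    unfolding spec_def by blast
  let ?U = "[(r, i) \<mapsto> blk] ++ U"
  have "exec B W (program_of body) L f \<mu> s (Outcome res R ?U (Suc w') (Suc d'))"
  proof (rule exec.store)
    show "program_of body s = Store r i blk ?s"
      using runs_at_program[OF *(2)] by simp
    show "derivable L W s ?s" "derivable L W s blk"
      using assms(3,4,6-8) *(3,4) by (auto simp: derivable_def enc_resp_def)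
  qed (use assms(1-3) *(3) e in auto)
  moreover have "\<mu> ++ ?U = ?m ++ U" by (simp add: map_add_assoc)
  moreover have "dom ?U \<inter> dom \<mu> = {}" "dom ?U \<subseteq> X \<union> range f \<times> UNIV" "R \<subseteq> dom \<mu> \<union> dom ?U"
    using **(3-5) ni assms(5) by auto
  ultimately show "spec L f \<mu> s X (Suc w) (Suc d) Q"
    unfolding spec_def using **(1,2,6) Suc_le_mono by metis
qed

text \<open>All locations of the new region become writable. The three words added are the number of
  lists in the response, the length of its only list, and the reference.\<close>

lemma run_Al:
  assumes "l + 3 \<le> L" "1 < W"
    and k: "\<And>r. run L \<mu> (insert (Ref r) K) (l + 3) (k r) (X \<union> {r} \<times> UNIV) w d Q"
  shows "run L \<mu> K l (Al k) X w d Q"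
  unfolding run_def
proof (intro allI impI)
  fix f s assume *: "fresh f \<mu> X" "runs_at s (Al k)" "K \<subseteq> set s" "length s \<le> l"
  let ?r = "f 0" let ?s = "s @ enc_resp [[Ref ?r]]" and ?X = "X \<union> {?r} \<times> UNIV"
  have "runs_at ?s (k ?r)" using runs_at_advance[OF *(2), of "[[Ref ?r]]"] by simp
  moreover have "fresh (f \<circ> Suc) \<mu> ?X"
    using *(1) unfolding fresh_iff by (fastforce simp: inj_def)
  moreover have "insert (Ref ?r) K \<subseteq> set ?s" "length ?s \<le> l + 3"
    using *(3,4) by (auto simp: enc_resp_def enc_list_def)
  ultimately have "spec L (f \<circ> Suc) \<mu> ?s ?X w d Q"
    using k[of ?r] unfolding run_def by blast
  then obtain res R U w' d' where
    e: "exec B W (program_of body) L (f \<circ> Suc) \<mu> ?s (Outcome res R U w' d')"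
    and **: "w' \<le> w" "d' \<le> d" "dom U \<inter> dom \<mu> = {}" "dom U \<subseteq> ?X \<union> range (f \<circ> Suc) \<times> UNIV"
      "R \<subseteq> dom \<mu> \<union> dom U" "\<forall>\<mu>'. \<mu> ++ U \<subseteq>\<^sub>m \<mu>' \<longrightarrow> Q res \<mu>'"
    unfolding spec_def by blast
  have "exec B W (program_of body) L f \<mu> s (Outcome res R U w' d')"
  proof (rule exec.alloc)
    show "program_of body s = Alloc (\<lambda>r. s @ enc_resp [[Ref r]])"
      using runs_at_program[OF *(2)] by simp
    show "derivable L W (s @ [Ref (f 0)]) ?s"
      using assms(1,2) *(4) by (auto simp: derivable_def enc_resp_def enc_list_def)
  qed (fact e)
  moreover have "dom U \<subseteq> X \<union> range f \<times> UNIV" using **(4) by auto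
  ultimately show "spec L f \<mu> s X w d Q"
    unfolding spec_def using ** by blast
qed

end

lemma fresh_subset:
  assumes "fresh f \<mu> X" "inj g" "range g \<subseteq> range f" "Y \<subseteq> X"
  shows "fresh g \<mu> Y"
proof -
  have "range g \<times> UNIV \<subseteq> range f \<times> UNIV" using assms(3) by (rule Sigma_mono) simp
  then have "range g \<times> UNIV \<inter> (dom \<mu> \<union> Y) \<subseteq> range f \<times> UNIV \<inter> (dom \<mu> \<union> X)"
    using assms(4) by (intro Int_mono Un_mono order_refl)
  moreover have "Y \<inter> dom \<mu> \<subseteq> X \<inter> dom \<mu>" using assms(4) by (intro Int_mono order_refl)
  ultimately show ?thesis using assms(1,2) unfolding fresh_def by (metis subset_empty)
qed

lemma Un_disjoint:
  "U \<subseteq> Y \<union> R \<Longrightarrow> U' \<subseteq> Y' \<union> R' \<Longrightarrow> Y \<inter> Y' = {} \<Longrightarrow> Y \<inter> R' = {} \<Longrightarrow> R \<inter> Y' = {} \<Longrightarrow> R \<inter> R' = {} \<Longrightarrow>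
    U \<inter> U' = {}"
  by blast

lemma length_concat_le_enc_resp: "length (concat rs) \<le> length (enc_resp rs)"
  unfolding enc_resp_def by (induction rs) (simp_all add: enc_list_def)

lemma set_enc_resp: "set (enc_resp rs) \<subseteq> set (concat rs) \<union> Num ` insert (length rs) (length ` set rs)"
  unfolding enc_resp_def by (auto simp: enc_list_def)

lemma UN_Int_empty: "(\<And>i. i < (n::nat) \<Longrightarrow> F i \<inter> Z = {}) \<Longrightarrow> (\<Union>i<n. F i) \<inter> Z = {}"
  by auto

lemma Int_Diff_UN_empty: "i < (n::nat) \<Longrightarrow> Y i \<inter> (X - (\<Union>i<n. Y i)) = {}"
  by auto

lemma subset_Un_disjoint: "U \<subseteq> Y \<union> R \<Longrightarrow> Y \<inter> Z = {} \<Longrightarrow> R \<inter> Z = {} \<Longrightarrow> U \<inter> Z = {}"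
  by blast

lemma freshD:
  assumes "fresh f \<mu> X"
  shows "inj f" "X \<inter> dom \<mu> = {}" "range f \<times> UNIV \<inter> dom \<mu> = {}" "range f \<times> UNIV \<inter> X = {}"
  using assms by (simp_all add: fresh_def Int_Un_distrib)

context machine begin

lemma run_weaken:
  assumes "run L \<mu> K' l' c X' w d Q" "K' \<subseteq> K" "l \<le> l'" "X' \<subseteq> X"
  shows "run L \<mu> K l c X w d Q"
  unfolding run_def
proof (intro allI impI)
  fix f s assume *: "fresh f \<mu> X" "runs_at s c" "K \<subseteq> set s" "length s \<le> l"
  have "inj f" using *(1) by (simp add: fresh_def)
  have "fresh f \<mu> X'" using fresh_subset[OF *(1) \<open>inj f\<close> order_refl assms(4)] .
  moreover have "K' \<subseteq> set s" "length s \<le> l'" using *(3,4) assms(2,3) by auto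
  ultimately have "spec L f \<mu> s X' w d Q" using assms(1) *(2) unfolding run_def by blast
  then obtain res R U w' d' where "exec B W (program_of body) L f \<mu> s (Outcome res R U w' d')"
    and **: "w' \<le> w" "d' \<le> d" "dom U \<inter> dom \<mu> = {}" "dom U \<subseteq> X' \<union> range f \<times> UNIV"
      "R \<subseteq> dom \<mu> \<union> dom U" "\<forall>\<mu>'. \<mu> ++ U \<subseteq>\<^sub>m \<mu>' \<longrightarrow> Q res \<mu>'"
    unfolding spec_def by blast
  moreover have "dom U \<subseteq> X \<union> range f \<times> UNIV"
    using order_trans[OF **(4) Un_mono[OF assms(4) order_refl]] .
  ultimately show "spec L f \<mu> s X w d Q" unfolding spec_def by blast
qed

lemma specI:
  assumes "exec B W (program_of body) L f \<mu> s (Outcome res R U w' d')" "w' \<le> w" "d' \<le> d"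
    "dom U \<inter> dom \<mu> = {}" "dom U \<subseteq> X \<union> range f \<times> UNIV" "R \<subseteq> dom \<mu> \<union> dom U"
    "\<forall>\<mu>'. \<mu> ++ U \<subseteq>\<^sub>m \<mu>' \<longrightarrow> Q res \<mu>'"
  shows "spec L f \<mu> s X w d Q"
  using assms unfolding spec_def by blast

text \<open>The children receive disjoint parts \<open>Y i\<close> of \<open>X\<close> and disjoint
  shares of the allocator, so their writes are disjoint; their reads lie in the old memory or among
  their own writes, hence there is no race. The joined memory extends the final memory of each
  child, so all postconditions are available to the continuation.\<close>

lemma run_Fk:
  fixes n :: nat
  assumes n: "length cs = n" "n \<le> B"
    and cs: "\<And>a. a \<in> set cs \<Longrightarrow> set a \<subseteq> K \<union> Num ` {..<W} \<and> length a < W" "(\<Sum>a\<leftarrow>cs. length a + 2) \<le> L"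
    and child: "\<And>i. i < n \<Longrightarrow> call (L - l) \<mu> (cs ! i) (Y i) (ws i) dc (P i)"
    and len: "\<And>i res \<mu>'. i < n \<Longrightarrow> P i res \<mu>' \<Longrightarrow> length res \<le> b"
    and L: "l + 1 + n * (b + 1) \<le> L" "L < W" "1 < W" "B < W"
    and Y: "\<And>i. i < n \<Longrightarrow> Y i \<subseteq> X" "\<And>i j. i < n \<Longrightarrow> j < n \<Longrightarrow> i \<noteq> j \<Longrightarrow> Y i \<inter> Y j = {}"
    and k: "\<And>rs \<mu>'. length rs = n \<Longrightarrow> \<mu> \<subseteq>\<^sub>m \<mu>' \<Longrightarrow> (\<And>i \<mu>''. i < n \<Longrightarrow> \<mu>' \<subseteq>\<^sub>m \<mu>'' \<Longrightarrow> P i (rs ! i) \<mu>'') \<Longrightarrow>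
        run L \<mu>' (K \<union> (\<Union>r\<in>set rs. set r)) (l + 1 + n * (b + 1)) (k rs) (X - (\<Union>i<n. Y i)) w d Q"
  shows "run L \<mu> K l (Fk cs k) X ((\<Sum>i<n. ws i) + w) (dc + d) Q"
  unfolding run_def
proof (intro allI impI)
  fix f s assume *: "fresh f \<mu> X" "runs_at s (Fk cs k)" "K \<subseteq> set s" "length s \<le> l"
  have "inj f" using *(1) unfolding fresh_def by blast
  \<comment> \<open>\<open>prod_encode\<close> is injective, so shares of an injective enumeration
    are injective and have pairwise disjoint ranges.\<close>
  then have share_eq: "share f i x = share f j y \<longleftrightarrow> i = j \<and> x = y" for i j x y
    unfolding share_def by (simp add: inj_eq)
  have share: "inj (share f i)" "range (share f i) \<subseteq> range f" for i
    by (simp add: inj_def share_eq) (auto simp: share_def)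
  have share_disj: "range (share f i) \<inter> range (share f j) = {}" if "i \<noteq> j" for i j
    using that by (auto simp: share_eq)
  have fr: "fresh (share f (Suc i)) \<mu> (Y i)" if "i < n" for i
    using fresh_subset[OF *(1) share(1,2) Y(1)[OF that]] .
  have Y_range: "Y i \<inter> range (share f j) \<times> UNIV = {}" if "i < n" for i j
  proof -
    have "range (share f j) \<times> UNIV \<subseteq> range f \<times> UNIV" by (rule Sigma_mono[OF share(2)]) simp
    moreover have "X \<inter> range f \<times> UNIV = {}" using *(1) by (auto simp: fresh_def)
    ultimately show ?thesis using Y(1)[OF that] by blast
  qed
  have "\<exists>out. exec B W (program_of body) (L - length s) (share f (Suc i)) \<mu> (enc_state (cs ! i) []) out
      \<and> io_work out \<le> ws i \<and> io_span out \<le> dc \<and>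
      dom (io_writes out) \<inter> dom \<mu> = {} \<and>
      dom (io_writes out) \<subseteq> Y i \<union> range (share f (Suc i)) \<times> UNIV \<and>
      io_reads out \<subseteq> dom \<mu> \<union> dom (io_writes out) \<and>
      (\<forall>\<mu>'. \<mu> ++ io_writes out \<subseteq>\<^sub>m \<mu>' \<longrightarrow> P i (result out) \<mu>')" (is "\<exists>out. ?G i out") if "i < n" for i
  proof -
    have "spec (L - l) (share f (Suc i)) \<mu> (enc_state (cs ! i) []) (Y i) (ws i) dc (P i)"
      using child[OF that] fr[OF that] unfolding call_def by blast
    then obtain res R U w' d' where
      e: "exec B W (program_of body) (L - l) (share f (Suc i)) \<mu> (enc_state (cs ! i) []) (Outcome res R U w' d')"
      and **: "w' \<le> ws i" "d' \<le> dc" "dom U \<inter> dom \<mu> = {}" "dom U \<subseteq> Y i \<union> range (share f (Suc i)) \<times> UNIV"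
        "R \<subseteq> dom \<mu> \<union> dom U" "\<forall>\<mu>'. \<mu> ++ U \<subseteq>\<^sub>m \<mu>' \<longrightarrow> P i res \<mu>'"
      unfolding spec_def by blast
    have "exec B W (program_of body) (L - length s) (share f (Suc i)) \<mu> (enc_state (cs ! i) []) (Outcome res R U w' d')"
      by (rule exec_mono[OF e]) (use *(4) in linarith)
    with ** show ?thesis by (intro exI[of _ "Outcome res R U w' d'"]) simp
  qed
  then obtain g where g: "?G i (g i)" if "i < n" for i by metis
  define os where "os = map g [0..<n]"
  have len_os: "length os = n" and nth_os: "i < n \<Longrightarrow> os ! i = g i" for i by (auto simp: os_def)
  have G: "?G i (os ! i)" if "i < n" for i using g[OF that] nth_os[OF that] by simp
  note G0 = G[THEN conjunct1] and G1 = G[THEN conjunct2]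
  note Gw = G1[THEN conjunct1] and G2 = G1[THEN conjunct2]
  note Gs = G2[THEN conjunct1] and G3 = G2[THEN conjunct2]
  note Gm = G3[THEN conjunct1] and G4 = G3[THEN conjunct2]
  note Gd = G4[THEN conjunct1] and G5 = G4[THEN conjunct2]
  note Gr = G5[THEN conjunct1] and Gp = G5[THEN conjunct2]
  have disj: "dom (io_writes (os ! i)) \<inter> dom (io_writes (os ! j)) = {}"
    if "i < n" "j < n" "i \<noteq> j" for i j
  proof -
    have "range (share f (Suc i)) \<times> UNIV \<inter> Y j = {}" "Y i \<inter> range (share f (Suc j)) \<times> UNIV = {}"
      using Y_range that by (metis inf_commute)+
    moreover have "range (share f (Suc i)) \<times> (UNIV :: nat set) \<inter> range (share f (Suc j)) \<times> UNIV = {}"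
      using share_disj[of "Suc i" "Suc j"] that(3) by auto
    ultimately show ?thesis
      by (intro Un_disjoint[OF Gd[OF that(1)] Gd[OF that(2)] Y(2)[OF that]])
  qed
  have race: "race_free os"
    unfolding race_free_def len_os
  proof (intro allI impI)
    fix i j assume ij: "i < n" "j < n" "i \<noteq> j"
    show "dom (io_writes (os ! i)) \<inter> (io_reads (os ! j) \<union> dom (io_writes (os ! j))) = {}"
      using disj[OF ij] Gm[OF ij(1)] Gr[OF ij(2)] by blast
  qed
  define J where "J = joined_writes os"
  have Jdom: "dom J = (\<Union>i<n. dom (io_writes (os ! i)))"
    unfolding J_def joined_writes_dom using len_os by (force simp: in_set_conv_nth)
  have Jle: "io_writes (os ! i) \<subseteq>\<^sub>m J" if "i < n" for i
    unfolding J_def using joined_writes_le[of i os] disj that len_os by simp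
  have Jmu: "dom J \<inter> dom \<mu> = {}" unfolding Jdom using Gm by blast
  have muJ: "\<mu> \<subseteq>\<^sub>m \<mu> ++ J" using Jmu by (metis map_add_comm map_le_map_add)
  let ?rs = "map result os"
  \<comment> \<open>Postconditions were required for all later memories, and the joined memory is
    later than the final memory of any one child.\<close>
  have P: "P i (?rs ! i) \<mu>'" if "i < n" "\<mu> ++ J \<subseteq>\<^sub>m \<mu>'" for i \<mu>'
  proof -
    have "\<mu> ++ io_writes (os ! i) \<subseteq>\<^sub>m \<mu> ++ J"
      using map_add_le_mapI[OF muJ map_le_trans[OF Jle[OF that(1)] map_le_map_add]] .
    then show ?thesis using Gp[OF that(1)] that len_os map_le_trans by fastforce
  qed
  let ?s = "s @ enc_resp ?rs"
  have at: "runs_at ?s (k ?rs)" using runs_at_advance[OF *(2), of ?rs] by simp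
  have reslen: "length r \<le> b" if "r \<in> set ?rs" for r
  proof -
    from that obtain i where "i < n" "r = ?rs ! i" using len_os by (metis in_set_conv_nth length_map)
    then show ?thesis using len P[OF _ map_le_refl] by blast
  qed
  have sum: "(\<Sum>r\<leftarrow>?rs. length r + 1) \<le> n * (b + 1)"
  proof -
    have "(\<Sum>r\<leftarrow>?rs. length r + 1) \<le> (\<Sum>r\<leftarrow>?rs. b + 1)"
      by (rule sum_list_mono) (use reslen in auto)
    then show ?thesis unfolding sum_list_triv using len_os by simp
  qed
  have lenr: "length (enc_resp ?rs) = 1 + (\<Sum>r\<leftarrow>?rs. length r + 1)"
    unfolding enc_resp_def by (simp add: length_concat enc_list_def map_map o_def)
  have fr0: "fresh (share f 0) (\<mu> ++ J) (X - (\<Union>i<n. Y i))"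
  proof -
    note fr' = fresh_subset[OF *(1) share(1,2) Diff_subset]
    have "dom (io_writes (os ! i)) \<inter> range (share f 0) \<times> UNIV = {}" if "i < n" for i
    proof (rule subset_Un_disjoint[OF Gd[OF that] Y_range[OF that]])
      show "range (share f (Suc i)) \<times> (UNIV :: nat set) \<inter> range (share f 0) \<times> UNIV = {}"
        using share_disj[of "Suc i" 0] by auto
    qed
    then have J1: "dom J \<inter> range (share f 0) \<times> UNIV = {}" unfolding Jdom by (rule UN_Int_empty)
    have "dom (io_writes (os ! i)) \<inter> (X - (\<Union>i<n. Y i)) = {}" if "i < n" for i
    proof (rule subset_Un_disjoint[OF Gd[OF that]])
      show "Y i \<inter> (X - (\<Union>i<n. Y i)) = {}" by (rule Int_Diff_UN_empty[OF that])
      show "range (share f (Suc i)) \<times> UNIV \<inter> (X - (\<Union>i<n. Y i)) = {}"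
        by (rule freshD(4)[OF fr'])
    qed
    then have J2: "dom J \<inter> (X - (\<Union>i<n. Y i)) = {}" unfolding Jdom by (rule UN_Int_empty)
    show ?thesis
      unfolding fresh_def dom_map_add Int_Un_distrib using freshD[OF fr'] J1 J2
      by (simp only: Int_commute Un_empty simp_thms)
  qed
  have rset: "K \<union> (\<Union>r\<in>set ?rs. set r) \<subseteq> set ?s"
    using *(3) by (auto simp: enc_resp_def enc_list_def)
  have "spec L (share f 0) (\<mu> ++ J) ?s (X - (\<Union>i<n. Y i)) w d Q"
  proof -
    have "run L (\<mu> ++ J) (K \<union> (\<Union>r\<in>set ?rs. set r)) (l + 1 + n * (b + 1)) (k ?rs) (X - (\<Union>i<n. Y i)) w d Q"
      by (rule k) (use len_os muJ P in auto)
    moreover have "length ?s \<le> l + 1 + n * (b + 1)" using *(4) lenr sum by simp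
    ultimately show ?thesis unfolding run_def
      using fr0 at rset by blast
  qed
  then obtain res R U w' d' where
    e: "exec B W (program_of body) L (share f 0) (\<mu> ++ J) ?s (Outcome res R U w' d')"
    and **: "w' \<le> w" "d' \<le> d" "dom U \<inter> dom (\<mu> ++ J) = {}"
      "dom U \<subseteq> (X - (\<Union>i<n. Y i)) \<union> range (share f 0) \<times> UNIV"
      "R \<subseteq> dom (\<mu> ++ J) \<union> dom U" "\<forall>\<mu>'. \<mu> ++ J ++ U \<subseteq>\<^sub>m \<mu>' \<longrightarrow> Q res \<mu>'"
    unfolding spec_def by blast
  have ex: "exec B W (program_of body) L f \<mu> s
      (Outcome res ((\<Union>out\<in>set os. io_reads out) \<union> R) (joined_writes os ++ U)
              (sum_list (map io_work os) + w') (foldr max (map io_span os) 0 + d'))"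
  proof (rule exec.fork)
    show "program_of body s = Fork (map (\<lambda>a. enc_state a []) cs) (\<lambda>rs. s @ enc_resp rs)"
      using runs_at_program[OF *(2)] by simp
    show "length (map (\<lambda>a. enc_state a []) cs) \<le> B" using n by simp
    show "derivable L W s (concat (map (\<lambda>a. enc_state a []) cs))"
    proof -
      have "length (concat (map (\<lambda>a. enc_state a []) cs)) = (\<Sum>a\<leftarrow>cs. length a + 2)"
        by (simp add: length_concat enc_state_def enc_list_def comp_def)
      moreover have "set (concat (map (\<lambda>a. enc_state a []) cs)) \<subseteq> set s \<union> Num ` {..<W}"
      proof -
        have "set (enc_state a []) \<subseteq> set s \<union> Num ` {..<W}" if "a \<in> set cs" for a
          using cs(1)[OF that] *(3) L(3) unfolding enc_state_def enc_list_def by auto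
        then show ?thesis by auto
      qed
      ultimately show ?thesis using cs(2) *(4) L(1) by (auto simp: derivable_def)
    qed
    show "derivable L W (s @ concat (map result os)) ?s"
    proof -
      have "length (concat ?rs) \<le> length (enc_resp ?rs)"
        by (rule length_concat_le_enc_resp)
      moreover have "length (enc_resp ?rs) \<le> 1 + n * (b + 1)" using lenr sum by simp
      moreover have "length r < W" if "r \<in> set ?rs" for r
      proof -
        \<comment> \<open>Length words must be machine integers: for \<open>n > 0\<close> a single
          result fits into the \<open>n * (b + 1)\<close> words accounted for, which are below
          \<open>L < W\<close>.\<close>
        have "n \<noteq> 0" using that len_os by auto
        then have "b + 1 \<le> n * (b + 1)" using mult_le_mono1[of 1 n "b + 1"] by simp
        then show ?thesis using reslen[OF that] L(1,2) by linarith
      qed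
      then have "insert (length ?rs) (length ` set ?rs) \<subseteq> {..<W}"
        using n(2) L(4) len_os by auto
      then have "set (enc_resp ?rs) \<subseteq> set (concat ?rs) \<union> Num ` {..<W}"
        by (intro order_trans[OF set_enc_resp] Un_mono order_refl image_mono)
      then have "set ?s \<subseteq> set (s @ concat ?rs) \<union> Num ` {..<W}" by auto
      moreover have "length (s @ concat ?rs) \<le> L" "length ?s \<le> L"
        using calculation(1,2) *(4) L(1) by simp_all
      ultimately show ?thesis unfolding derivable_def by blast
    qed
    show "\<forall>i<length (map (\<lambda>a. enc_state a []) cs).
       exec B W (program_of body) (L - length s) (share f (Suc i)) \<mu> (map (\<lambda>a. enc_state a []) cs ! i) (os ! i)"
      using G0 n by simp
  qed (use len_os n race e in \<open>simp_all add: J_def\<close>)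
  have "sum_list (map io_work os) \<le> (\<Sum>i<n. ws i)"
  proof -
    have "sum_list (map io_work os) = (\<Sum>i<n. io_work (os ! i))"
      using len_os by (simp add: sum_list_sum_nth atLeast0LessThan)
    also have "\<dots> \<le> (\<Sum>i<n. ws i)" by (rule sum_mono) (use Gw in auto)
    finally show ?thesis .
  qed
  moreover have "foldr max (map io_span os) 0 \<le> dc"
  proof -
    have "\<forall>out\<in>set os. io_span out \<le> dc" using Gs len_os by (metis in_set_conv_nth)
    then show ?thesis by (induction os) auto
  qed
  moreover have "dom (joined_writes os ++ U) \<inter> dom \<mu> = {}"
    using **(3) Jmu by (auto simp: J_def)
  moreover have "dom (joined_writes os ++ U) \<subseteq> X \<union> range f \<times> UNIV"
  proof -
    have sub: "range (share f j) \<times> UNIV \<subseteq> range f \<times> UNIV" for j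
      by (rule Sigma_mono[OF share(2)]) simp
    have "dom (io_writes (os ! i)) \<subseteq> X \<union> range f \<times> UNIV" if "i < n" for i
      by (rule order_trans[OF Gd[OF that] Un_mono[OF Y(1)[OF that] sub]])
    then have "dom J \<subseteq> X \<union> range f \<times> UNIV" unfolding Jdom by (rule UN_least) simp
    moreover have "dom U \<subseteq> X \<union> range f \<times> UNIV"
      using **(4) Un_mono[OF Diff_subset sub[of 0]] by (rule order_trans)
    ultimately show ?thesis unfolding J_def[symmetric] dom_map_add by (rule Un_least[rotated])
  qed
  moreover have "(\<Union>out\<in>set os. io_reads out) \<union> R \<subseteq> dom \<mu> \<union> dom (joined_writes os ++ U)"
  proof -
    have "io_reads out \<subseteq> dom \<mu> \<union> dom J" if "out \<in> set os" for out
    proof -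
      from that obtain i where "i < n" "out = os ! i" using len_os by (metis in_set_conv_nth)
      then have "io_reads out \<subseteq> dom \<mu> \<union> dom (io_writes out)" "dom (io_writes out) \<subseteq> dom J"
        using Gr Jdom by auto
      then show ?thesis by blast
    qed
    then have "(\<Union>out\<in>set os. io_reads out) \<subseteq> dom \<mu> \<union> dom J" by (rule UN_least)
    then show ?thesis using **(5) unfolding J_def[symmetric] dom_map_add by auto
  qed
  moreover have "\<forall>\<mu>'. \<mu> ++ (joined_writes os ++ U) \<subseteq>\<^sub>m \<mu>' \<longrightarrow> Q res \<mu>'"
    using **(6) by (simp add: J_def)
  ultimately show "spec L f \<mu> s X ((\<Sum>i<n. ws i) + w) (dc + d) Q"
    using **(1,2) by (intro specI[OF ex] add_mono) simp_all
qed

end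

section \<open>Trees, units and regrouping\<close>

fun mix :: "'a list \<Rightarrow> 'a list list \<Rightarrow> 'a list" where
  "mix (k # ks) (t # ts) = t @ k # mix ks ts"
| "mix [] (t # ts) = t"
| "mix _ [] = []"

lemma set_mix: "length ts = length ks + 1 \<Longrightarrow> set (mix ks ts) = set ks \<union> (\<Union>t\<in>set ts. set t)"
proof (induction ks ts rule: mix.induct)
  case (2 t ts)
  then show ?case by (cases ts) auto
qed auto

text \<open>This turns the search-tree order into strict sortedness of one list. Comparing the first
  key with everything to its right is the point: an element beyond the next list lies above some
  later key, and so above the first.\<close>

lemma sorted_mix_iff:
  fixes ks :: "'a::linorder list"
  assumes "length ts = length ks + 1"
  shows "sorted_wrt (<) (mix ks ts) \<longleftrightarrow>
    sorted_wrt (<) ks \<and> (\<forall>t\<in>set ts. sorted_wrt (<) t) \<and>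
    (\<forall>i<length ks. (\<forall>x\<in>set (ts ! i). x < ks ! i) \<and> (\<forall>x\<in>set (ts ! Suc i). ks ! i < x))"
  using assms
proof (induction ks ts rule: mix.induct)
  case (1 k ks t ts)
  have l: "length ts = length ks + 1" using 1(2) by simp
  have ts: "ts \<noteq> []" using l by auto
  have hd: "\<forall>x\<in>set (ts ! 0). k < x" if "\<forall>x\<in>set (mix ks ts). k < x"
    using that set_mix[OF l] ts by (metis UN_I UnI2 length_greater_0_conv nth_mem)
  have all: "\<forall>x\<in>set (mix ks ts). k < x"
    if *: "\<forall>x\<in>set (ts ! 0). k < x" "\<forall>x\<in>set ks. k < x" "\<forall>i<length ks. \<forall>x\<in>set (ts ! Suc i). ks ! i < x"
  proof
    fix x assume "x \<in> set (mix ks ts)"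
    then consider "x \<in> set ks" | t where "t \<in> set ts" "x \<in> set t" using set_mix[OF l] by auto
    then show "k < x"
    proof cases
      case 2
      then obtain i where i: "i < length ts" "x \<in> set (ts ! i)" by (metis in_set_conv_nth)
      show ?thesis
      proof (cases i)
        case 0
        then show ?thesis using * i by simp
      next
        case (Suc j)
        then have "j < length ks" using i l by simp
        then have "k < ks ! j" "ks ! j < x" using * i Suc by simp_all
        then show ?thesis by (rule less_trans)
      qed
    qed (use * in auto)
  qed
  show ?case
  proof
    assume *: "sorted_wrt (<) (mix (k # ks) (t # ts))"
    then have **: "sorted_wrt (<) (mix ks ts)" "sorted_wrt (<) t" "\<forall>x\<in>set t. x < k"
      "\<forall>x\<in>set (mix ks ts). k < x"
      by (auto simp: sorted_wrt_append)
    moreover have "\<forall>x\<in>set ks. k < x" using **(4) set_mix[OF l] by auto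
    ultimately show "sorted_wrt (<) (k # ks) \<and> (\<forall>t\<in>set (t # ts). sorted_wrt (<) t) \<and>
      (\<forall>i<length (k # ks). (\<forall>x\<in>set ((t # ts) ! i). x < (k # ks) ! i) \<and>
        (\<forall>x\<in>set ((t # ts) ! Suc i). (k # ks) ! i < x))"
      using 1(1)[OF l] hd by (auto simp: nth_Cons split: nat.splits)
  next
    assume *: "sorted_wrt (<) (k # ks) \<and> (\<forall>t\<in>set (t # ts). sorted_wrt (<) t) \<and>
      (\<forall>i<length (k # ks). (\<forall>x\<in>set ((t # ts) ! i). x < (k # ks) ! i) \<and>
        (\<forall>x\<in>set ((t # ts) ! Suc i). (k # ks) ! i < x))"
    then have i: "\<forall>i<length ks. (\<forall>x\<in>set (ts ! i). x < ks ! i) \<and> (\<forall>x\<in>set (ts ! Suc i). ks ! i < x)"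
      by (metis Suc_less_eq length_Cons nth_Cons_Suc)
    have 0: "\<forall>x\<in>set t. x < k" "\<forall>x\<in>set (ts ! 0). k < x" using * by fastforce+
    have a: "\<forall>x\<in>set (mix ks ts). k < x" using all[OF 0(2)] i * by simp
    have "sorted_wrt (<) (mix ks ts)" using 1(1)[OF l] * i by simp
    moreover have "\<forall>x\<in>set t. \<forall>y\<in>set (mix ks ts). x < y" using 0(1) a less_trans by blast
    ultimately show "sorted_wrt (<) (mix (k # ks) (t # ts))"
      using * a 0 by (auto simp: sorted_wrt_append)
  qed
qed auto

fun inorder :: "'k btree \<Rightarrow> 'k list" where
  "inorder Ext = []"
| "inorder (Node ks ts) = mix ks (map inorder ts)"

text \<open>The common depth of the external nodes becomes a parameter and the number of children is
  included, so that one induction on the tree carries all shape conditions. \<open>lo\<close>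
  differs from \<open>B div 2\<close> at a root only.\<close>

fun balanced :: "nat \<Rightarrow> nat \<Rightarrow> nat \<Rightarrow> 'k btree \<Rightarrow> bool" where
  "balanced B lo h Ext \<longleftrightarrow> h = 0"
| "balanced B lo h (Node ks ts) \<longleftrightarrow> h > 0 \<and> lo \<le> length ks \<and> length ks \<le> B \<and>
     length ts = length ks + 1 \<and> (\<forall>t\<in>set ts. balanced B (B div 2) (h - 1) t)"

lemma balanced_mono: "balanced B lo h t \<Longrightarrow> lo' \<le> lo \<Longrightarrow> balanced B lo' h t"
  by (cases t) auto

lemma set_inorder: "balanced B lo h t \<Longrightarrow> set (inorder t) = keys t"
  by (induction B lo h t rule: balanced.induct) (auto simp: set_mix)

lemma search_tree_inorder:
  "balanced B lo h t \<Longrightarrow> search_tree t \<longleftrightarrow> sorted_wrt (<) (inorder t)"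
proof (induction B lo h t rule: balanced.induct)
  case (2 B lo h ks ts)
  then have len: "length (map inorder ts) = length ks + 1" by simp
  have k: "set (inorder t) = keys t" if "t \<in> set ts" for t using 2(2) that set_inorder[of B "B div 2" "h - 1" t] by simp
  have n: "i < length ts \<Longrightarrow> set (map inorder ts ! i) = keys (ts ! i)" for i using k by simp
  have IH: "\<forall>t\<in>set ts. search_tree t \<longleftrightarrow> sorted_wrt (<) (inorder t)" using 2 by simp
  show ?case
    using n len IH by (auto simp: sorted_mix_iff[OF len])
qed simp

lemma ext_depths_balanced: "balanced B lo h t \<Longrightarrow> ext_depths t = {h}"
proof (induction B lo h t rule: balanced.induct)
  case (2 B lo h ks ts)
  then have "ts \<noteq> []" by auto
  then have "(\<Union>t\<in>set ts. ext_depths t) = {h - 1}" using 2 by auto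
  then show ?case using 2(2) by simp
qed simp

lemma degrees_ok_balanced: "balanced B lo h t \<Longrightarrow> degrees_ok B lo t"
  by (induction B lo h t rule: balanced.induct) auto

text \<open>Each child has some height by induction. A balanced tree has a single external depth,
  and all these depths occur in the depth set of the parent, so the heights coincide.\<close>

lemma balanced_if_degrees_ok:
  "search_tree t \<Longrightarrow> degrees_ok B lo t \<Longrightarrow> \<forall>d\<in>ext_depths t. \<forall>d'\<in>ext_depths t. d = d' \<Longrightarrow>
   \<exists>h. balanced B lo h t"
proof (induction t arbitrary: lo)
  case (Node ks ts)
  have "\<exists>h. balanced B (B div 2) h t" if "t \<in> set ts" for t
    by (rule Node.IH) (use Node.prems that in auto)
  then obtain H where H: "\<And>t. t \<in> set ts \<Longrightarrow> balanced B (B div 2) (H t) t" by metis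
  have "Suc (H t) \<in> ext_depths (Node ks ts)" if "t \<in> set ts" for t
    using that ext_depths_balanced[OF H[OF that]] by auto
  then have eq: "H t = H t'" if "t \<in> set ts" "t' \<in> set ts" for t t'
    using Node.prems(3) that by (meson nat.inject)
  have "hd ts \<in> set ts" using Node.prems(1) by (cases ts) auto
  then have "balanced B (B div 2) (H (hd ts)) t" if "t \<in> set ts" for t
    using eq[OF that] H[OF that] by simp
  then have "balanced B lo (Suc (H (hd ts))) (Node ks ts)" using Node.prems by simp
  then show ?case by blast
qed simp

text \<open>The rest of the proof works with this characterization, where shape and order are
  independent of each other.\<close>

lemma is_btree_iff: "is_btree B t \<longleftrightarrow> (\<exists>h. balanced B 1 h t) \<and> sorted_wrt (<) (inorder t)"
proof
  assume "is_btree B t"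
  note * = this[unfolded is_btree_def]
  from balanced_if_degrees_ok[OF *[THEN conjunct1] *[THEN conjunct2, THEN conjunct1] *[THEN conjunct2, THEN conjunct2]]
  obtain h where h: "balanced B 1 h t" ..
  then show "(\<exists>h. balanced B 1 h t) \<and> sorted_wrt (<) (inorder t)"
    using search_tree_inorder[OF h] * by (intro conjI exI) simp_all
next
  assume *: "(\<exists>h. balanced B 1 h t) \<and> sorted_wrt (<) (inorder t)"
  then obtain h where h: "balanced B 1 h t" by (elim conjE exE)
  have "search_tree t" using * search_tree_inorder[OF h] by (elim conjE) simp
  then show "is_btree B t"
    unfolding is_btree_def ext_depths_balanced[OF h] by (intro conjI degrees_ok_balanced[OF h]) simp_all
qed

section \<open>Slices, units and plans\<close>

definition slice :: "nat \<Rightarrow> nat \<Rightarrow> 'a list \<Rightarrow> 'a list" where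
  "slice i j xs = drop i (take j xs)"

lemma length_slice: "j \<le> length xs \<Longrightarrow> length (slice i j xs) = j - i"
  by (simp add: slice_def)

lemma nth_slice: "j \<le> length xs \<Longrightarrow> k < j - i \<Longrightarrow> slice i j xs ! k = xs ! (i + k)"
  by (simp add: slice_def)

lemma set_slice_subset: "set (slice i j xs) \<subseteq> set xs"
  unfolding slice_def by (meson order_trans set_drop_subset set_take_subset)

lemma slice_append: "i \<le> j \<Longrightarrow> j \<le> k \<Longrightarrow> slice i j xs @ slice j k xs = slice i k xs"
proof -
  assume "i \<le> j" "j \<le> k"
  then have "take k xs = take j xs @ drop j (take k xs)"
    by (metis append_take_drop_id min.absorb1 take_take)
  then have "drop i (take k xs) = drop i (take j xs) @ drop (i - length (take j xs)) (drop j (take k xs))"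
    by (metis drop_append)
  moreover have "drop (i - length (take j xs)) (drop j (take k xs)) = drop j (take k xs)"
    using \<open>i \<le> j\<close> by (cases "j \<le> length xs") auto
  ultimately show ?thesis by (simp add: slice_def)
qed

lemma slice_slice: "v \<le> q - p \<Longrightarrow> slice u v (slice p q xs) = slice (p + u) (p + v) xs"
  by (cases "p \<le> q") (auto simp: slice_def take_drop min_absorb1 ac_simps)

lemma slice_all: "slice 0 (length xs) xs = xs"
  by (simp add: slice_def)

lemma list_all2_slice: "list_all2 P xs ys \<Longrightarrow> list_all2 P (slice i j xs) (slice i j ys)"
  by (simp add: slice_def list_all2_dropI list_all2_takeI)

lemma concat_slices:
  assumes "\<And>g. a g \<le> a (Suc g)"
  shows "concat (map (\<lambda>g. slice (a g) (a (Suc g)) xs) [0..<c]) = slice (a 0) (a c) xs"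
proof (induction c)
  case 0
  show ?case by (simp add: slice_def)
next
  case (Suc c)
  have "a 0 \<le> a c" by (rule lift_Suc_mono_le[of a]) (use assms in simp_all)
  then show ?case using Suc assms by (simp add: slice_append)
qed

text \<open>A unit is a tree of some fixed height, the key separating it from the next unit, and the I/O
  work for building it.\<close>

type_synonym 'k tunit = "'k btree \<times> 'k option \<times> nat"

definition flat :: "'k tunit list \<Rightarrow> 'k list" where
  "flat us = concat (map (\<lambda>(t, s, _). inorder t @ (case s of None \<Rightarrow> [] | Some k \<Rightarrow> [k])) us)"

definition separated :: "'k tunit list \<Rightarrow> bool" where
  "separated us \<longleftrightarrow> (\<forall>i. i + 1 < length us \<longrightarrow> fst (snd (us ! i)) \<noteq> None)"

text \<open>Replacements of an entire subtree: no separator follows the last one, since the key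
  after the subtree belongs to an ancestor. A group taken from the middle of such a list is
  \<open>separated\<close> but ends with a separator.\<close>

definition closed_units :: "'k tunit list \<Rightarrow> bool" where
  "closed_units us \<longleftrightarrow> us \<noteq> [] \<and> separated us \<and> fst (snd (last us)) = None"

definition weight :: "'k tunit list \<Rightarrow> nat" where
  "weight us = sum_list (map (snd \<circ> snd) us)"

text \<open>Inner separators become the keys of the new node and the last one is passed on. Building
  the node takes 8 transfers: five loads of the planned node and three stores for the
  result.\<close>

definition join_units :: "'k tunit list \<Rightarrow> 'k tunit" where
  "join_units us = (Node (map (the \<circ> fst \<circ> snd) (butlast us)) (map fst us), fst (snd (last us)),
     8 + weight us)"

text \<open>The ceiling of \<open>C / (B + 1)\<close>, the least number of nodes that can hold
  \<open>C\<close> children; \<open>cut\<close> rounds the multiples of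
  \<open>C / groups B C\<close> down.\<close>

definition groups :: "nat \<Rightarrow> nat \<Rightarrow> nat" where
  "groups B C = (C + B) div (B + 1)"

definition cut :: "nat \<Rightarrow> nat \<Rightarrow> nat \<Rightarrow> nat" where
  "cut B C g = g * C div groups B C"

definition regroup :: "nat \<Rightarrow> 'k tunit list \<Rightarrow> 'k tunit list" where
  "regroup B us = map (\<lambda>g. join_units (slice (cut B (length us) g) (cut B (length us) (Suc g)) us))
     [0..<groups B (length us)]"

text \<open>The key after a child becomes the separator of the last unit of this child, which has
  none of its own if the list is closed.\<close>

fun stitch :: "'k list \<Rightarrow> 'k tunit list list \<Rightarrow> 'k tunit list" where
  "stitch (k # ks) (us # uss) =
     butlast us @ (fst (last us), Some k, snd (snd (last us))) # stitch ks uss"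
| "stitch [] (us # uss) = us"
| "stitch _ [] = []"

datatype 'k plan = Keep "'k btree" | Gap "'k list" | PNode "'k list" "'k plan list"

text \<open>A kept subtree is reused by its pointer and costs nothing. In a gap each new key is the
  separator after an external node and costs the one read that fetches it from the array.\<close>

fun units :: "nat \<Rightarrow> 'k plan \<Rightarrow> 'k tunit list" where
  "units B (Keep t) = [(t, None, 0)]"
| "units B (Gap xs) = map (\<lambda>x. (Ext, Some x, 1)) xs @ [(Ext, None, 0)]"
| "units B (PNode ks ps) = regroup B (stitch ks (map (units B) ps))"

text \<open>Both comparisons are strict, so a key that already occurs in the node is dropped; this
  is how duplicates disappear from the union.\<close>

fun splits :: "'k::linorder list \<Rightarrow> 'k list \<Rightarrow> 'k list list" where
  "splits [] xs = [xs]"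
| "splits (k # ks) xs = filter (\<lambda>x. x < k) xs # splits ks (filter (\<lambda>x. k < x) xs)"

text \<open>The key list varies in the nested recursion. Defining functions of it makes the
  recursion primitive: the children are first mapped to functions and then applied to their shares
  of the keys.\<close>

primrec make_plan :: "'k::linorder btree \<Rightarrow> 'k list \<Rightarrow> 'k plan" where
  "make_plan Ext = (\<lambda>xs. if xs = [] then Keep Ext else Gap xs)"
| "make_plan (Node ks ts) = (\<lambda>xs. if xs = [] then Keep (Node ks ts) else
     PNode ks (map2 (\<lambda>f ys. f ys) (map make_plan ts) (splits ks xs)))"

section \<open>Even regrouping\<close>

lemma groups_pos: "0 < C \<Longrightarrow> 0 < groups B C"
  by (simp add: groups_def div_greater_zero_iff)

text \<open>With \<open>c\<close> groups, consecutive cuts differ by \<open>C div c\<close> plus a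
  carry of at most 1, and the carry vanishes if \<open>c\<close> divides \<open>C\<close>. As
  \<open>C <= c * (B + 1)\<close>, a carry cannot push a group beyond \<open>B + 1\<close>
  children.\<close>

lemma cut_step:
  assumes "0 < C"
  shows "cut B C g + C div groups B C \<le> cut B C (Suc g)"
    and "cut B C (Suc g) \<le> cut B C g + (B + 1)"
proof -
  define c where "c = groups B C"
  have c: "0 < c" using groups_pos[OF assms] by (simp add: c_def)
  have eq: "(g * C + C) div c = g * C div c + C div c + (g * C mod c + C mod c) div c"
    by (rule div_add1_eq)
  then show "cut B C g + C div groups B C \<le> cut B C (Suc g)"
    by (simp add: cut_def c_def add.commute)
  have "C \<le> c * (B + 1)"
  proof -
    have "C + B < (B + 1) + (C + B) div (B + 1) * (B + 1)"
      by (rule dividend_less_div_times) simp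
    then show ?thesis unfolding c_def groups_def by simp
  qed
  moreover have "(g * C mod c + C mod c) div c \<le> 1"
  proof -
    have "g * C mod c + C mod c < 2 * c"
      using mod_less_divisor[OF c, of "g * C"] mod_less_divisor[OF c, of C] by linarith
    then have "(g * C mod c + C mod c) div c < 2" by (rule less_mult_imp_div_less)
    then show ?thesis by simp
  qed
  moreover have "(g * C mod c + C mod c) div c = 0" if "C mod c = 0" using that c by simp
  moreover have "C div c + 1 \<le> B + 1" if "C mod c \<noteq> 0"
  proof -
    have "c * (C div c) < c * (B + 1)"
      using \<open>C \<le> c * (B + 1)\<close> that mult_div_mod_eq[of c C] by linarith
    then have "C div c < B + 1" by (metis nat_mult_less_cancel1 c)
    then show ?thesis by simp
  qed
  moreover have "C div c \<le> B + 1"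
    using div_le_mono[OF \<open>C \<le> c * (B + 1)\<close>, of c] c by simp
  ultimately have "C div c + (g * C mod c + C mod c) div c \<le> B + 1"
    by (cases "C mod c = 0") simp_all
  then show "cut B C (Suc g) \<le> cut B C g + (B + 1)"
    using eq by (simp add: cut_def c_def[symmetric] add.commute)
qed

lemma groups_le: "0 < C \<Longrightarrow> groups B C \<le> C"
proof -
  assume "0 < C"
  then have "C + B \<le> (B + 1) * C" by (cases C) auto
  then have "groups B C \<le> (B + 1) * C div (B + 1)" unfolding groups_def by (rule div_le_mono)
  also have "\<dots> = C" by (rule nonzero_mult_div_cancel_left) simp
  finally show ?thesis .
qed

lemma cut_strict: "0 < C \<Longrightarrow> cut B C g < cut B C (Suc g)"
proof -
  assume C: "0 < C"
  have "0 < C div groups B C" using groups_le[OF C] groups_pos[OF C] by (simp add: div_greater_zero_iff)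
  then show ?thesis using cut_step(1)[OF C, of B g] by linarith
qed

lemma cut_0: "cut B C 0 = 0" by (simp add: cut_def)

lemma cut_last: "0 < C \<Longrightarrow> cut B C (groups B C) = C"
  using groups_pos[of C B] by (simp add: cut_def)

lemma cut_mono: "g \<le> g' \<Longrightarrow> cut B C g \<le> cut B C g'"
  by (simp add: cut_def div_le_mono)

lemma cut_le: "0 < C \<Longrightarrow> g \<le> groups B C \<Longrightarrow> cut B C g \<le> C"
  using cut_mono[of g "groups B C" B C] cut_last by simp

text \<open>From \<open>c * (B + 1) <= C + B\<close> for the number \<open>c\<close> of groups,
  subtract \<open>c * (B - B div 2)\<close>, which is at least \<open>B\<close> once there are two
  groups. The remainder \<open>c * (B div 2 + 1) <= C\<close> is the lower bound on the degree, and
  it is here that the rounding of \<open>B div 2\<close> matters.\<close>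

lemma half_le_group:
  assumes "2 \<le> groups B C"
  shows "B div 2 + 1 \<le> C div groups B C"
proof -
  define c where "c = groups B C"
  have c: "2 \<le> c" using assms by (simp add: c_def)
  have "c * (B + 1) \<le> C + B" unfolding c_def groups_def by (rule div_times_less_eq_dividend)
  moreover have "c * (B + 1) = c * (B div 2 + 1) + c * (B - B div 2)"
    unfolding distrib_left[symmetric] by simp
  moreover have "B \<le> c * (B - B div 2)"
  proof -
    have "B \<le> 2 * (B - B div 2)" by simp
    also have "\<dots> \<le> c * (B - B div 2)" using c by (rule mult_le_mono1)
    finally show ?thesis .
  qed
  ultimately have "c * (B div 2 + 1) \<le> C" by linarith
  then show ?thesis using c unfolding c_def[symmetric]
    using div_le_mono[of "c * (B div 2 + 1)" C c] by simp
qed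

lemma flat_simps [simp]:
  "flat [] = []" "flat (u # us) = inorder (fst u) @ (case fst (snd u) of None \<Rightarrow> [] | Some k \<Rightarrow> [k]) @ flat us"
  "flat (us @ vs) = flat us @ flat vs"
  by (simp_all add: flat_def case_prod_unfold)

lemma weight_simps [simp]:
  "weight [] = 0" "weight (u # us) = snd (snd u) + weight us" "weight (us @ vs) = weight us + weight vs"
  by (simp_all add: weight_def)

lemma weight_concat: "weight (concat uss) = sum_list (map weight uss)"
  by (induction uss) simp_all

lemma flat_concat: "flat (concat uss) = concat (map flat uss)"
  by (induction uss) simp_all

lemma flat_singletons: "flat us = concat (map (\<lambda>u. flat [u]) us)"
  by (induction us) simp_all

lemma separated_Cons: "separated (u # us) \<Longrightarrow> us \<noteq> [] \<Longrightarrow> fst (snd u) \<noteq> None \<and> separated us"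
  unfolding separated_def by (metis One_nat_def Suc_eq_plus1 Suc_less_eq length_Cons length_greater_0_conv nth_Cons_0 nth_Cons_Suc)

lemma flat_join_units: "us \<noteq> [] \<Longrightarrow> separated us \<Longrightarrow> flat [join_units us] = flat us"
proof (induction us rule: list_nonempty_induct)
  case (single u)
  then show ?case by (simp add: join_units_def)
next
  case (cons u us)
  then have *: "fst (snd u) \<noteq> None" "separated us" using separated_Cons by blast+
  then obtain k where "fst (snd u) = Some k" by blast
  then show ?case using cons(1) cons(2)[OF *(2)] by (simp add: join_units_def)
qed

lemma separated_slice: "separated us \<Longrightarrow> j \<le> length us \<Longrightarrow> separated (slice i j us)"
  unfolding separated_def by (auto simp: length_slice nth_slice)

lemma last_slice: "i < j \<Longrightarrow> j \<le> length xs \<Longrightarrow> last (slice i j xs) = xs ! (j - 1)"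
  by (simp add: last_conv_nth length_slice nth_slice slice_def)

context
  fixes B :: nat and us :: "'k tunit list"
  assumes us: "closed_units us"
begin

private lemma C: "0 < length us"
  using us by (simp add: closed_units_def)

private lemma slice_group:
  assumes "g < groups B (length us)"
  shows "cut B (length us) g < cut B (length us) (Suc g)" "cut B (length us) (Suc g) \<le> length us"
    "slice (cut B (length us) g) (cut B (length us) (Suc g)) us \<noteq> []"
    "separated (slice (cut B (length us) g) (cut B (length us) (Suc g)) us)"
proof -
  show *: "cut B (length us) g < cut B (length us) (Suc g)" by (rule cut_strict[OF C])
  show **: "cut B (length us) (Suc g) \<le> length us" using assms by (intro cut_le[OF C]) simp
  show "slice (cut B (length us) g) (cut B (length us) (Suc g)) us \<noteq> []"
    using * ** length_slice[OF **, of "cut B (length us) g"] by auto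
  show "separated (slice (cut B (length us) g) (cut B (length us) (Suc g)) us)"
    using us ** by (intro separated_slice) (auto simp: closed_units_def)
qed

lemma length_regroup: "length (regroup B us) = groups B (length us)"
  by (simp add: regroup_def)

private lemma slices: "concat (map (\<lambda>g. slice (cut B (length us) g) (cut B (length us) (Suc g)) us)
    [0..<groups B (length us)]) = us"
  using concat_slices[of "cut B (length us)" us "groups B (length us)"] cut_strict[OF C]
  by (simp add: less_imp_le cut_0 cut_last[OF C] slice_all)

lemma flat_regroup: "flat (regroup B us) = flat us"
proof -
  let ?S = "\<lambda>g. slice (cut B (length us) g) (cut B (length us) (Suc g)) us"
  have "flat (regroup B us) = concat (map (\<lambda>g. flat [join_units (?S g)]) [0..<groups B (length us)])"
    by (subst flat_singletons) (simp only: regroup_def map_map o_def)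
  also have "\<dots> = concat (map (\<lambda>g. flat (?S g)) [0..<groups B (length us)])"
    by (intro arg_cong[where f = concat] map_cong refl flat_join_units slice_group(3,4)) simp_all
  also have "\<dots> = flat us"
    by (subst (2) slices[symmetric]) (simp only: flat_concat map_map o_def)
  finally show ?thesis .
qed

lemma weight_regroup: "weight (regroup B us) = 8 * groups B (length us) + weight us"
proof -
  have "weight (regroup B us) =
      (\<Sum>g\<leftarrow>[0..<groups B (length us)]. 8 + weight (slice (cut B (length us) g) (cut B (length us) (Suc g)) us))"
    by (simp add: regroup_def weight_def join_units_def comp_def)
  also have "\<dots> = 8 * groups B (length us) + weight (concat (map (\<lambda>g. slice (cut B (length us) g) (cut B (length us) (Suc g)) us)
    [0..<groups B (length us)]))"
    by (simp add: sum_list_addf sum_list_triv weight_concat comp_def)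
  finally show ?thesis unfolding slices .
qed

lemma closed_regroup: "closed_units (regroup B us)"
proof -
  let ?c = "groups B (length us)"
  have sep: "fst (snd (regroup B us ! g)) = fst (snd (us ! (cut B (length us) (Suc g) - 1)))"
    if "g < ?c" for g
    using that last_slice[OF slice_group(1,2)[OF that]] by (simp add: regroup_def join_units_def)
  have "separated (regroup B us)"
    unfolding separated_def length_regroup
  proof (intro allI impI)
    fix g assume g: "g + 1 < ?c"
    have "cut B (length us) (Suc g) < length us"
      using slice_group(1,2)[of "Suc g"] g by simp
    moreover have "cut B (length us) (Suc g) > 0" using slice_group(1)[of g] g by simp
    ultimately have "(cut B (length us) (Suc g) - 1) + 1 < length us" by linarith
    then have "fst (snd (us ! (cut B (length us) (Suc g) - 1))) \<noteq> None"
      using us unfolding closed_units_def separated_def by (elim conjE) (erule allE, erule mp)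
    then show "fst (snd (regroup B us ! g)) \<noteq> None"
      by (subst sep) (use g in simp_all)
  qed
  moreover have "regroup B us \<noteq> []" using groups_pos[OF C] length_regroup by (metis length_greater_0_conv)
  moreover have "fst (snd (last (regroup B us))) = None"
  proof -
    have "?c - 1 < ?c" using groups_pos[OF C] by simp
    moreover have "fst (snd (us ! (length us - 1))) = None"
      using us last_conv_nth[of us] unfolding closed_units_def by simp
    ultimately show ?thesis using sep[of "?c - 1"] \<open>regroup B us \<noteq> []\<close> cut_last[OF C, of B] groups_pos[OF C, of B]
      by (simp add: last_conv_nth length_regroup closed_units_def)
  qed
  ultimately show ?thesis by (simp add: closed_units_def)
qed

text \<open>Two or more groups are all large enough to be inner nodes. A single group contains all
  units, so its size is bounded below only by their number; this is the case in which the weaker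
  bound \<open>lo\<close> of a root is kept.\<close>

lemma balanced_regroup:
  assumes bal: "\<forall>u\<in>set us. balanced B (B div 2) h (fst u)" and lo: "lo + 1 \<le> length us" "lo \<le> B div 2"
  shows "\<forall>u\<in>set (regroup B us). balanced B lo (Suc h) (fst u)"
    and "2 \<le> groups B (length us) \<Longrightarrow> \<forall>u\<in>set (regroup B us). balanced B (B div 2) (Suc h) (fst u)"
proof -
  let ?s = "\<lambda>g. slice (cut B (length us) g) (cut B (length us) (Suc g)) us"
  have len: "length (?s g) \<le> B + 1" "length us div groups B (length us) \<le> length (?s g)"
    if "g < groups B (length us)" for g
    using cut_step[OF C, of B g] length_slice[OF slice_group(2)[OF that], of "cut B (length us) g"]
    by linarith+
  have *: "balanced B lo' (Suc h) (fst (join_units (?s g)))"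
    if g: "g < groups B (length us)" and "lo' + 1 \<le> length us div groups B (length us)" for lo' g
  proof -
    have "lo' + 1 \<le> length (?s g)" using that len(2)[OF g] by linarith
    moreover have "\<forall>u\<in>set (?s g). balanced B (B div 2) h (fst u)" using bal set_slice_subset by fast
    ultimately show ?thesis using len(1)[OF g] by (auto simp: join_units_def)
  qed
  show **: "\<forall>u\<in>set (regroup B us). balanced B (B div 2) (Suc h) (fst u)" if "2 \<le> groups B (length us)"
    using *[of _ "B div 2"] half_le_group[OF that] by (auto simp: regroup_def)
  show "\<forall>u\<in>set (regroup B us). balanced B lo (Suc h) (fst u)"
  proof (cases "2 \<le> groups B (length us)")
    case True
    then show ?thesis using ** lo(2) balanced_mono by blast
  next
    case False
    then have "groups B (length us) = 1" using groups_pos[OF C, of B] by simp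
    then show ?thesis using *[of _ lo] lo(1) by (auto simp: regroup_def)
  qed
qed

end

text \<open>Stitching changes separators of last units and nothing else. Closedness of the parts
  makes the overwritten separators empty, so no key is lost.\<close>

lemma stitch_props:
  assumes "length uss = length ks + 1" "\<forall>us\<in>set uss. closed_units us"
  shows "closed_units (stitch ks uss) \<and> flat (stitch ks uss) = mix ks (map flat uss) \<and>
    length (stitch ks uss) = sum_list (map length uss) \<and>
    weight (stitch ks uss) = sum_list (map weight uss) \<and>
    fst ` set (stitch ks uss) = (\<Union>us\<in>set uss. fst ` set us)"
  using assms
proof (induction ks uss rule: stitch.induct)
  case (1 k ks us uss)
  then have IH: "closed_units (stitch ks uss) \<and> flat (stitch ks uss) = mix ks (map flat uss) \<and>
    length (stitch ks uss) = sum_list (map length uss) \<and>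
    weight (stitch ks uss) = sum_list (map weight uss) \<and>
    fst ` set (stitch ks uss) = (\<Union>us\<in>set uss. fst ` set us)" by simp
  from 1 have us: "us \<noteq> []" "separated us" "fst (snd (last us)) = None" by (auto simp: closed_units_def)
  define vs u where "vs = butlast us" "u = last us"
  have eq: "us = vs @ [u]" using us(1) by (simp add: vs_u_def)
  have vs: "\<forall>i<length vs. fst (snd (vs ! i)) \<noteq> None"
    using us(2) unfolding separated_def eq by (simp add: nth_append)
  have u: "fst (snd u) = None" using us(3) vs_u_def by simp
  have st: "stitch (k # ks) (us # uss) = vs @ (fst u, Some k, snd (snd u)) # stitch ks uss" by (simp add: eq)
  have "separated (vs @ (fst u, Some k, snd (snd u)) # stitch ks uss)"
    using vs IH unfolding separated_def closed_units_def
    by (auto simp: nth_append nth_Cons split: nat.splits)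
  then have "closed_units (stitch (k # ks) (us # uss))" unfolding st using IH by (simp add: closed_units_def)
  then show ?case using IH u unfolding st by (auto simp: eq)
next
  case (2 us uss)
  then show ?case by (cases uss) auto
qed auto

section \<open>Distributing keys over a tree\<close>

lemma length_splits [simp]: "length (splits ks xs) = length ks + 1"
  by (induction ks arbitrary: xs) simp_all

text \<open>Keys already in \<open>ks\<close> are dropped by \<open>splits\<close>, hence
  \<open>set ks\<close> on both sides.\<close>

lemma set_splits: "set ks \<union> (\<Union>ys\<in>set (splits ks xs). set ys) = set ks \<union> set xs"
proof (induction ks arbitrary: xs)
  case (Cons k ks)
  have "set (k # ks) \<union> (\<Union>ys\<in>set (splits (k # ks) xs). set ys) =
      insert k (set (filter (\<lambda>x. x < k) xs) \<union> (set ks \<union> (\<Union>ys\<in>set (splits ks (filter (\<lambda>x. k < x) xs)). set ys)))"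
    by auto
  also have "\<dots> = set (k # ks) \<union> set xs" unfolding Cons.IH by auto
  finally show ?case .
qed simp

lemma sorted_splits: "sorted_wrt (<) xs \<Longrightarrow> ys \<in> set (splits ks xs) \<Longrightarrow> sorted_wrt (<) ys"
proof (induction ks arbitrary: xs)
  case (Cons k ks)
  then show ?case using Cons.IH[of "filter (\<lambda>x. k < x) xs"] by (auto simp: sorted_wrt_filter)
qed simp

lemma sum_length_splits: "sum_list (map length (splits ks xs)) \<le> length xs"
proof (induction ks arbitrary: xs)
  case (Cons k ks)
  have "length (filter (\<lambda>x. x < k) xs) + length (filter (\<lambda>x. k < x) xs) \<le> length xs"
    by (induction xs) auto
  then show ?case using Cons[of "filter (\<lambda>x. k < x) xs"] by simp
qed simp

lemma nth_splits:
  assumes "sorted_wrt (<) ks" "i \<le> length ks"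
  shows "splits ks xs ! i =
    filter (\<lambda>x. (0 < i \<longrightarrow> ks ! (i - 1) < x) \<and> (i < length ks \<longrightarrow> x < ks ! i)) xs"
  using assms
proof (induction ks arbitrary: xs i)
  case (Cons k ks)
  show ?case
  proof (cases i)
    case (Suc j)
    have *: "(k < x \<and> (0 < j \<longrightarrow> ks ! (j - 1) < x)) = (ks' ! j < x)" if "ks' = k # ks" for x ks'
    proof (cases j)
      case (Suc l)
      then have "k < ks ! l" using Cons.prems \<open>i = Suc j\<close> by simp
      then show ?thesis using Suc that by auto
    qed (use that in simp)
    have "splits (k # ks) xs ! i = filter (\<lambda>x. (0 < j \<longrightarrow> ks ! (j - 1) < x) \<and>
        (j < length ks \<longrightarrow> x < ks ! j)) (filter (\<lambda>x. k < x) xs)"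
      using Cons.IH[of j "filter (\<lambda>x. k < x) xs"] Cons.prems Suc by simp
    also have "\<dots> = filter (\<lambda>x. (0 < i \<longrightarrow> (k # ks) ! (i - 1) < x) \<and>
        (i < length (k # ks) \<longrightarrow> x < (k # ks) ! i)) xs"
      unfolding filter_filter using *[OF refl] Suc by (intro filter_cong refl) auto
    finally show ?thesis .
  qed simp
qed simp

lemma filter_less_sorted:
  fixes xs :: "'a::linorder list"
  shows "sorted_wrt (<) xs \<Longrightarrow> filter (\<lambda>x. x < z) xs = take (length (filter (\<lambda>x. x < z) xs)) xs"
proof (induction xs)
  case (Cons x xs)
  show ?case
  proof (cases "x < z")
    case False
    then have "filter (\<lambda>x. x < z) xs = []" using Cons.prems by (auto simp: filter_empty_conv)
    then show ?thesis using False by simp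
  qed (use Cons in simp)
qed simp

lemma filter_greater_sorted:
  fixes xs :: "'a::linorder list"
  shows "sorted_wrt (<) xs \<Longrightarrow> filter (\<lambda>x. y < x) xs = drop (length (filter (\<lambda>x. x \<le> y) xs)) xs"
proof (induction xs)
  case (Cons x xs)
  show ?case
  proof (cases "x \<le> y")
    case False
    then have "y < z" if "z \<in> set xs" for z using that Cons.prems by force
    then have "filter (\<lambda>x. x \<le> y) xs = []" "filter (\<lambda>x. y < x) xs = xs"
      by (auto simp: filter_empty_conv not_le)
    then show ?thesis using False by simp
  qed (use Cons in \<open>simp add: not_less\<close>)
qed simp

text \<open>Every share of a sorted list is an interval, so a task is given by two indices. Its ends
  are a count with \<open>\<le>\<close> for the key on the left and a count with \<open><\<close>
  for the key on the right, which is why each key is ranked in both ways.\<close>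

lemma nth_splits_slice:
  fixes xs :: "'a::linorder list"
  assumes ks: "sorted_wrt (<) ks" and xs: "sorted_wrt (<) xs" and i: "i \<le> length ks"
  shows "splits ks xs ! i = slice (if i = 0 then 0 else length (filter (\<lambda>x. x \<le> ks ! (i - 1)) xs))
    (if i < length ks then length (filter (\<lambda>x. x < ks ! i) xs) else length xs) xs"
proof -
  let ?ys = "if i < length ks then filter (\<lambda>x. x < ks ! i) xs else xs"
  have ys: "?ys = take (if i < length ks then length (filter (\<lambda>x. x < ks ! i) xs) else length xs) xs"
    using filter_less_sorted[OF xs, of "ks ! i"] by simp
  have sys: "sorted_wrt (<) ?ys" using xs by (simp add: sorted_wrt_filter)
  show ?thesis
  proof (cases "i = 0")
    case True
    then show ?thesis
      using nth_splits[OF ks i, of xs] filter_less_sorted[OF xs, of "ks ! 0", symmetric]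
      by (auto simp: slice_def)
  next
    case False
    have "splits ks xs ! i = filter (\<lambda>x. ks ! (i - 1) < x) ?ys"
      using nth_splits[OF ks i, of xs] False by (auto intro!: filter_cong simp: conj_commute)
    also have "\<dots> = drop (length (filter (\<lambda>x. x \<le> ks ! (i - 1)) ?ys)) ?ys"
      by (rule filter_greater_sorted[OF sys])
    \<comment> \<open>Elements up to the left key lie below the right key anyway, so the rank may be
      taken in the whole list.\<close>
    also have "filter (\<lambda>x. x \<le> ks ! (i - 1)) ?ys = filter (\<lambda>x. x \<le> ks ! (i - 1)) xs"
    proof (cases "i < length ks")
      case True
      then have "ks ! (i - 1) < ks ! i" using ks False by (auto simp: sorted_wrt_iff_nth_less)
      then show ?thesis using True by (auto intro!: filter_cong)
    qed simp
    finally show ?thesis using False ys by (simp add: slice_def)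
  qed
qed

lemma make_plan_Nil [simp]: "make_plan t [] = Keep t"
  by (cases t) simp_all

lemma make_plan_Node: "xs \<noteq> [] \<Longrightarrow>
  make_plan (Node ks ts) xs = PNode ks (map (\<lambda>(t, ys). make_plan t ys) (zip ts (splits ks xs)))"
  by (simp add: zip_map1 comp_def case_prod_unfold)

declare make_plan.simps(2) [simp del]

fun plan_ok :: "nat \<Rightarrow> 'k plan \<Rightarrow> bool" where
  "plan_ok B (PNode ks ps) \<longleftrightarrow> length ks \<le> B \<and> length ps = length ks + 1 \<and> (\<forall>p\<in>set ps. plan_ok B p)"
| "plan_ok B p \<longleftrightarrow> True"

fun touched :: "'k plan \<Rightarrow> nat" where
  "touched (PNode ks ps) = 1 + sum_list (map touched ps)"
| "touched p = 0"

fun gap_keys :: "'k plan \<Rightarrow> nat" where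
  "gap_keys (PNode ks ps) = sum_list (map gap_keys ps)"
| "gap_keys (Gap xs) = length xs"
| "gap_keys p = 0"

lemma closed_units_units: "plan_ok B p \<Longrightarrow> closed_units (units B p)"
proof (induction B p rule: units.induct)
  case (2 B xs)
  then show ?case by (auto simp: closed_units_def separated_def nth_append)
next
  case (3 B ks ps)
  then show ?case using stitch_props[of "map (units B) ps" ks] by (auto intro!: closed_regroup)
qed (simp add: closed_units_def separated_def)

text \<open>Each unit holds a credit of 8 for its part in units one level up.\<close>

lemma units_count_weight:
  assumes "2 \<le> B"
  shows "plan_ok B p \<Longrightarrow> length (units B p) \<le> gap_keys p + 1 \<and>
    weight (units B p) + 8 * length (units B p) \<le> 9 * gap_keys p + 24 * touched p + 8"
proof (induction p)
  case (Gap xs)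
  have "weight (map (\<lambda>x. (Ext, Some x, 1)) xs) = length xs" by (induction xs) simp_all
  then show ?case by simp
next
  case (PNode ks ps)
  let ?us = "stitch ks (map (units B) ps)"
  have closed: "\<forall>p\<in>set ps. closed_units (units B p)" using PNode.prems closed_units_units by auto
  have st: "closed_units ?us" "length ?us = (\<Sum>p\<leftarrow>ps. length (units B p))"
    "weight ?us = (\<Sum>p\<leftarrow>ps. weight (units B p))"
    using stitch_props[of "map (units B) ps" ks] closed PNode.prems by (simp_all add: comp_def)
  define G T Lu where "G = (\<Sum>p\<leftarrow>ps. gap_keys p)" "T = (\<Sum>p\<leftarrow>ps. touched p)" "Lu = length ?us"
  have "Lu \<le> (\<Sum>p\<leftarrow>ps. gap_keys p + 1)" unfolding G_T_Lu_def st(2)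
    by (rule sum_list_mono) (use PNode in auto)
  then have L: "Lu \<le> G + length ps" by (simp add: G_T_Lu_def sum_list_Suc)
  have "(\<Sum>p\<leftarrow>ps. weight (units B p) + 8 * length (units B p)) \<le>
      (\<Sum>p\<leftarrow>ps. 9 * gap_keys p + 24 * touched p + 8)"
    by (rule sum_list_mono) (use PNode in auto)
  then have W: "weight ?us + 8 * Lu \<le> 9 * G + 24 * T + 8 * length ps"
    by (simp add: G_T_Lu_def st sum_list_addf sum_list_triv sum_list_const_mult)
  define c where "c = groups B Lu"
  have c: "c * (B + 1) \<le> Lu + B" unfolding c_def groups_def by (rule div_times_less_eq_dividend)
  have lp: "length ps \<le> B + 1" using PNode.prems by simp
  have lu: "units B (PNode ks ps) = regroup B ?us" by simp
  \<comment> \<open>Were there \<open>G + 2\<close> groups or more, \<open>(G + 2) * (B + 1)\<close>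
    would be at most \<open>G + (B + 1) + B\<close>, as the old children number at most
    \<open>B + 1\<close>.\<close>
  have 1: "c \<le> G + 1"
  proof (rule ccontr)
    assume "\<not> c \<le> G + 1"
    then have "(G + 2) * (B + 1) \<le> c * (B + 1)" by (intro mult_le_mono1) simp
    also have "\<dots> \<le> G + (B + 1) + B" using c L lp by linarith
    finally show False by (simp add: algebra_simps)
  qed
  have ge: "length ps \<le> Lu"
  proof -
    have "(\<Sum>p\<leftarrow>ps. 1) \<le> (\<Sum>p\<leftarrow>ps. length (units B p))"
      by (rule sum_list_mono) (use closed in \<open>auto simp: closed_units_def Suc_le_eq\<close>)
    then show ?thesis by (simp add: G_T_Lu_def st sum_list_triv)
  qed
  \<comment> \<open>Each group costs 8 to build and takes a new credit of 8. Groups after the first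
    two account for at least \<open>B + 1 >= 3\<close> surplus units each, whose credits pay for
    them; the constant 3 is charged to the touched node as 24.\<close>
  have "2 * c \<le> (Lu - length ps) + 3"
  proof (cases c)
    case (Suc e)
    have "e * (B + 1) \<le> Lu - length ps + B" using c Suc ge lp by simp
    then show ?thesis
    proof (cases e)
      case (Suc e')
      then have "e' * (B + 1) + 1 \<le> Lu - length ps" using \<open>e * (B + 1) \<le> _\<close> by simp
      moreover have "e' * 3 \<le> e' * (B + 1)" using assms by (intro mult_le_mono2) simp
      ultimately show ?thesis using Suc \<open>c = Suc e\<close> by linarith
    qed (use Suc in simp)
  qed simp
  then have "16 * c \<le> 8 * (Lu - length ps) + 24" by simp
  then have 2: "8 * c + weight ?us + 8 * c \<le> 9 * G + 24 * T + 32"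
    using W ge by linarith
  show ?case
    unfolding lu length_regroup[OF st(1)] weight_regroup[OF st(1)]
    using 1 2 by (simp add: G_T_Lu_def c_def)
qed simp

lemma plan_ok_make_plan: "balanced B lo h t \<Longrightarrow> plan_ok B (make_plan t xs)"
proof (induction t arbitrary: lo h xs)
  case (Node ks ts)
  show ?case
  proof (cases "xs = []")
    case False
    have "plan_ok B (make_plan t ys)" if "(t, ys) \<in> set (zip ts (splits ks xs))" for t ys
      using Node.IH[OF set_zip_leftD[OF that]] Node.prems set_zip_leftD[OF that] by auto
    then show ?thesis using False Node.prems by (auto simp: make_plan_Node)
  qed simp
qed simp

lemma sum_list_zip_add:
  "length xs = length ys \<Longrightarrow> (\<Sum>(x, y)\<leftarrow>zip xs ys. f x + g y) = sum_list (map f xs) + (sum_list (map g ys) :: 'a::comm_monoid_add)"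
  by (induction xs ys rule: list_induct2) (simp_all add: ac_simps)

lemma gap_keys_make_plan: "balanced B lo h t \<Longrightarrow> gap_keys (make_plan t xs) \<le> length xs"
proof (induction t arbitrary: lo h xs)
  case (Node ks ts)
  show ?case
  proof (cases "xs = []")
    case False
    have len: "length ts = length (splits ks xs)" using Node.prems by simp
    have "gap_keys (make_plan (Node ks ts) xs) = (\<Sum>(t, ys)\<leftarrow>zip ts (splits ks xs). gap_keys (make_plan t ys))"
      using False by (simp add: make_plan_Node comp_def case_prod_unfold)
    also have "\<dots> \<le> (\<Sum>(t, ys)\<leftarrow>zip ts (splits ks xs). 0 + length ys)"
    proof (rule sum_list_mono, clarify)
      fix t ys assume "(t, ys) \<in> set (zip ts (splits ks xs))"
      from set_zip_leftD[OF this] show "gap_keys (make_plan t ys) \<le> 0 + length ys"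
        using Node.IH[of t _ _ ys] Node.prems by auto
    qed
    also have "\<dots> = sum_list (map length (splits ks xs))"
      using sum_list_zip_add[OF len, of "\<lambda>_. 0" length] by simp
    finally show ?thesis using sum_length_splits[of ks xs] by simp
  qed simp
qed simp

text \<open>The bound \<open>lo\<close> may be violated nowhere but matters at the root only: units
  of children satisfy \<open>B div 2\<close> and can be regrouped. The last conjunct says that two
  or more units at the root are also legal children, so that further levels can be put on
  top.\<close>

theorem make_plan_correct:
  assumes "balanced B lo h t" "lo \<le> B div 2" "sorted_wrt (<) (inorder t)" "sorted_wrt (<) xs"
  shows "sorted_wrt (<) (flat (units B (make_plan t xs))) \<and>
    set (flat (units B (make_plan t xs))) = keys t \<union> set xs \<and>
    (\<forall>u\<in>set (units B (make_plan t xs)). balanced B lo h (fst u)) \<and>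
    (2 \<le> length (units B (make_plan t xs)) \<longrightarrow> (\<forall>u\<in>set (units B (make_plan t xs)). balanced B (B div 2) h (fst u)))"
  using assms
proof (induction t arbitrary: lo h xs)
  case Ext
  have "flat (map (\<lambda>x. (Ext, Some x, 1)) xs) = xs" for xs :: "'a list" by (induction xs) simp_all
  then show ?case using Ext by auto
next
  case (Node ks ts)
  show ?case
  proof (cases "xs = []")
    case True
    then show ?thesis using Node.prems set_inorder[OF Node.prems(1)] by simp
  next
    case False
    define ps where "ps = map (\<lambda>(t, ys). make_plan t ys) (zip ts (splits ks xs))"
    let ?us = "stitch ks (map (units B) ps)"
    have lts: "length ts = length ks + 1" using Node.prems(1) by simp
    have lps: "length ps = length ks + 1" using lts by (simp add: ps_def)
    have plan: "make_plan (Node ks ts) xs = PNode ks ps" using False by (simp add: make_plan_Node ps_def)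
    have ok: "plan_ok B (PNode ks ps)" using plan_ok_make_plan[OF Node.prems(1), of xs] plan by simp
    have closed: "\<forall>p\<in>set ps. closed_units (units B p)" using ok closed_units_units by auto
    have st: "closed_units ?us" "flat ?us = mix ks (map (\<lambda>p. flat (units B p)) ps)"
      "length ?us = (\<Sum>p\<leftarrow>ps. length (units B p))" "fst ` set ?us = (\<Union>p\<in>set ps. fst ` set (units B p))"
      using stitch_props[of "map (units B) ps" ks] closed lps by (simp_all add: comp_def)
    have sorted_ks: "sorted_wrt (<) ks" and sorted_ts: "\<forall>t\<in>set ts. sorted_wrt (<) (inorder t)"
      and sep_ts: "\<forall>i<length ks. (\<forall>x\<in>set (inorder (ts ! i)). x < ks ! i) \<and> (\<forall>x\<in>set (inorder (ts ! Suc i)). ks ! i < x)"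
      using Node.prems(3) sorted_mix_iff[of "map inorder ts" ks] lts by auto
    have IH: "sorted_wrt (<) (flat (units B (ps ! i))) \<and>
      set (flat (units B (ps ! i))) = keys (ts ! i) \<union> set (splits ks xs ! i) \<and>
      (\<forall>u\<in>set (units B (ps ! i)). balanced B (B div 2) (h - 1) (fst u))" if "i < length ts" for i
    proof -
      have "ps ! i = make_plan (ts ! i) (splits ks xs ! i)" using that lts by (simp add: ps_def)
      moreover have t: "ts ! i \<in> set ts" using that by simp
      moreover have "sorted_wrt (<) (splits ks xs ! i)"
        by (rule sorted_splits[OF Node.prems(4) nth_mem]) (use that lts in simp)
      ultimately show ?thesis
        using Node.IH[OF t, of "B div 2" "h - 1" "splits ks xs ! i"] Node.prems(1) sorted_ts by simp
    qed
    have ino: "set (inorder (ts ! i)) = keys (ts ! i)" if "i < length ts" for i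
      using set_inorder[of B "B div 2" "h - 1" "ts ! i"] Node.prems(1) that by simp
    have fl: "flat (units B (make_plan (Node ks ts) xs)) = mix ks (map (\<lambda>p. flat (units B p)) ps)"
      by (simp add: plan flat_regroup[OF st(1)] st(2))
    have lm: "length (map (\<lambda>p. flat (units B p)) ps) = length ks + 1" using lps by simp
    have split_sep: "\<forall>x\<in>set (splits ks xs ! i). x < ks ! i" "\<forall>x\<in>set (splits ks xs ! Suc i). ks ! i < x"
      if "i < length ks" for i
      using nth_splits[OF sorted_ks, of i xs] nth_splits[OF sorted_ks, of "Suc i" xs] that by auto
    have "sorted_wrt (<) (mix ks (map (\<lambda>p. flat (units B p)) ps))"
      unfolding sorted_mix_iff[OF lm]
    proof (intro conjI ballI allI impI)
      show "sorted_wrt (<) ks" by fact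
      show "sorted_wrt (<) xs'" if "xs' \<in> set (map (\<lambda>p. flat (units B p)) ps)" for xs'
        using that IH lps lts by (auto simp: in_set_conv_nth)
      show "x < ks ! i" if "i < length ks" "x \<in> set (map (\<lambda>p. flat (units B p)) ps ! i)" for i x
        using that IH[of i] ino[of i] sep_ts split_sep(1)[of i] lps lts by auto
      show "ks ! i < x" if "i < length ks" "x \<in> set (map (\<lambda>p. flat (units B p)) ps ! Suc i)" for i x
        using that IH[of "Suc i"] ino[of "Suc i"] sep_ts split_sep(2)[of i] lps lts by auto
    qed
    moreover have "set (mix ks (map (\<lambda>p. flat (units B p)) ps)) = keys (Node ks ts) \<union> set xs"
    proof -
      have "(\<Union>p\<in>set ps. set (flat (units B p))) = (\<Union>i<length ts. set (flat (units B (ps ! i))))"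
        using lps lts by (force simp: in_set_conv_nth)
      also have "\<dots> = (\<Union>i<length ts. keys (ts ! i) \<union> set (splits ks xs ! i))" using IH by auto
      also have "\<dots> = (\<Union>t\<in>set ts. keys t) \<union> (\<Union>ys\<in>set (splits ks xs). set ys)"
      proof -
        have "(\<Union>t\<in>set ts. keys t) = (\<Union>i<length ts. keys (ts ! i))" by (force simp: in_set_conv_nth)
        moreover have "(\<Union>ys\<in>set (splits ks xs). set ys) = (\<Union>i<length ts. set (splits ks xs ! i))"
          using lts by (force simp: in_set_conv_nth)
        ultimately show ?thesis by auto
      qed
      finally have "set (mix ks (map (\<lambda>p. flat (units B p)) ps)) =
          (\<Union>t\<in>set ts. keys t) \<union> (set ks \<union> (\<Union>ys\<in>set (splits ks xs). set ys))"
        using set_mix[OF lm] by auto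
      then show ?thesis unfolding set_splits by auto
    qed
    moreover have bal: "\<forall>u\<in>set ?us. balanced B (B div 2) (h - 1) (fst u)"
    proof
      fix u assume "u \<in> set ?us"
      then have "fst u \<in> (\<Union>p\<in>set ps. fst ` set (units B p))" unfolding st(4)[symmetric] by simp
      then obtain p v where "p \<in> set ps" "v \<in> set (units B p)" "fst u = fst v" by auto
      moreover then obtain i where "i < length ts" "p = ps ! i" using lps lts by (auto simp: in_set_conv_nth)
      ultimately show "balanced B (B div 2) (h - 1) (fst u)" using IH by auto
    qed
    \<comment> \<open>Every child leaves at least one unit and the old node had at least
      \<open>lo + 1\<close> children, so regrouping never faces too few units.\<close>
    moreover have "lo + 1 \<le> length ?us"
    proof -
      have "(\<Sum>p\<leftarrow>ps. 1) \<le> (\<Sum>p\<leftarrow>ps. length (units B p))"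
        by (rule sum_list_mono) (use closed in \<open>auto simp: closed_units_def Suc_le_eq\<close>)
      then show ?thesis using lps Node.prems(1) by (simp add: st(3) sum_list_triv)
    qed
    moreover have "Suc (h - 1) = h" using Node.prems(1) by simp
    ultimately show ?thesis
      unfolding fl using balanced_regroup[OF st(1) bal _ Node.prems(2)] length_regroup[OF st(1), of B]
      by (simp add: plan)
  qed
qed

section \<open>Work of the distribution phase\<close>

definition stride :: "nat \<Rightarrow> nat \<Rightarrow> nat" where
  "stride k b = max 1 (nat \<lfloor>sqrt (real k / real b)\<rfloor>)"

text \<open>The 8 is for three loads of the node and five stores of its planned copy. The other
  terms are the sample and, for a proper sample, two searches of at most \<open>s - 1\<close> reads
  for each key.\<close>

definition node_cost :: "nat \<Rightarrow> nat \<Rightarrow> nat" where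
  "node_cost k b = (let s = stride k b in
     8 + (k + s - 1) div s + (if s = 1 then 0 else 2 * b * (s - 1)))"

text \<open>With \<open>q = sqrt (k * b)\<close> and \<open>x = sqrt (k / b)\<close> one has
  \<open>k = x * q\<close> and \<open>b * x = q\<close>, so sampling and searching are both
  \<open>O(q)\<close> at a stride close to \<open>x\<close>. The weights \<open>a\<close> and
  \<open>e\<close> are left open to be chosen per level.\<close>

lemma node_cost_le:
  assumes "1 \<le> k" "1 \<le> b"
  shows "real (node_cost k b) \<le> 12 * real k"
    and "0 \<le> a \<Longrightarrow> 0 \<le> e \<Longrightarrow> a * e = 1 \<Longrightarrow> real (node_cost k b) \<le> 12 * (a * real k + e * real b)"
proof -
  define x q s where "x = sqrt (real k / real b)" "q = sqrt (real k * real b)" "s = stride k b"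
  have xq: "x * q = k" "b * x = q"
  proof -
    have "x * q = sqrt ((real k / real b) * (real k * real b))"
      unfolding x_q_s_def by (rule real_sqrt_mult[symmetric])
    also have "(real k / real b) * (real k * real b) = (real k)\<^sup>2" using assms by (simp add: power2_eq_square)
    finally show "x * q = k" by simp
    have "b * x = sqrt ((real b)\<^sup>2) * x" by simp
    also have "\<dots> = sqrt ((real b)\<^sup>2 * (real k / real b))" unfolding x_q_s_def by (rule real_sqrt_mult[symmetric])
    also have "(real b)\<^sup>2 * (real k / real b) = real k * real b" using assms by (simp add: power2_eq_square)
    finally show "b * x = q" by (simp add: x_q_s_def)
  qed
  have "1 * 1 \<le> real k * real b" using assms by (intro mult_mono) auto
  then have q1: "1 \<le> q" by (simp add: x_q_s_def)
  have x0: "0 < x" using assms by (simp add: x_q_s_def)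
  have s: "1 \<le> s" "x < s + 1" "s \<noteq> 1 \<Longrightarrow> s \<le> x"
  proof -
    have "s = max 1 (nat \<lfloor>x\<rfloor>)" by (simp add: x_q_s_def stride_def)
    moreover have "real (nat \<lfloor>x\<rfloor>) = real_of_int \<lfloor>x\<rfloor>" using x0 by simp
    ultimately have rs: "real s = max 1 (real_of_int \<lfloor>x\<rfloor>)" by (simp only: of_nat_max of_nat_1)
    have fl: "real_of_int \<lfloor>x\<rfloor> \<le> x" "x < real_of_int \<lfloor>x\<rfloor> + 1" by linarith+
    show "1 \<le> s" using rs by linarith
    show "x < s + 1" using rs fl by linarith
    show "s \<le> x" if "s \<noteq> 1"
    proof -
      have "real s \<noteq> 1" using that by simp
      then show ?thesis using rs fl by (simp add: max_def split: if_splits)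
    qed
  qed
  have cost: "real (node_cost k b) \<le> 12 * k \<and> real (node_cost k b) \<le> 13 * q"
  proof (cases "s = 1")
    case True
    then have "node_cost k b = 8 + k" by (simp add: node_cost_def Let_def x_q_s_def)
    \<comment> \<open>Stride 1 means \<open>x < 2\<close>.\<close>
    moreover have "k \<le> 2 * q" unfolding xq(1)[symmetric] using s(2) True q1 by (intro mult_right_mono) auto
    ultimately show ?thesis using q1 assms by simp
  next
    case False
    then have "2 \<le> s" using s(1) by simp
    then have x2: "2 \<le> x" using s(3)[OF False] by simp
    have "real ((k + s - 1) div s) \<le> real (k + s - 1) / s" by (rule of_nat_div_le_of_nat)
    also have "\<dots> \<le> k / s + 1" using s(1) by (simp add: field_simps)
    also have "k / s \<le> 2 * q"
    proof -
      have "x \<le> 2 * s" using s(1,2) by simp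
      then have "x * q \<le> 2 * s * q" using q1 by (intro mult_right_mono) auto
      then show ?thesis using s(1) xq(1) by (simp add: field_simps)
    qed
    finally have "real ((k + s - 1) div s) \<le> 2 * q + 1" by simp
    moreover have "real (2 * b * (s - 1)) \<le> 2 * q"
    proof -
      have "real b * real (s - 1) \<le> b * x" using s(1) s(3)[OF False] by (intro mult_left_mono) auto
      then show ?thesis using xq(2) by simp
    qed
    moreover have "node_cost k b = 8 + (k + s - 1) div s + 2 * b * (s - 1)"
      using False by (simp add: node_cost_def Let_def x_q_s_def)
    ultimately have "real (node_cost k b) \<le> 9 + 4 * q" by simp
    moreover have "2 * q \<le> k" unfolding xq(1)[symmetric] using x2 q1 by (intro mult_right_mono) auto
    ultimately show ?thesis using q1 assms by simp
  qed
  then show "real (node_cost k b) \<le> 12 * real k" by simp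
  show "real (node_cost k b) \<le> 12 * (a * real k + e * real b)" if "0 \<le> a" "0 \<le> e" "a * e = 1"
  proof -
    \<comment> \<open>AM-GM for \<open>a * k\<close> and \<open>e * b\<close>, whose product is
      \<open>k * b\<close>. As the sum is at least \<open>2 * q\<close>, the factor 12 has room for
      the 13 in front of \<open>q\<close>.\<close>
    have "sqrt ((a * k) * (e * b)) \<le> (a * k + e * b) / 2"
      using that by (intro arith_geo_mean_sqrt) auto
    moreover have "(a * k) * (e * b) = real k * real b" using that(3) by (metis mult.assoc mult.commute mult.left_commute mult_1)
    ultimately have "2 * q \<le> a * k + e * b" by (simp add: x_q_s_def)
    moreover have "real (node_cost k b) \<le> 13 * q" using cost by blast
    moreover have "12 * X \<ge> 13 * q" if "2 * q \<le> X" for X using that q1 by linarith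
    ultimately show ?thesis by (meson order_trans)
  qed
qed

lemma real_sum_list: "real (sum_list xs) = sum_list (map real xs)"
  by (induction xs) simp_all

primrec plan_work :: "'k::linorder btree \<Rightarrow> 'k list \<Rightarrow> nat" where
  "plan_work Ext = (\<lambda>xs. 0)"
| "plan_work (Node ks ts) = (\<lambda>xs. if xs = [] then 0 else
     node_cost (length xs) (length ks) + sum_list (map2 (\<lambda>f ys. f ys) (map plan_work ts) (splits ks xs)))"

lemma plan_work_Nil [simp]: "plan_work t [] = 0"
  by (cases t) simp_all

lemma plan_work_Node: "xs \<noteq> [] \<Longrightarrow> plan_work (Node ks ts) xs =
    node_cost (length xs) (length ks) + (\<Sum>(t, ys)\<leftarrow>zip ts (splits ks xs). plan_work t ys)"
  by (simp add: zip_map1 comp_def case_prod_unfold)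

declare plan_work.simps(2) [simp del]

text \<open>Charges building, whose cost is linear in touched nodes and new keys, to the
  distribution phase.\<close>

lemma touched_le_plan_work: "8 * touched (make_plan t xs) \<le> plan_work t xs"
proof (induction t arbitrary: xs)
  case (Node ks ts)
  show ?case
  proof (cases "xs = []")
    case False
    have "8 * (\<Sum>(t, ys)\<leftarrow>zip ts (splits ks xs). touched (make_plan t ys)) =
        (\<Sum>(t, ys)\<leftarrow>zip ts (splits ks xs). 8 * touched (make_plan t ys))"
      by (simp add: sum_list_const_mult[symmetric] case_prod_unfold)
    also have "\<dots> \<le> (\<Sum>(t, ys)\<leftarrow>zip ts (splits ks xs). plan_work t ys)"
      by (rule sum_list_mono) (auto dest!: set_zip_leftD intro: Node.IH)
    moreover have "8 \<le> node_cost (length xs) (length ks)" by (simp add: node_cost_def Let_def)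
    ultimately show ?thesis using False
      by (simp add: make_plan_Node plan_work_Node comp_def case_prod_unfold)
  qed simp
qed simp

text \<open>\<open>num_keys t + 1\<close> is the number of external nodes of a balanced tree; unlike
  the number of keys, it is additive over children.\<close>

lemma num_keys_ge_power: "balanced B (B div 2) h t \<Longrightarrow> (B div 2 + 1) ^ h \<le> num_keys t + 1"
proof (induction t arbitrary: h)
  case (Node ks ts)
  have "(B div 2 + 1) ^ h = (B div 2 + 1) * (B div 2 + 1) ^ (h - 1)"
    using Node.prems by (metis balanced.simps(2) power_eq_if less_numeral_extra(3))
  also have "\<dots> \<le> length ts * (B div 2 + 1) ^ (h - 1)" using Node.prems by simp
  also have "\<dots> = (\<Sum>t\<leftarrow>ts. (B div 2 + 1) ^ (h - 1))" by (simp add: sum_list_triv)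
  also have "\<dots> \<le> (\<Sum>t\<leftarrow>ts. num_keys t + 1)" by (rule sum_list_mono) (use Node in auto)
  also have "\<dots> = num_keys (Node ks ts) + 1" using Node.prems by (simp add: sum_list_Suc)
  finally show ?case .
qed simp

text \<open>The keys of a node are charged to its own subtree, so summing over the nodes of one
  height gives the decrease by the factor \<open>B div 2 + 1\<close> per level.\<close>

lemma keys_times_power_le:
  assumes "balanced B lo h (Node ks ts)"
  shows "length ks * (B div 2 + 1) ^ (h - 1) \<le> num_keys (Node ks ts) + 1"
proof -
  have "length ks * (B div 2 + 1) ^ (h - 1) \<le> length ts * (B div 2 + 1) ^ (h - 1)" using assms by simp
  also have "\<dots> = (\<Sum>t\<leftarrow>ts. (B div 2 + 1) ^ (h - 1))" by (simp add: sum_list_triv)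
  also have "\<dots> \<le> (\<Sum>t\<leftarrow>ts. num_keys t + 1)"
    by (rule sum_list_mono) (use assms num_keys_ge_power in auto)
  also have "\<dots> = num_keys (Node ks ts) + 1" using assms by (simp add: sum_list_Suc)
  finally show ?thesis .
qed

text \<open>Index \<open>j\<close> is the height of the children of a node. On each level the cost
  is bounded either by the arriving keys alone (\<open>a j = 1\<close>, \<open>e j = 0\<close>) or
  by the weighted AM-GM bound. Both measures are subadditive over the children, so the levels add
  up.\<close>

lemma plan_work_le:
  fixes a e :: "nat \<Rightarrow> real"
  assumes B: "2 \<le> B" and ae: "\<And>j. 0 \<le> a j" "\<And>j. 0 \<le> e j" "\<And>j. a j = 1 \<and> e j = 0 \<or> a j * e j = 1"
  shows "balanced B lo h t \<Longrightarrow> 1 \<le> lo \<Longrightarrow> real (plan_work t xs) \<le>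
    12 * ((\<Sum>j<h. a j) * length xs + (\<Sum>j<h. e j / real (B div 2 + 1) ^ j) * (num_keys t + 1))"
proof (induction t arbitrary: lo h xs)
  case Ext
  then show ?case by simp
next
  case (Node ks ts)
  let ?D = "real (B div 2 + 1)"
  define g where "g = h - 1"
  have h: "h = Suc g" using Node.prems(1) by (simp add: g_def)
  let ?A = "\<Sum>j<g. a j" and ?E = "\<Sum>j<g. e j / ?D ^ j"
  have nonneg: "0 \<le> ?A" "0 \<le> ?E" "0 \<le> (\<Sum>j<h. a j)" "0 \<le> (\<Sum>j<h. e j / ?D ^ j)" using ae by (auto intro!: sum_nonneg)
  show ?case
  proof (cases "xs = []")
    case True
    then show ?thesis using nonneg by simp
  next
    case False
    let ?k = "length xs" and ?b = "length ks" and ?N = "num_keys (Node ks ts)"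
    have kb: "1 \<le> ?k" "1 \<le> ?b" using False Node.prems by (auto simp: Suc_le_eq)
    have "real (node_cost ?k ?b) \<le> 12 * (a g * ?k + e g * ?b)"
      using node_cost_le(1)[OF kb] node_cost_le(2)[OF kb ae(1,2)[of g]] ae(3)[of g] by auto
    moreover have "e g * ?b \<le> e g / ?D ^ g * (?N + 1)"
    proof -
      have "real (?b * (B div 2 + 1) ^ g) \<le> real (?N + 1)"
        using keys_times_power_le[OF Node.prems(1)] unfolding g_def of_nat_le_iff .
      then have "real ?b * ?D ^ g \<le> real (?N + 1)" by simp
      moreover have D: "0 < ?D ^ g" by simp
      ultimately have "real ?b \<le> real (?N + 1) / ?D ^ g" by (simp add: pos_le_divide_eq)
      then have "e g * ?b \<le> e g * (real (?N + 1) / ?D ^ g)" using ae(2) by (intro mult_left_mono)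
      then show ?thesis by simp
    qed
    ultimately have 1: "real (node_cost ?k ?b) \<le> 12 * (a g * ?k + e g / ?D ^ g * (?N + 1))"
      by (meson add_left_mono mult_left_mono order_trans zero_le_numeral)
    have len: "length ts = length (splits ks xs)" using Node.prems by simp
    have "real (\<Sum>(t, ys)\<leftarrow>zip ts (splits ks xs). plan_work t ys) =
        (\<Sum>(t, ys)\<leftarrow>zip ts (splits ks xs). real (plan_work t ys))"
      by (simp add: real_sum_list case_prod_unfold comp_def)
    also have "\<dots> \<le> (\<Sum>(t, ys)\<leftarrow>zip ts (splits ks xs). 12 * ?E * (num_keys t + 1) + 12 * ?A * length ys)"
    proof (rule sum_list_mono, clarify)
      fix t ys assume "(t, ys) \<in> set (zip ts (splits ks xs))"
      from set_zip_leftD[OF this] show "real (plan_work t ys) \<le> 12 * ?E * (num_keys t + 1) + 12 * ?A * length ys"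
        using Node.IH[of t "B div 2" g ys] Node.prems B by (simp add: h algebra_simps)
    qed
    also have "\<dots> = (\<Sum>t\<leftarrow>ts. 12 * ?E * (num_keys t + 1)) + (\<Sum>ys\<leftarrow>splits ks xs. 12 * ?A * length ys)"
      by (rule sum_list_zip_add[OF len])
    also have "(\<Sum>t\<leftarrow>ts. 12 * ?E * (num_keys t + 1)) = 12 * ?E * (?N + 1)"
    proof -
      have "?N + 1 = (\<Sum>t\<leftarrow>ts. num_keys t + 1)" using Node.prems by (simp add: sum_list_Suc)
      then have "real (?N + 1) = (\<Sum>t\<leftarrow>ts. real (num_keys t + 1))" by (simp only: real_sum_list map_map comp_def)
      then show ?thesis by (simp add: sum_list_const_mult)
    qed
    also have "(\<Sum>ys\<leftarrow>splits ks xs. 12 * ?A * length ys) \<le> 12 * ?A * ?k"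
    proof -
      have "(\<Sum>ys\<leftarrow>splits ks xs. 12 * ?A * length ys) = 12 * ?A * real (sum_list (map length (splits ks xs)))"
        by (simp add: sum_list_const_mult real_sum_list comp_def)
      also have "\<dots> \<le> 12 * ?A * ?k" using nonneg sum_length_splits[of ks xs] by (intro mult_left_mono) auto
      finally show ?thesis .
    qed
    finally have 2: "real (\<Sum>(t, ys)\<leftarrow>zip ts (splits ks xs). plan_work t ys) \<le> 12 * ?E * (?N + 1) + 12 * ?A * ?k" by simp
    have "real (plan_work (Node ks ts) xs) = real (node_cost ?k ?b) + real (\<Sum>(t, ys)\<leftarrow>zip ts (splits ks xs). plan_work t ys)"
      using False by (simp add: plan_work_Node)
    then show ?thesis using 1 2 by (simp add: h algebra_simps del: num_keys.simps)
  qed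
qed

lemma plan_work_linear:
  assumes B: "2 \<le> B" and t: "balanced B lo h t" "1 \<le> lo"
    and J: "num_keys t \<le> m * (B div 2 + 1) ^ J" and m: "length xs \<le> m" "1 \<le> m"
  shows "plan_work t xs \<le> 12 * m * (J + 11)"
proof -
  \<comment> \<open>up to height \<open>J\<close> a node is charged to the distributed keys, above it by AM-GM to both kinds of keys\<close>
  define a e :: "nat \<Rightarrow> real" where "a = (\<lambda>j. if j < J then 1 else (2/3) ^ (j - J))"
    and "e = (\<lambda>j. if j < J then 0 else (3/2) ^ (j - J))"
  define D where "D = real (B div 2 + 1)"
  have D: "2 \<le> D" using B by (simp add: D_def)
  have ae: "0 \<le> a j" "0 \<le> e j" "a j = 1 \<and> e j = 0 \<or> a j * e j = 1" for j
    by (simp_all add: a_def e_def flip: power_mult_distrib)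
  \<comment> \<open>The ratio \<open>3/2\<close> lies strictly between 1 and \<open>D >= 2\<close>:
    the weights on arriving keys decrease by \<open>2/3\<close> and sum to at most 3, those on tree
    keys decrease by \<open>3/4\<close> after division by \<open>D ^ j\<close> and give the factor
    4. Together they yield \<open>J + 3 + 4 * 2\<close>.\<close>
  have A: "(\<Sum>j<J+d. a j) = J + 3 * (1 - (2/3) ^ d)" for d
    by (induction d) (simp_all add: a_def algebra_simps)
  have E: "(\<Sum>j<J+d. e j / D ^ j) \<le> 4 / D ^ J * (1 - (3/4) ^ d)" for d
  proof (induction d)
    case 0
    have "(\<Sum>j<J. e j / D ^ j) = 0" by (simp add: e_def)
    then show ?case by simp
  next
    case (Suc d)
    have "(3/2) ^ d / D ^ d \<le> (3/4 :: real) ^ d"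
      unfolding power_divide[symmetric] using D by (intro power_mono) (auto simp: field_simps)
    then have "(3/2) ^ d / D ^ d / D ^ J \<le> (3/4) ^ d / D ^ J" using D by (intro divide_right_mono) auto
    then have "e (J + d) / D ^ (J + d) \<le> (3/4) ^ d / D ^ J" by (simp add: e_def power_add mult.commute)
    then show ?case using Suc by (simp add: algebra_simps)
  qed
  have "(\<Sum>j<h. a j) \<le> (\<Sum>j<J+h. a j)" using ae(1) by (intro sum_mono2) auto
  also have "\<dots> \<le> J + 3" unfolding A by simp
  finally have A': "(\<Sum>j<h. a j) \<le> J + 3" .
  have "(\<Sum>j<h. e j / D ^ j) \<le> (\<Sum>j<J+h. e j / D ^ j)" using ae(2) D by (intro sum_mono2) auto
  also have "\<dots> \<le> 4 / D ^ J * (1 - (3/4) ^ h)" by (rule E)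
  also have "\<dots> \<le> 4 / D ^ J * 1" using D by (intro mult_left_mono) auto
  finally have E': "(\<Sum>j<h. e j / D ^ j) \<le> 4 / D ^ J" by simp
  have "real (num_keys t) \<le> real (m * (B div 2 + 1) ^ J)" using J unfolding of_nat_le_iff .
  then have "real (num_keys t) \<le> m * D ^ J" by (simp add: D_def)
  moreover have "1 * 1 \<le> m * D ^ J" using m D by (intro mult_mono one_le_power) auto
  ultimately have N: "real (num_keys t + 1) \<le> 2 * (m * D ^ J)" by simp
  have "real (plan_work t xs) \<le> 12 * ((\<Sum>j<h. a j) * length xs + (\<Sum>j<h. e j / D ^ j) * (num_keys t + 1))"
    unfolding D_def by (rule plan_work_le[OF B ae t])
  also have "\<dots> \<le> 12 * ((J + 3) * m + 4 / D ^ J * (2 * (m * D ^ J)))"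
  proof -
    have "(\<Sum>j<h. a j) * length xs \<le> (real J + 3) * m"
      using A' m by (intro mult_mono) auto
    moreover have "(\<Sum>j<h. e j / D ^ j) * (num_keys t + 1) \<le> 4 / D ^ J * (2 * (m * D ^ J))"
      using E' N D by (intro mult_mono) auto
    ultimately show ?thesis by simp
  qed
  also have "\<dots> = real (12 * m * (J + 11))" using D by (simp add: algebra_simps)
  finally show ?thesis unfolding of_nat_le_iff .
qed

section \<open>Raising the root until one unit remains\<close>

function levels :: "nat \<Rightarrow> nat \<Rightarrow> nat" where
  "levels B c = (if c \<le> 1 \<or> B = 0 then 0 else Suc (levels B (groups B c)))"
  by pat_completeness auto
termination
proof (relation "measure snd")
  fix B c :: nat assume "\<not> (c \<le> 1 \<or> B = 0)"
  then have "c + B < c * (B + 1)" by (cases c; cases B) auto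
  then show "((B, groups B c), (B, c)) \<in> measure snd"
    by (simp add: groups_def less_mult_imp_div_less del: mult_Suc_right)
qed simp

declare levels.simps [simp del]

lemma groups_double: "2 \<le> B \<Longrightarrow> 2 \<le> c \<Longrightarrow> 2 * groups B c \<le> c"
proof (rule ccontr)
  assume *: "2 \<le> B" "2 \<le> c" "\<not> 2 * groups B c \<le> c"
  have g: "groups B c * (B + 1) \<le> c + B" unfolding groups_def by (rule div_times_less_eq_dividend)
  define g where "g = groups B c"
  have "c \<le> 2 * g - 1" using * by (simp add: g_def)
  then have "g * (B + 1) \<le> 2 * g - 1 + B" using g unfolding g_def by (rule le_trans[rotated, OF add_le_mono1])
  moreover have "2 \<le> g" using * by (simp add: g_def)
  then obtain g' where "g = g' + 2" by (metis add.commute le_Suc_ex)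
  moreover obtain B' where "B = B' + 2" using *(1) by (metis add.commute le_Suc_ex)
  ultimately show False by (simp add: algebra_simps)
qed

text \<open>One level divides \<open>c - 1\<close> by at least \<open>B + 1\<close>, since
  \<open>(groups B c - 1) * (B + 1) <= c - 1\<close>.\<close>

lemma power_levels: "2 \<le> B \<Longrightarrow> 2 \<le> c \<Longrightarrow> (B + 1) ^ (levels B c - 1) \<le> c - 1"
proof (induction B c rule: levels.induct)
  case (1 B c)
  have l: "levels B c = Suc (levels B (groups B c))" using 1 by (subst levels.simps) simp
  show ?case
  proof (cases "2 \<le> groups B c")
    case True
    then have IH: "(B + 1) ^ (levels B (groups B c) - 1) \<le> groups B c - 1" using 1 by simp
    have "levels B (groups B c) = Suc (levels B (groups B c) - 1)"
      using True 1(2) by (subst (1 2) levels.simps) simp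
    then have "(B + 1) ^ (levels B c - 1) = (B + 1) * (B + 1) ^ (levels B (groups B c) - 1)"
      unfolding l by (metis diff_Suc_1 power_Suc)
    also have "\<dots> \<le> (B + 1) * (groups B c - 1)" using IH by (rule mult_le_mono2)
    also have "\<dots> = groups B c * (B + 1) - (B + 1)" by (simp add: algebra_simps)
    also have "\<dots> \<le> c + B - (B + 1)"
      unfolding groups_def by (intro diff_le_mono div_times_less_eq_dividend)
    finally show ?thesis by simp
  next
    case False
    then have "levels B (groups B c) = 0" by (subst levels.simps) simp
    then show ?thesis using l 1(3) by simp
  qed
qed

text \<open>The count at least halves per level. The linear bound lets the stores of the lifting
  phase be charged to the distributed keys.\<close>

lemma levels_le: "2 \<le> B \<Longrightarrow> levels B c \<le> c - 1"
proof (induction B c rule: levels.induct)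
  case (1 B c)
  show ?case
  proof (cases "c \<le> 1")
    case True
    then show ?thesis by (subst levels.simps) simp
  next
    case False
    then have "levels B (groups B c) \<le> groups B c - 1" using 1 by simp
    moreover have "2 * groups B c \<le> c" using groups_double[OF 1(2), of c] False by simp
    moreover have "levels B c = Suc (levels B (groups B c))" using 1(2) False by (subst levels.simps) simp
    ultimately show ?thesis using False by linarith
  qed
qed

text \<open>Invariant while levels are added on top. A single unit may have an undersized root, but
  as soon as there are several, each of them must be a legal child.\<close>

definition fit_plan :: "nat \<Rightarrow> nat \<Rightarrow> 'k list \<Rightarrow> 'k plan \<Rightarrow> bool" where
  "fit_plan B h zs p \<longleftrightarrow> plan_ok B p \<and> flat (units B p) = zs \<and>
     (\<forall>u\<in>set (units B p). balanced B 1 h (fst u)) \<and>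
     (2 \<le> length (units B p) \<longrightarrow> (\<forall>u\<in>set (units B p). balanced B (B div 2) h (fst u)))"

lemma units_lift: "units B (PNode [] [p]) = regroup B (units B p)"
  by simp

text \<open>A node without keys and with one child stands for the new level, and its units are the
  regrouped units below. Two or more units to regroup give even a single group at least one
  key.\<close>

lemma fit_plan_lift:
  assumes "2 \<le> B" "fit_plan B h zs p" "2 \<le> length (units B p)"
  shows "fit_plan B (Suc h) zs (PNode [] [p])"
proof -
  have c: "closed_units (units B p)" using assms(2) closed_units_units by (auto simp: fit_plan_def)
  have b: "\<forall>u\<in>set (units B p). balanced B (B div 2) h (fst u)" using assms(2,3) by (simp add: fit_plan_def)
  show ?thesis
    unfolding fit_plan_def units_lift flat_regroup[OF c] length_regroup[OF c]
    using balanced_regroup[OF c b, of 1] assms by (auto simp: fit_plan_def)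
qed

section \<open>Implementation\<close>

fun num :: "'k word \<Rightarrow> nat" where
  "num (Num n) = n"
| "num _ = 0"

fun region :: "'k word \<Rightarrow> nat" where
  "region (Ref r) = r"
| "region _ = 0"

fun key :: "'k word \<Rightarrow> 'k" where
  "key (Key k) = k"

fun is_ref :: "'k word \<Rightarrow> bool" where
  "is_ref (Ref r) = True"
| "is_ref _ = False"

fun is_key :: "'k word \<Rightarrow> bool" where
  "is_key (Key k) = True"
| "is_key _ = False"

fun chop :: "'a list \<Rightarrow> 'a list list" where
  "chop (a # b # c # d # e # f # xs) = [a, b, c, d, e, f] # chop xs"
| "chop _ = []"

fun pairs :: "'a list \<Rightarrow> ('a \<times> 'a) list" where
  "pairs (a # b # xs) = (a, b) # pairs xs"
| "pairs _ = []"

lemma chop_concat: "\<forall>t\<in>set ts. length t = 6 \<Longrightarrow> chop (concat ts) = ts"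
proof (induction ts)
  case (Cons t ts)
  then have "length t = Suc (Suc (Suc (Suc (Suc (Suc 0)))))" by simp
  then obtain a b c d e f where "t = [a, b, c, d, e, f]"
    by (auto simp: length_Suc_conv)
  then show ?case using Cons by simp
qed simp

lemma pairs_concat: "\<forall>r\<in>set rs. length r = 2 \<Longrightarrow> pairs (concat rs) = map (\<lambda>r. (r ! 0, r ! 1)) rs"
proof (induction rs)
  case (Cons r rs)
  then have "length r = Suc (Suc 0)" by simp
  then obtain a b where "r = [a, b]" by (auto simp: length_Suc_conv)
  then show ?case using Cons by simp
qed simp

text \<open>The first word of the arguments selects the procedure; tasks run by \<open>par\<close> are padded to six
  words and return two.\<close>

definition par :: "'k word list list \<Rightarrow> (('k word \<times> 'k word) list \<Rightarrow> 'k code) \<Rightarrow> 'k code" where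
  "par ts k = Fk [Num 1 # concat (take (length ts div 2) ts), Num 1 # concat (drop (length ts div 2) ts)]
     (\<lambda>rs. k (pairs (concat rs)))"

text \<open>Working copies attach one word to each child pointer, a size or a number of units. There
  are up to \<open>B + 1\<close> such words, so like the pointers they take two blocks.\<close>

definition put_node :: "'k word list \<Rightarrow> ('k word \<times> 'k word) list \<Rightarrow> (nat \<Rightarrow> 'k code) \<Rightarrow> 'k code" where
  "put_node ks cs k = Al (\<lambda>r. St r 0 ks (St r 1 (map fst (butlast cs)) (St r 2 [fst (last cs)]
     (St r 3 (map snd (butlast cs)) (St r 4 [snd (last cs)] (k r))))))"

definition get_node :: "nat \<Rightarrow> ('k word list \<Rightarrow> ('k word \<times> 'k word) list \<Rightarrow> 'k code) \<Rightarrow> 'k code" where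
  "get_node r k = Ld r 0 (\<lambda>ks. Ld r 1 (\<lambda>ps. Ld r 2 (\<lambda>p. Ld r 3 (\<lambda>cs. Ld r 4 (\<lambda>c.
     k ks (zip (ps @ p) (cs @ c)))))))"

definition annotate_task :: "'k word \<Rightarrow> 'k word list" where
  "annotate_task w = [Num 2, w, Num 0, Num 0, Num 0, Num 0]"

text \<open>Sizes are returned bottom-up and left in a copy of the tree, from which a thread can
  compute the array offsets of all children without further reads.\<close>

definition annotate_code :: "'k word \<Rightarrow> 'k code" where
  "annotate_code w = (if is_ref w then
     Ld (region w) 0 (\<lambda>ks. Ld (region w) 1 (\<lambda>ps. Ld (region w) 2 (\<lambda>p.
       par (map annotate_task (ps @ p)) (\<lambda>rs.
       put_node ks rs (\<lambda>r. Ret [Ref r, Num (length ks + (\<Sum>x\<leftarrow>rs. num (snd x)))])))))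
   else Ret [Num 0, Num 0])"

definition flatten_task :: "'k word \<Rightarrow> 'k word \<Rightarrow> nat \<Rightarrow> nat \<Rightarrow> 'k word \<Rightarrow> 'k word list" where
  "flatten_task a w sz off kw = [Num 3, a, w, Num sz, Num off, kw]"

text \<open>Storing its own keys one after another would give a node span linear in
  \<open>B\<close>. Each key is instead handed as \<open>kw\<close> to the task of the child on its
  left, which stores it right behind its own stretch of the array; \<open>Num 0\<close> means that
  no key follows.\<close>

definition flatten_code :: "'k word \<Rightarrow> 'k word \<Rightarrow> nat \<Rightarrow> nat \<Rightarrow> 'k word \<Rightarrow> 'k code" where
  "flatten_code a w sz off kw =
     (let rest = if sz = 0 then Ret [Num 0, Num 0] else
        get_node (region w) (\<lambda>ks cs.
          par (map (\<lambda>i. flatten_task a (fst (cs ! i)) (num (snd (cs ! i)))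
                 (off + (\<Sum>j<i. num (snd (cs ! j)) + 1)) ((ks @ [Num 0]) ! i)) [0..<length cs])
            (\<lambda>_. Ret [Num 0, Num 0]))
      in if is_key kw then St (region a) (off + sz) [kw] rest else rest)"

definition count_args :: "'k word \<Rightarrow> nat \<Rightarrow> nat \<Rightarrow> nat \<Rightarrow> 'k word list \<Rightarrow> 'k word list \<Rightarrow> 'k word list" where
  "count_args a p s n ys zs = [Num 4, a, Num p, Num s, Num n, Num (length ys)] @ ys @ zs"

text \<open>Halving by forks gives \<open>n\<close> reads with span one. The keys to be ranked
  travel in the arguments, those of \<open>ys\<close> to be ranked strictly and those of
  \<open>zs\<close> weakly.\<close>

definition count_code :: "'k::linorder word \<Rightarrow> nat \<Rightarrow> nat \<Rightarrow> nat \<Rightarrow> 'k word list \<Rightarrow> 'k word list \<Rightarrow> 'k code" where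
  "count_code a p s n ys zs =
     (if n = 0 then Ret (map (\<lambda>_. Num 0) (ys @ zs))
      else if n = 1 then Ld (region a) p (\<lambda>x.
        Ret (map (\<lambda>y. Num (if key (hd x) < key y then 1 else 0)) ys @
             map (\<lambda>z. Num (if key (hd x) \<le> key z then 1 else 0)) zs))
      else Fk [count_args a p s (n div 2) ys zs, count_args a (p + n div 2 * s) s (n - n div 2) ys zs]
        (\<lambda>rs. Ret (map2 (\<lambda>u v. Num (num u + num v)) (rs ! 0) (rs ! 1))))"

text \<open>If \<open>c\<close> samples of stride \<open>s\<close> satisfy a predicate that holds for a prefix of the sampled list, then
  the prefix ends between sample \<open>c - 1\<close> and sample \<open>c\<close>.\<close>

definition resume :: "nat \<Rightarrow> nat \<Rightarrow> nat" where
  "resume s c = (if c = 0 then 0 else (c - 1) * s + 1)"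

definition remaining :: "nat \<Rightarrow> nat \<Rightarrow> nat \<Rightarrow> nat" where
  "remaining k s c = (if c = 0 then 0 else min (s - 1) (k - resume s c))"

definition rank_args :: "'k word \<Rightarrow> nat \<Rightarrow> nat \<Rightarrow> nat \<Rightarrow> nat \<Rightarrow> nat \<Rightarrow> 'k word \<Rightarrow> 'k word list" where
  "rank_args a p k s c c' y = [Num 5, a, Num p, Num k, Num s, Num c, Num c', y]"

definition rank_code :: "'k word \<Rightarrow> nat \<Rightarrow> nat \<Rightarrow> nat \<Rightarrow> nat \<Rightarrow> nat \<Rightarrow> 'k word \<Rightarrow> 'k code" where
  "rank_code a p k s c c' y =
     Fk [count_args a (p + resume s c) 1 (remaining k s c) [y] [],
         count_args a (p + resume s c') 1 (remaining k s c') [] [y]]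
       (\<lambda>rs. Ret [Num (resume s c + num (rs ! 0 ! 0)), Num (resume s c' + num (rs ! 1 ! 0))])"

definition plan_task :: "'k word \<Rightarrow> 'k word \<Rightarrow> nat \<Rightarrow> nat \<Rightarrow> 'k word list" where
  "plan_task a w p q = [Num 6, a, w, Num p, Num q, Num 0]"

text \<open>\<open>us\<close> and \<open>vs\<close> are strict and weak ranks relative to
  \<open>p\<close>. Child \<open>i\<close> starts behind the array keys that are at most its left
  key and ends before those not below its right key.\<close>

definition descend_code :: "nat \<Rightarrow> 'k word \<Rightarrow> 'k word list \<Rightarrow> 'k word list \<Rightarrow> nat \<Rightarrow> nat \<Rightarrow> nat list \<Rightarrow> nat list \<Rightarrow> 'k code" where
  "descend_code B a ks ps p q us vs =
     par (map (\<lambda>i. plan_task a (ps ! i) (if i = 0 then p else p + vs ! (i - 1))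
                      (if i < length ks then p + us ! i else q)) [0..<length ps])
       (\<lambda>rs. put_node ks rs (\<lambda>r. Ret [Ref r, Num (groups B (\<Sum>x\<leftarrow>rs. max 1 (num (snd x))))]))"

text \<open>The number returned also tells the kinds of plan apart: 0 marks an untouched subtree,
  whose original pointer is returned. At an external node that keys have reached, the first word is
  the array position and the number is at least 2.\<close>

definition plan_code :: "nat \<Rightarrow> 'k word \<Rightarrow> 'k word \<Rightarrow> nat \<Rightarrow> nat \<Rightarrow> 'k code" where
  "plan_code B a w p q =
     (if q \<le> p then Ret [w, Num 0]
      else if is_ref w then
        Ld (region w) 0 (\<lambda>ks. Ld (region w) 1 (\<lambda>ps. Ld (region w) 2 (\<lambda>p'.
          let k = q - p; b = length ks; s = stride k b in
          Fk [count_args a p s ((k + s - 1) div s) ks ks] (\<lambda>rs.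
            let c = map num (rs ! 0) in
            if s = 1 then descend_code B a ks (ps @ p') p q (take b c) (drop b c)
            else Fk (map (\<lambda>j. rank_args a p k s (c ! j) (c ! (b + j)) (ks ! j)) [0..<b]) (\<lambda>rs'.
              descend_code B a ks (ps @ p') p q (map (\<lambda>r. num (r ! 0)) rs') (map (\<lambda>r. num (r ! 1)) rs'))))))
      else Ret [Num p, Num (q - p + 1)])"

text \<open>The same traversal as \<open>stitch\<close>, on stored data: a unit is named by a child,
  its number of units and an index. A separator is present if it is a key of this node; other
  separators become known when the unit is built. Count 0 stands for one kept unit.\<close>

fun slots :: "'k word list \<Rightarrow> ('k word \<times> 'k word) list \<Rightarrow> ('k word \<times> 'k word \<times> nat \<times> 'k word option) list" where
  "slots (k # ks) ((w, c) # cs) =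
     map (\<lambda>i. (w, c, i, if i + 1 = max 1 (num c) then Some k else None)) [0..<max 1 (num c)] @ slots ks cs"
| "slots [] ((w, c) # cs) = map (\<lambda>i. (w, c, i, None)) [0..<max 1 (num c)]"
| "slots _ [] = []"

definition build_task :: "'k word \<Rightarrow> 'k word \<Rightarrow> 'k word \<Rightarrow> nat \<Rightarrow> 'k word list" where
  "build_task a w c i = [Num 8, a, w, c, Num i, Num 0]"

definition build_code :: "nat \<Rightarrow> 'k word \<Rightarrow> 'k word \<Rightarrow> nat \<Rightarrow> nat \<Rightarrow> 'k code" where
  "build_code B a w c i =
     (if c = 0 then Ret [w, Num 0]
      else if is_ref w then get_node (region w) (\<lambda>ks cs.
        let ss = slots ks cs; sub = slice (cut B (length ss) i) (cut B (length ss) (Suc i)) ss in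
        par (map (\<lambda>(w, c, i, _). build_task a w c i) sub) (\<lambda>rs.
          let us = map2 (\<lambda>(_, _, _, s) (p, s'). (p, case s of None \<Rightarrow> s' | Some k \<Rightarrow> k)) sub rs in
          Al (\<lambda>r. St r 0 (map snd (butlast us)) (St r 1 (map fst (butlast us)) (St r 2 [fst (last us)]
            (Ret [Ref r, snd (last us)]))))))
      else if i + 1 < c then Ld (region a) (num w + i) (\<lambda>x. Ret [Num 0, hd x])
      else Ret [Num 0, Num 0])"

definition lift_args :: "'k word \<Rightarrow> 'k word \<Rightarrow> nat \<Rightarrow> 'k word list" where
  "lift_args a w c = [Num 7, a, w, Num c]"

text \<open>With several units left, a keyless node above the current one is planned and the
  procedure repeated. Nothing is built until a single unit remains.\<close>

definition lift_code :: "nat \<Rightarrow> 'k word \<Rightarrow> 'k word \<Rightarrow> nat \<Rightarrow> 'k code" where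
  "lift_code B a w c =
     (if c \<le> 1 then Fk [build_task a w (Num c) 0] (\<lambda>rs. Ret [rs ! 0 ! 0])
      else put_node [] [(w, Num c)] (\<lambda>r. Fk [lift_args a (Ref r) (groups B c)] (\<lambda>rs. Ret [rs ! 0 ! 0])))"

definition union_code :: "'k word \<Rightarrow> 'k word \<Rightarrow> 'k code" where
  "union_code p1 p2 =
     (if is_ref p1 then
        Fk [annotate_task p1] (\<lambda>rs. Al (\<lambda>a.
        Fk [flatten_task (Ref a) (rs ! 0 ! 0) (num (rs ! 0 ! 1)) 0 (Num 0)] (\<lambda>_.
        Fk [plan_task (Ref a) p2 0 (num (rs ! 0 ! 1))] (\<lambda>rs'.
        Fk [lift_args (Ref a) (rs' ! 0 ! 0) (num (rs' ! 0 ! 1))] (\<lambda>rs''. Ret [rs'' ! 0 ! 0])))))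
      else Ret [p2])"

definition union_body :: "nat \<Rightarrow> 'k::linorder word list \<Rightarrow> 'k code" where
  "union_body B ws = (let t = num (ws ! 0) in
     if t = 0 then union_code (ws ! 1) (ws ! 2)
     else if t = 1 then Fk (chop (tl ws)) (\<lambda>rs. Ret (concat rs))
     else if t = 2 then annotate_code (ws ! 1)
     else if t = 3 then flatten_code (ws ! 1) (ws ! 2) (num (ws ! 3)) (num (ws ! 4)) (ws ! 5)
     else if t = 4 then count_code (ws ! 1) (num (ws ! 2)) (num (ws ! 3)) (num (ws ! 4))
       (take (num (ws ! 5)) (drop 6 ws)) (drop (num (ws ! 5)) (drop 6 ws))
     else if t = 5 then rank_code (ws ! 1) (num (ws ! 2)) (num (ws ! 3)) (num (ws ! 4)) (num (ws ! 5))
       (num (ws ! 6)) (ws ! 7)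
     else if t = 6 then plan_code B (ws ! 1) (ws ! 2) (num (ws ! 3)) (num (ws ! 4))
     else if t = 7 then lift_code B (ws ! 1) (ws ! 2) (num (ws ! 3))
     else build_code B (ws ! 1) (ws ! 2) (num (ws ! 3)) (num (ws ! 4)))"

lemma union_body_simps:
  "union_body B [Num 0, p1, p2] = union_code p1 p2"
  "union_body B (Num 1 # xs) = Fk (chop xs) (\<lambda>rs. Ret (concat rs))"
  "union_body B (annotate_task w) = annotate_code w"
  "union_body B (flatten_task a w sz off kw) = flatten_code a w sz off kw"
  "union_body B (count_args a p s n ys zs) = count_code a p s n ys zs"
  "union_body B (rank_args a p k s c c' y) = rank_code a p k s c c' y"
  "union_body B (plan_task a w p q) = plan_code B a w p q"
  "union_body B (lift_args a w c) = lift_code B a w c"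
  "union_body B (build_task a w (Num c) i) = build_code B a w c i"
  by (simp_all add: union_body_def annotate_task_def flatten_task_def count_args_def rank_args_def
      plan_task_def lift_args_def build_task_def Let_def)

section \<open>Rules for node access and parallel tasks\<close>

definition node_at :: "'k memory \<Rightarrow> nat \<Rightarrow> 'k word list \<Rightarrow> ('k word \<times> 'k word) list \<Rightarrow> bool" where
  "node_at \<mu> r ks cs \<longleftrightarrow> cs \<noteq> [] \<and> \<mu> (r, 0) = Some ks \<and>
     \<mu> (r, 1) = Some (map fst (butlast cs)) \<and> \<mu> (r, 2) = Some [fst (last cs)] \<and>
     \<mu> (r, 3) = Some (map snd (butlast cs)) \<and> \<mu> (r, 4) = Some [snd (last cs)]"

lemma map_leD: "\<mu> \<subseteq>\<^sub>m \<mu>' \<Longrightarrow> \<mu> x = Some y \<Longrightarrow> \<mu>' x = Some y"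
  by (metis domI map_le_def)

lemma node_at_mono: "node_at \<mu> r ks cs \<Longrightarrow> \<mu> \<subseteq>\<^sub>m \<mu>' \<Longrightarrow> node_at \<mu>' r ks cs"
  by (auto simp: node_at_def dest: map_leD)

locale union_machine = machine B W "union_body B :: 'a::linorder word list \<Rightarrow> 'a code" for B W +
  assumes B2: "2 \<le> B"
begin

lemma map_le_upd: "x \<notin> dom \<mu> \<Longrightarrow> \<mu> \<subseteq>\<^sub>m \<mu>' \<Longrightarrow> \<mu> \<subseteq>\<^sub>m \<mu>'(x \<mapsto> y)"
  by (auto simp: map_le_def dom_def)

lemma run_put_node:
  assumes "cs \<noteq> []" "length ks \<le> B" "length cs \<le> B + 1" "set ks \<subseteq> K \<union> Num ` {..<W}"
    "fst ` set cs \<subseteq> K \<union> Num ` {..<W}" "snd ` set cs \<subseteq> K \<union> Num ` {..<W}"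
    and L: "l + 8 \<le> L" "B \<le> L" "5 < W"
    and k: "\<And>r \<mu>'. \<mu> \<subseteq>\<^sub>m \<mu>' \<Longrightarrow> node_at \<mu>' r ks cs \<Longrightarrow> run L \<mu>' (insert (Ref r) K) (l + 8) (k r) {} w d Q"
  shows "run L \<mu> K l (put_node ks cs k) {} (5 + w) (5 + d) Q"
proof -
  have bl: "fst ` set (butlast cs) \<subseteq> K \<union> Num ` {..<W}" "snd ` set (butlast cs) \<subseteq> K \<union> Num ` {..<W}"
    "fst (last cs) \<in> K \<union> Num ` {..<W}" "snd (last cs) \<in> K \<union> Num ` {..<W}" "length (butlast cs) \<le> B"
  proof -
    have "set (butlast cs) \<subseteq> set cs" by (meson in_set_butlastD subsetI)
    then show "fst ` set (butlast cs) \<subseteq> K \<union> Num ` {..<W}" "snd ` set (butlast cs) \<subseteq> K \<union> Num ` {..<W}"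
      using assms(5,6) by (meson image_mono order_trans)+
    show "fst (last cs) \<in> K \<union> Num ` {..<W}" "snd (last cs) \<in> K \<union> Num ` {..<W}"
      using assms(5,6) last_in_set[OF assms(1)] by (meson imageI subsetD)+
  qed (use assms(3) in simp)
  have B0: "1 \<le> B" using B2 by simp
  have "run L \<mu> K l (put_node ks cs k) {} (Suc (Suc (Suc (Suc (Suc w))))) (Suc (Suc (Suc (Suc (Suc d))))) Q"
    unfolding put_node_def
  proof (rule run_Al)
    fix r
    show "run L \<mu> (insert (Ref r) K) (l + 3) (St r 0 ks (St r 1 (map fst (butlast cs)) (St r 2 [fst (last cs)]
     (St r 3 (map snd (butlast cs)) (St r 4 [snd (last cs)] (k r))))))
     ({} \<union> {r} \<times> UNIV) (Suc (Suc (Suc (Suc (Suc w))))) (Suc (Suc (Suc (Suc (Suc d))))) Q"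
    \<comment> \<open>The rotation brings the continuation to the front; the freshness of each
      written location is kept, as all of them are needed to see that the final memory extends
      \<open>\<mu>\<close>.\<close>
    proof ((rule run_St[rotated -1]), goal_cases)
      case 1
      note f0 = 1
      show ?case
      proof ((rule run_St[rotated -1]), goal_cases)
        case 1
        note f1 = 1
        show ?case
        proof ((rule run_St[rotated -1]), goal_cases)
          case 1
          note f2 = 1
          show ?case
          proof ((rule run_St[rotated -1]), goal_cases)
            case 1
            note f3 = 1
            show ?case
            proof ((rule run_St[rotated -1]), goal_cases)
              case 1
              let ?m = "\<mu>((r, 0) \<mapsto> ks, (r, 1) \<mapsto> map fst (butlast cs), (r, 2) \<mapsto> [fst (last cs)],
                (r, 3) \<mapsto> map snd (butlast cs), (r, 4) \<mapsto> [snd (last cs)])"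
              have "\<mu> \<subseteq>\<^sub>m ?m"
                using f0 f1 f2 f3 1 by (intro map_le_upd) auto
              moreover have "node_at ?m r ks cs" using assms(1) by (simp add: node_at_def)
              ultimately have "run L ?m (insert (Ref r) K) (l + 8) (k r) {} w d Q" by (rule k)
              then show ?case by (rule run_weaken) simp_all
            qed (use L bl B0 in auto)
          qed (use L bl B0 in auto)
        qed (use L bl B0 in auto)
      qed (use L bl B0 in auto)
    qed (use L assms B0 in auto)
  qed (use L in auto)
  then show ?thesis by (simp add: numeral_eq_Suc)
qed

lemma run_get_node:
  assumes n: "node_at \<mu> r ks cs" "Ref r \<in> K" "length ks \<le> B" "length cs \<le> B + 1"
    and L: "l + 9 * B \<le> L" "L < W" "4 < W"
    and k: "run L \<mu> (K \<union> set ks \<union> fst ` set cs \<union> snd ` set cs) (l + 9 * B) (k ks cs) X w d Q"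
  shows "run L \<mu> K l (get_node r k) X (5 + w) (5 + d) Q"
proof -
  let ?ps = "map fst (butlast cs)" and ?p = "[fst (last cs)]" and ?cs = "map snd (butlast cs)" and ?c = "[snd (last cs)]"
  have cs: "cs \<noteq> []" using n(1) by (simp add: node_at_def)
  then have cs': "butlast cs @ [last cs] = cs" by simp
  have z: "zip (?ps @ ?p) (?cs @ ?c) = cs"
    using cs' by (metis (no_types) map_append list.map(1) list.map(2) zip_map_fst_snd)
  have len: "length ?ps \<le> B" "length ?cs \<le> B" using n(4) by auto
  have "run L \<mu> K l (get_node r k) X (Suc (Suc (Suc (Suc (Suc w))))) (Suc (Suc (Suc (Suc (Suc d))))) Q"
    unfolding get_node_def
  proof (rule run_Ld[where blk = ks], goal_cases)
    case 6
    show ?case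
    proof (rule run_Ld[where blk = ?ps], goal_cases)
      case 6
      show ?case
      proof (rule run_Ld[where blk = ?p], goal_cases)
        case 6
        show ?case
        proof (rule run_Ld[where blk = ?cs], goal_cases)
          case 6
          show ?case
          proof (rule run_Ld[where blk = ?c], goal_cases)
            case 6
            have "K \<union> set ks \<union> fst ` set cs \<union> snd ` set cs \<subseteq>
              K \<union> set ks \<union> set ?ps \<union> set ?p \<union> set ?cs \<union> set ?c"
              by (subst (1 2) cs'[symmetric]) auto
            then show ?case unfolding z
              by (intro run_weaken[OF k]) (use n(3) len B2 in auto)
          qed (use n L len B2 in \<open>auto simp: node_at_def\<close>)
        qed (use n L len B2 in \<open>auto simp: node_at_def\<close>)
      qed (use n L len B2 in \<open>auto simp: node_at_def\<close>)
    qed (use n L len B2 in \<open>auto simp: node_at_def\<close>)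
  qed (use n L len B2 in \<open>auto simp: node_at_def\<close>)
  then show ?thesis by (simp add: numeral_eq_Suc)
qed

text \<open>Correctness of the intermediate threads of \<open>par\<close>. Tasks have six words and
  results two, so that concatenations can be taken apart without delimiters.\<close>

lemma call_group:
  assumes n: "length ts = n" "n \<le> B" and ts: "\<And>t. t \<in> set ts \<Longrightarrow> length t = 6"
    and child: "\<And>i. i < n \<Longrightarrow> call L' \<mu> (ts ! i) (Y i) (ws i) d (P i)"
    and len: "\<And>i res \<mu>'. i < n \<Longrightarrow> P i res \<mu>' \<Longrightarrow> length res = 2"
    and L: "L' + 20 * B \<le> L" "L < W"
    and Y: "\<And>i j. i < n \<Longrightarrow> j < n \<Longrightarrow> i \<noteq> j \<Longrightarrow> Y i \<inter> Y j = {}"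
  shows "call L \<mu> (Num 1 # concat ts) (\<Union>i<n. Y i) (\<Sum>i<n. ws i) d
    (\<lambda>res \<mu>'. \<exists>rs. length rs = n \<and> res = concat rs \<and> (\<forall>i<n. P i (rs ! i) \<mu>'))"
proof (rule callI)
  have body: "union_body B (Num 1 # concat ts) = Fk ts (\<lambda>rs. Ret (concat rs))"
    unfolding union_body_simps by (subst chop_concat) (use ts in auto)
  have lc: "length (concat ts) = 6 * n"
  proof -
    have "length (concat ts) = (\<Sum>t\<leftarrow>ts. 6)" unfolding length_concat
      by (rule arg_cong[of _ _ sum_list]) (use ts in auto)
    then show ?thesis using n by (simp add: sum_list_triv)
  qed
  let ?l = "length (Num 1 # concat ts) + 2"
  have "run L \<mu> (set (Num 1 # concat ts)) ?l (Fk ts (\<lambda>rs. Ret (concat rs))) (\<Union>i<n. Y i) ((\<Sum>i<n. ws i) + 0) (d + 0)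
    (\<lambda>res \<mu>'. \<exists>rs. length rs = n \<and> res = concat rs \<and> (\<forall>i<n. P i (rs ! i) \<mu>'))"
  proof (rule run_Fk[OF n])
    fix a assume "a \<in> set ts"
    then show "set a \<subseteq> set (Num 1 # concat ts) \<union> Num ` {..<W} \<and> length a < W"
      using ts L B2 by auto
  next
    have "(\<Sum>a\<leftarrow>ts. length a + 2) = (\<Sum>a\<leftarrow>ts. 8)"
      by (rule arg_cong[of _ _ sum_list]) (use ts in auto)
    also have "\<dots> = 8 * n" using n by (simp add: sum_list_triv)
    finally show "(\<Sum>a\<leftarrow>ts. length a + 2) \<le> L" using n L by simp
  next
    fix i assume i: "i < n"
    show "call (L - ?l) \<mu> (ts ! i) (Y i) (ws i) d (P i)"
      by (rule call_mono[OF child[OF i]]) (use L n B2 lc in auto)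
    show "length res \<le> 2" if "P i res \<mu>'" for res \<mu>' using len[OF i that] by simp
    show "Y i \<inter> Y j = {}" if "j < n" "i \<noteq> j" for j using Y i that by simp
  next
    fix rs \<mu>' assume rs: "length rs = n" "\<And>i \<mu>''. i < n \<Longrightarrow> \<mu>' \<subseteq>\<^sub>m \<mu>'' \<Longrightarrow> P i (rs ! i) \<mu>''"
    have "\<forall>r\<in>set rs. length r = 2" using rs len by (metis in_set_conv_nth map_le_refl)
    then have "sum_list (map length rs) = (\<Sum>r\<leftarrow>rs. 2)" by (intro arg_cong[of _ _ sum_list]) simp
    then have "length (concat rs) = 2 * n" using rs(1) by (simp add: length_concat sum_list_triv)
    then show "run L \<mu>' (set (Num 1 # concat ts) \<union> (\<Union>r\<in>set rs. set r)) (?l + 1 + n * (2 + 1))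
        (Ret (concat rs)) ((\<Union>i<n. Y i) - (\<Union>i<n. Y i)) 0 0
        (\<lambda>res \<mu>'. \<exists>rs. length rs = n \<and> res = concat rs \<and> (\<forall>i<n. P i (rs ! i) \<mu>'))"
      using rs L n lc B2 by (intro run_Ret) auto
  qed (use L n lc B2 in auto)
  then show "run L \<mu> (set (Num 1 # concat ts)) ?l (union_body B (Num 1 # concat ts)) (\<Union>i<n. Y i) (\<Sum>i<n. ws i) d
    (\<lambda>res \<mu>'. \<exists>rs. length rs = n \<and> res = concat rs \<and> (\<forall>i<n. P i (rs ! i) \<mu>'))"
    unfolding body by simp
qed

end

lemma concat_length2: "\<forall>r\<in>set rs. length r = 2 \<Longrightarrow> length (concat rs) = 2 * length rs"
proof -
  assume "\<forall>r\<in>set rs. length r = 2"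
  then have "sum_list (map length rs) = (\<Sum>r\<leftarrow>rs. 2)" by (intro arg_cong[of _ _ sum_list]) simp
  then show ?thesis by (simp add: length_concat sum_list_triv)
qed

lemma concat_length6: "\<forall>r\<in>set rs. length r = 6 \<Longrightarrow> length (concat rs) = 6 * length rs"
proof -
  assume "\<forall>r\<in>set rs. length r = 6"
  then have "sum_list (map length rs) = (\<Sum>r\<leftarrow>rs. 6)" by (intro arg_cong[of _ _ sum_list]) simp
  then show ?thesis by (simp add: length_concat sum_list_triv)
qed

context union_machine begin

text \<open>A fork with one child acts as a procedure call: only the result of the callee is
  recorded by the caller, so the callee's history does not stay in local memory.\<close>

lemma run_call:
  assumes a: "set a \<subseteq> K \<union> Num ` {..<W}" "length a < W" "length a + 2 \<le> L"
    and child: "call (L - l) \<mu> a Y w1 d1 P" and len: "\<And>res \<mu>'. P res \<mu>' \<Longrightarrow> length res \<le> b"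
    and L: "l + b + 2 \<le> L" "L < W" "B < W" and Y: "Y \<subseteq> X"
    and k: "\<And>res \<mu>'. \<mu> \<subseteq>\<^sub>m \<mu>' \<Longrightarrow> (\<And>\<mu>''. \<mu>' \<subseteq>\<^sub>m \<mu>'' \<Longrightarrow> P res \<mu>'') \<Longrightarrow>
      run L \<mu>' (K \<union> set res) (l + b + 2) (k [res]) (X - Y) w d Q"
  shows "run L \<mu> K l (Fk [a] k) X (w1 + w) (d1 + d) Q"
proof -
  have "run L \<mu> K l (Fk [a] k) X ((\<Sum>i<(1::nat). w1) + w) (d1 + d) Q"
  proof (rule run_Fk[where Y = "\<lambda>_. Y" and P = "\<lambda>_. P" and b = b])
    fix rs \<mu>' assume rs: "length rs = 1" "\<mu> \<subseteq>\<^sub>m \<mu>'" "\<And>i \<mu>''. i < 1 \<Longrightarrow> \<mu>' \<subseteq>\<^sub>m \<mu>'' \<Longrightarrow> P (rs ! i) \<mu>''"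
    then obtain r where r: "rs = [r]" by (auto simp: length_Suc_conv)
    have "run L \<mu>' (K \<union> set r) (l + b + 2) (k [r]) (X - Y) w d Q"
      by (rule k[OF rs(2)]) (use rs(3)[of 0] r in simp)
    then show "run L \<mu>' (K \<union> (\<Union>r\<in>set rs. set r)) (l + 1 + 1 * (b + 1)) (k rs) (X - (\<Union>i<(1::nat). Y)) w d Q"
      by (simp add: r lessThan_Suc)
  qed (use assms B2 in auto)
  then show ?thesis by simp
qed

text \<open>Tasks for up to \<open>B + 1\<close> children exceed the width of a fork. They are dealt
  to two threads, each of which forks its half, at the price of one more stack frame and no
  I/O.\<close>

lemma run_par:
  assumes n: "length ts = n" "n \<le> 2 * B"
    and ts: "\<And>t. t \<in> set ts \<Longrightarrow> length t = 6 \<and> set t \<subseteq> K \<union> Num ` {..<W}"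
    and child: "\<And>i. i < n \<Longrightarrow> call L' \<mu> (ts ! i) (Y i) (ws i) dc (P i)"
    and len: "\<And>i res \<mu>'. i < n \<Longrightarrow> P i res \<mu>' \<Longrightarrow> length res = 2"
    and L: "l + L' + 20 * B \<le> L" "L < W"
    and Y: "\<And>i. i < n \<Longrightarrow> Y i \<subseteq> X" "\<And>i j. i < n \<Longrightarrow> j < n \<Longrightarrow> i \<noteq> j \<Longrightarrow> Y i \<inter> Y j = {}"
    and k: "\<And>rs \<mu>'. length rs = n \<Longrightarrow> \<mu> \<subseteq>\<^sub>m \<mu>' \<Longrightarrow>
        (\<And>i \<mu>''. i < n \<Longrightarrow> \<mu>' \<subseteq>\<^sub>m \<mu>'' \<Longrightarrow> P i [fst (rs ! i), snd (rs ! i)] \<mu>'') \<Longrightarrow>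
        run L \<mu>' (K \<union> fst ` set rs \<union> snd ` set rs) (l + 4 * B + 3) (k rs) (X - (\<Union>i<n. Y i)) w d Q"
  shows "run L \<mu> K l (par ts k) X ((\<Sum>i<n. ws i) + w) (dc + d) Q"
proof -
  define h where "h = n div 2"
  have h: "h \<le> B" "n - h \<le> B" "h \<le> n" using n(2) by (auto simp: h_def)
  let ?args = "[Num 1 # concat (take h ts), Num 1 # concat (drop h ts)]"
  let ?Y = "\<lambda>i::nat. if i = 0 then (\<Union>i<h. Y i) else (\<Union>i<n - h. Y (h + i))"
  let ?P = "\<lambda>(i::nat) res \<mu>'. if i = 0 then (\<exists>rs. length rs = h \<and> res = concat rs \<and> (\<forall>i<h. P i (rs ! i) \<mu>'))
    else (\<exists>rs. length rs = n - h \<and> res = concat rs \<and> (\<forall>i<n - h. P (h + i) (rs ! i) \<mu>'))"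
  let ?ws = "\<lambda>i::nat. if i = 0 then (\<Sum>i<h. ws i) else (\<Sum>i<n - h. ws (h + i))"
  have tsub: "set (take h ts) \<subseteq> set ts" "set (drop h ts) \<subseteq> set ts" by (rule set_take_subset, rule set_drop_subset)
  have lc: "length (concat (take h ts)) = 6 * h" "length (concat (drop h ts)) = 6 * (n - h)"
    using concat_length6[of "take h ts"] concat_length6[of "drop h ts"] ts tsub n(1) h by auto
  have g0: "call (L - l) \<mu> (Num 1 # concat (take h ts)) (\<Union>i<h. Y i) (\<Sum>i<h. ws i) dc
      (\<lambda>res \<mu>'. \<exists>rs. length rs = h \<and> res = concat rs \<and> (\<forall>i<h. P i (rs ! i) \<mu>'))"
  proof (rule call_group[where L' = L'])
    show "length res = 2" if "i < h" "P i res \<mu>'" for i res \<mu>'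
      using len[OF less_le_trans[OF that(1) h(3)] that(2)] .
  qed (use n h ts tsub child L Y in auto)
  have g1: "call (L - l) \<mu> (Num 1 # concat (drop h ts)) (\<Union>i<n - h. Y (h + i)) (\<Sum>i<n - h. ws (h + i)) dc
      (\<lambda>res \<mu>'. \<exists>rs. length rs = n - h \<and> res = concat rs \<and> (\<forall>i<n - h. P (h + i) (rs ! i) \<mu>'))"
  proof (rule call_group[where L' = L'])
    show "length res = 2" if "i < n - h" "P (h + i) res \<mu>'" for i res \<mu>'
      using len[of "h + i"] that by auto
  qed (use n h ts tsub child L Y in auto)
  have conc2: "length (concat rs) = 2 * N" if "length rs = N" "\<forall>i<N. P (j + i) (rs ! i) \<mu>'" "j + N \<le> n" for rs N j \<mu>'
    using concat_length2[of rs] that len by (metis add_less_cancel_left in_set_conv_nth less_le_trans)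
  have split: "(\<Sum>i<n. ws i) = (\<Sum>i<h. ws i) + (\<Sum>i<n - h. ws (h + i))"
  proof -
    have "(\<Sum>i<h + m. ws i) = (\<Sum>i<h. ws i) + (\<Sum>i<m. ws (h + i))" for m by (induction m) simp_all
    from this[of "n - h"] show ?thesis using h by simp
  qed
  have Ysplit: "(\<Union>i<(2::nat). ?Y i) = (\<Union>i<n. Y i)"
  proof -
    have "(\<Union>i<n. Y i) = (\<Union>i<h. Y i) \<union> (\<Union>i<n - h. Y (h + i))"
    proof (intro equalityI subsetI)
      fix x assume "x \<in> (\<Union>i<n. Y i)"
      then obtain i where i: "i < n" "x \<in> Y i" by auto
      show "x \<in> (\<Union>i<h. Y i) \<union> (\<Union>i<n - h. Y (h + i))"
      proof (cases "i < h")
        case False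
        then have "i - h < n - h" "x \<in> Y (h + (i - h))" using i by simp_all
        then show ?thesis by blast
      qed (use i in blast)
    qed (use h in auto)
    then show ?thesis by (simp add: numeral_2_eq_2 lessThan_Suc Un_commute)
  qed
  have "run L \<mu> K l (par ts k) X ((\<Sum>i<(2::nat). ?ws i) + w) (dc + d) Q"
    unfolding par_def n(1) h_def[symmetric]
  proof (rule run_Fk[where Y = ?Y and P = ?P and b = "2 * B"])
    show "length ?args = 2" "2 \<le> B" using B2 by simp_all
    show "set a \<subseteq> K \<union> Num ` {..<W} \<and> length a < W" if "a \<in> set ?args" for a
      using that ts tsub lc L h B2 by fastforce
    show "(\<Sum>a\<leftarrow>?args. length a + 2) \<le> L" using lc L h B2 by simp
    show "call (L - l) \<mu> (?args ! i) (?Y i) (?ws i) dc (?P i)" if "i < 2" for i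
      using that g0 g1 by (auto simp: numeral_2_eq_2 less_Suc_eq)
    show "length res \<le> 2 * B" if "i < 2" and Pi: "?P i res \<mu>'" for i :: nat and res \<mu>'
    proof (cases "i = 0")
      case True
      then obtain rs where "length rs = h" "res = concat rs" "\<forall>i<h. P i (rs ! i) \<mu>'" using Pi by (simp split: if_splits) blast
      then show ?thesis using conc2[of rs h 0 \<mu>'] h by simp
    next
      case False
      then obtain rs where "length rs = n - h" "res = concat rs" "\<forall>i<n - h. P (h + i) (rs ! i) \<mu>'" using Pi by (simp split: if_splits) blast
      then show ?thesis using conc2[of rs "n - h" h \<mu>'] h by simp
    qed
    have "(\<Union>i<h. Y i) \<subseteq> X" "(\<Union>i<n - h. Y (h + i)) \<subseteq> X"
      by (rule UN_least, rule Y(1), use h in simp)+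
    then show "?Y i \<subseteq> X" if "i < 2" for i :: nat by simp
    show "?Y i \<inter> ?Y j = {}" if "i < 2" "j < 2" "i \<noteq> j" for i j :: nat
    proof -
      have "Y i \<inter> Y (h + j) = {}" if "i < h" "j < n - h" for i j using Y(2)[of i "h + j"] that by simp
      then have "(\<Union>i<h. Y i) \<inter> (\<Union>i<n - h. Y (h + i)) = {}" by blast
      then show ?thesis using that by (auto simp: numeral_2_eq_2 less_Suc_eq)
    qed
  next
    fix rs \<mu>' assume rs: "length rs = 2" "\<mu> \<subseteq>\<^sub>m \<mu>'" "\<And>i \<mu>''. i < 2 \<Longrightarrow> \<mu>' \<subseteq>\<^sub>m \<mu>'' \<Longrightarrow> ?P i (rs ! i) \<mu>''"
    then obtain r0 r1 where r: "rs = [r0, r1]" by (auto simp: numeral_2_eq_2 length_Suc_conv)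
    from rs(3)[of 0 \<mu>'] r obtain q0 where q0: "length q0 = h" "r0 = concat q0" "\<forall>i<h. P i (q0 ! i) \<mu>'" by auto
    from rs(3)[of 1 \<mu>'] r obtain q1 where q1: "length q1 = n - h" "r1 = concat q1" "\<forall>i<n - h. P (h + i) (q1 ! i) \<mu>'" by auto
    have l0: "\<forall>x\<in>set q0. length x = 2" using q0 len h by (metis in_set_conv_nth less_le_trans)
    have l1: "\<forall>x\<in>set q1. length x = 2"
      using q1 len h by (metis in_set_conv_nth less_diff_conv add.commute)
    define ps where "ps = pairs (concat rs)"
    have ps: "ps = map (\<lambda>r. (r ! 0, r ! 1)) (q0 @ q1)"
      unfolding ps_def r q0(2) q1(2) using pairs_concat[of "q0 @ q1"] l0 l1 by auto
    have lps: "length ps = n" using ps q0 q1 h by simp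
    have "P i [fst (ps ! i), snd (ps ! i)] \<mu>''" if "i < n" "\<mu>' \<subseteq>\<^sub>m \<mu>''" for i \<mu>''
    proof -
      have eq: "q = [q ! 0, q ! 1]" if "length q = 2" for q :: "'b list"
        using that by (auto simp: numeral_2_eq_2 length_Suc_conv)
      \<comment> \<open>The postcondition of a group yields a new list of results for every later
        memory. All results have two words, so the flat list splits in one way only and these lists
        agree.\<close>
      have cinj: "xs = ys" if "concat xs = concat ys" "length xs = length ys" "\<forall>x\<in>set xs. length x = 2"
        "\<forall>x\<in>set ys. length x = 2" for xs ys :: "'b list list"
      proof (rule concat_injective[OF that(1,2)], clarify)
        fix a b assume "(a, b) \<in> set (zip xs ys)"
        from set_zip_leftD[OF this] set_zip_rightD[OF this] show "length a = length b" using that by simp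
      qed
      show ?thesis
      proof (cases "i < h")
        case True
        from rs(3)[of 0 \<mu>''] r that obtain q where q: "length q = h" "r0 = concat q" "\<forall>i<h. P i (q ! i) \<mu>''" by auto
        have "\<forall>x\<in>set q. length x = 2" using q len h by (metis in_set_conv_nth less_le_trans)
        then have "q = q0" using q q0 l0 by (intro cinj) auto
        then have "ps ! i = (q ! i ! 0, q ! i ! 1)" "length (q ! i) = 2" using ps True q0(1) l0 by (auto simp: nth_append)
        then show ?thesis using eq q(3) True by (metis fst_conv snd_conv)
      next
        case False
        from rs(3)[of 1 \<mu>''] r that obtain q where q: "length q = n - h" "r1 = concat q" "\<forall>i<n - h. P (h + i) (q ! i) \<mu>''" by auto
        have "\<forall>x\<in>set q. length x = 2" using q len h by (metis in_set_conv_nth less_diff_conv add.commute)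
        then have qq: "q = q1" using q q1 l1 by (intro cinj) auto
        have i: "i - h < n - h" "h + (i - h) = i" using False that by auto
        then have "ps ! i = (q ! (i - h) ! 0, q ! (i - h) ! 1)" "length (q ! (i - h)) = 2"
          using ps False q0(1) q1(1) l1 qq by (auto simp: nth_append)
        then show ?thesis using eq q(3) i by (metis fst_conv snd_conv)
      qed
    qed
    then have "run L \<mu>' (K \<union> fst ` set ps \<union> snd ` set ps) (l + 4 * B + 3) (k ps) (X - (\<Union>i<n. Y i)) w d Q"
      by (rule k[OF lps rs(2)])
    moreover have "fst ` set ps \<union> snd ` set ps \<subseteq> (\<Union>r\<in>set rs. set r)"
    proof -
      have "x ! 0 \<in> set x \<and> x ! 1 \<in> set x" if "x \<in> set (q0 @ q1)" for x
        using that l0 l1 by (auto intro!: nth_mem)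
      then show ?thesis unfolding ps r q0(2) q1(2) by fastforce
    qed
    ultimately show "run L \<mu>' (K \<union> (\<Union>r\<in>set rs. set r)) (l + 1 + 2 * (2 * B + 1)) (k (pairs (concat rs)))
        (X - (\<Union>i<(2::nat). ?Y i)) w d Q"
      unfolding ps_def[symmetric] Ysplit by (elim run_weaken) auto
  qed (use L B2 in auto)
  then show ?thesis unfolding split by (simp add: numeral_2_eq_2)
qed

end

lemma stored_mono: "stored \<mu> w t \<Longrightarrow> \<mu> \<subseteq>\<^sub>m \<mu>' \<Longrightarrow> stored \<mu>' w t"
proof (induction rule: stored.induct)
  case (node r ks ps p ts)
  then show ?case
    by (intro stored.node) (auto dest: map_leD elim!: list_all2_mono)
qed (rule stored.ext)

inductive sized :: "'k memory \<Rightarrow> 'k word \<Rightarrow> 'k btree \<Rightarrow> bool" for \<mu> where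
  ext: "sized \<mu> (Num 0) Ext"
| node: "node_at \<mu> r (map Key ks) (zip ws (map (\<lambda>t. Num (num_keys t)) ts)) \<Longrightarrow>
    list_all2 (sized \<mu>) ws ts \<Longrightarrow> sized \<mu> (Ref r) (Node ks ts)"

lemma sized_mono: "sized \<mu> w t \<Longrightarrow> \<mu> \<subseteq>\<^sub>m \<mu>' \<Longrightarrow> sized \<mu>' w t"
proof (induction rule: sized.induct)
  case (node r ks ws ts)
  then show ?case
    by (intro sized.node[of _ _ _ ws]) (auto intro: node_at_mono elim!: list_all2_mono)
qed (rule sized.ext)

section \<open>Flattening the smaller tree\<close>

lemma length_mix: "length ts = length ks + 1 \<Longrightarrow> length (mix ks ts) = length ks + sum_list (map length ts)"
proof (induction ks ts rule: mix.induct)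
  case (2 t ts)
  then show ?case by (cases ts) auto
qed auto

lemma length_inorder: "balanced B lo h t \<Longrightarrow> length (inorder t) = num_keys t"
proof (induction B lo h t rule: balanced.induct)
  case (2 B lo h ks ts)
  then have "map length (map inorder ts) = map num_keys ts" by auto
  then show ?case using 2(2) by (simp add: length_mix del: map_map)
qed simp

lemma num_keys_pos: "balanced B lo h t \<Longrightarrow> 1 \<le> lo \<Longrightarrow> num_keys t = 0 \<longleftrightarrow> t = Ext"
  by (cases t) auto

context union_machine begin

text \<open>In the specifications of procedures, \<open>60 * B\<close> words cover one frame of the stack.\<close>

lemma call_annotate:
  assumes "stored \<mu> w t" "balanced B lo h t" "1 \<le> lo" "60 * B * (h + 1) < W" "num_keys t < W"
  shows "call (60 * B * (h + 1)) \<mu> (annotate_task w) {} (8 * num_keys t) (8 * h)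
    (\<lambda>res \<mu>'. \<exists>w'. res = [w', Num (num_keys t)] \<and> sized \<mu>' w' t)"
  using assms
proof (induction t arbitrary: w lo h rule: btree.induct)
  case Ext
  then have w: "w = Num 0" by (auto elim: stored.cases)
  have "0 < W" "2 \<le> B" using Ext B2 by auto
  then show ?case
    by (intro callI, unfold union_body_simps annotate_code_def w)
      (auto simp: annotate_task_def intro!: run_Ret sized.ext)
next
  case (Node ks ts)
  from Node.prems(1) obtain r ps p where w: "w = Ref r" and m: "\<mu> (r, 0) = Some (map Key ks)"
    "\<mu> (r, 1) = Some ps" "\<mu> (r, 2) = Some [p]" and st: "list_all2 (stored \<mu>) (ps @ [p]) ts"
    by (auto elim: stored.cases)
  from Node.prems(2,3) have b: "0 < h" "1 \<le> length ks" "length ks \<le> B" "length ts = length ks + 1"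
    "\<And>t. t \<in> set ts \<Longrightarrow> balanced B (B div 2) (h - 1) t" by auto
  define L where "L = 60 * B * (h + 1)"
  define g where "g = h - 1"
  have h: "h = g + 1" using b(1) by (simp add: g_def)
  have LL: "L = 60 * B * (g + 1) + 60 * B" by (simp add: L_def h)
  have LW: "L < W" using Node.prems(4) by (simp add: L_def)
  have nW: "num_keys t < W" if "t \<in> set ts" for t
    using Node.prems(5) member_le_sum_list[of "num_keys t" "map num_keys ts"] that by simp
  have lps: "length (ps @ [p]) = length ts" using st by (rule list_all2_lengthD)
  have lp: "length ps = length ks" using lps b(4) by simp
  define Q where "Q = (\<lambda>res \<mu>'. \<exists>w'. res = [w', Num (num_keys (Node ks ts))] \<and> sized \<mu>' w' (Node ks ts))"
  let ?K = "set (annotate_task w)" and ?n = "length ts"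
  let ?c = "\<lambda>rs. put_node (map Key ks) rs (\<lambda>r. Ret [Ref r, Num (length (map Key ks) + (\<Sum>x\<leftarrow>rs. num (snd x)))])"
  let ?P = "\<lambda>i res \<mu>'. \<exists>w'. res = [w', Num (num_keys (ts ! i))] \<and> sized \<mu>' w' (ts ! i)"
  have par: "run L \<mu> (?K \<union> set (map Key ks) \<union> set ps \<union> set [p])
      (8 + length (map Key ks) + 2 + length ps + 2 + length [p] + 2)
      (par (map annotate_task (ps @ [p])) ?c) {}
      ((\<Sum>i<?n. 8 * num_keys (ts ! i)) + (5 + 0)) (8 * g + (5 + 0)) Q"
  proof (rule run_par[where L' = "60 * B * (g + 1)" and Y = "\<lambda>_. {}" and P = ?P])
    fix t assume "t \<in> set (map annotate_task (ps @ [p]))"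
    then show "length t = 6 \<and> set t \<subseteq> ?K \<union> set (map Key ks) \<union> set ps \<union> set [p] \<union> Num ` {..<W}"
      using LW LL B2 by (auto simp: annotate_task_def)
  next
    fix i assume i: "i < ?n"
    have "stored \<mu> ((ps @ [p]) ! i) (ts ! i)" using list_all2_nthD2[OF st i] .
    then have "call (60 * B * (g + 1)) \<mu> (annotate_task ((ps @ [p]) ! i)) {} (8 * num_keys (ts ! i)) (8 * g) (?P i)"
      using Node.IH[of "ts ! i" "(ps @ [p]) ! i" "B div 2" g] b(5)[of "ts ! i"] nW[of "ts ! i"] i LW LL B2
      by (simp add: g_def)
    moreover have "map annotate_task (ps @ [p]) ! i = annotate_task ((ps @ [p]) ! i)"
      by (rule nth_map) (use i lps in simp)
    ultimately show "call (60 * B * (g + 1)) \<mu> (map annotate_task (ps @ [p]) ! i) {} (8 * num_keys (ts ! i)) (8 * g) (?P i)"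
      by simp
  next
    fix rs \<mu>' assume rs: "length rs = ?n" "\<mu> \<subseteq>\<^sub>m \<mu>'"
      "\<And>i \<mu>''. i < ?n \<Longrightarrow> \<mu>' \<subseteq>\<^sub>m \<mu>'' \<Longrightarrow> ?P i [fst (rs ! i), snd (rs ! i)] \<mu>''"
    have snd: "map snd rs = map (\<lambda>t. Num (num_keys t)) ts"
      using rs(1) rs(3)[OF _ map_le_refl] by (auto intro!: nth_equalityI)
    have "rs = zip (map fst rs) (map snd rs)" by (simp add: zip_map_fst_snd)
    then have z: "rs = zip (map fst rs) (map (\<lambda>t. Num (num_keys t)) ts)" unfolding snd .
    have sz: "list_all2 (sized \<mu>'') (map fst rs) ts" if "\<mu>' \<subseteq>\<^sub>m \<mu>''" for \<mu>''
      using rs(1) rs(3)[OF _ that] by (auto simp: list_all2_conv_all_nth)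
    have sum: "(\<Sum>x\<leftarrow>rs. num (snd x)) = sum_list (map num_keys ts)"
    proof -
      have "map (\<lambda>x. num (snd x)) rs = map num (map snd rs)" by simp
      also have "\<dots> = map num_keys ts" unfolding snd by simp
      finally show ?thesis by simp
    qed
    have sndW: "snd ` set rs \<subseteq> Num ` {..<W}"
    proof -
      have "snd ` set rs = set (map snd rs)" by simp
      then show ?thesis unfolding snd using nW by auto
    qed
    show "run L \<mu>' (?K \<union> set (map Key ks) \<union> set ps \<union> set [p] \<union> fst ` set rs \<union> snd ` set rs)
        (8 + length (map Key ks) + 2 + length ps + 2 + length [p] + 2 + 4 * B + 3) (?c rs)
        ({} - (\<Union>i<?n. {})) (5 + 0) (5 + 0) Q"
      unfolding empty_Diff
    proof (rule run_put_node)
      fix r' \<mu>'' assume m'': "\<mu>' \<subseteq>\<^sub>m \<mu>''" "node_at \<mu>'' r' (map Key ks) rs"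
      show "run L \<mu>'' (insert (Ref r') (?K \<union> set (map Key ks) \<union> set ps \<union> set [p] \<union> fst ` set rs \<union> snd ` set rs))
        (8 + length (map Key ks) + 2 + length ps + 2 + length [p] + 2 + 4 * B + 3 + 8)
        (Ret [Ref r', Num (length (map Key ks) + (\<Sum>x\<leftarrow>rs. num (snd x)))]) {} 0 0 Q"
      proof (rule run_Ret)
        show "Q [Ref r', Num (length (map Key ks) + (\<Sum>x\<leftarrow>rs. num (snd x)))] \<mu>'''" if "\<mu>'' \<subseteq>\<^sub>m \<mu>'''" for \<mu>'''
          unfolding Q_def sum
          using node_at_mono[OF m''(2) that] z sz[OF map_le_trans[OF m''(1) that]] by (auto intro!: sized.node)
      qed (use Node.prems(5) sum LL b lp B2 in auto)
    qed (use rs(1) b lp LL LW B2 sndW in auto)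
  qed (use lps lp b LL LW B2 in auto)
  have run: "run L \<mu> ?K 8 (annotate_code w) {} (Suc (Suc (Suc ((\<Sum>i<?n. 8 * num_keys (ts ! i)) + (5 + 0)))))
      (Suc (Suc (Suc (8 * g + (5 + 0))))) Q"
    unfolding annotate_code_def w is_ref.simps region.simps if_True
  proof (rule run_Ld[where blk = "map Key ks"], goal_cases)
    case 6
    show ?case
    proof (rule run_Ld[where blk = ps], goal_cases)
      case 6
      show ?case
        by (rule run_Ld[where blk = "[p]"]) (use par m w b LL LW B2 lp in \<open>auto simp: annotate_task_def\<close>)
    qed (use m w b LL LW B2 lp in \<open>auto simp: annotate_task_def\<close>)
  qed (use m w b LL LW B2 in \<open>auto simp: annotate_task_def\<close>)
  \<comment> \<open>Three loads and five stores at this node are paid for by any one of its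
    keys.\<close>
  have "8 * num_keys (Node ks ts) \<ge> Suc (Suc (Suc ((\<Sum>i<?n. 8 * num_keys (ts ! i)) + (5 + 0))))"
  proof -
    have "(\<Sum>i<?n. 8 * num_keys (ts ! i)) = 8 * sum_list (map num_keys ts)"
      by (simp add: sum_list_sum_nth sum_distrib_left atLeast0LessThan)
    then show ?thesis using b(2) by simp
  qed
  then have run': "run L \<mu> ?K 8 (annotate_code w) {} (8 * num_keys (Node ks ts)) (8 * h) Q"
    by (rule run_mono[OF run]) (simp_all add: h)
  show ?case
    unfolding L_def[symmetric] Q_def[symmetric]
  proof (rule callI)
    have "length (annotate_task w) + 2 = 8" by (simp add: annotate_task_def)
    then show "run L \<mu> (set (annotate_task w)) (length (annotate_task w) + 2) (union_body B (annotate_task w)) {}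
      (8 * num_keys (Node ks ts)) (8 * h) Q"
      unfolding union_body_simps by (simp only: run')
  qed
qed

end

text \<open>The list is cut into a subtree followed by the key after it, which is what one
  flattening task writes.\<close>

lemma mix_concat: "length ts = length ks + 1 \<Longrightarrow>
  mix ks ts = concat (map (\<lambda>i. ts ! i @ (if i < length ks then [ks ! i] else [])) [0..<length ts])"
proof (induction ks ts rule: mix.induct)
  case (1 k ks t ts)
  have l: "[0..<length (t # ts)] = 0 # map Suc [0..<length ts]"
    by (simp add: upt_conv_Cons map_Suc_upt del: upt_Suc)
  show ?case using 1 unfolding l by (simp add: comp_def del: upt_Suc cong: if_cong)
next
  case (2 t ts)
  then show ?case by (cases ts) auto
qed auto

lemma concat_nth_sum:
  fixes n :: nat
  shows "j < (\<Sum>i<n. length (G i)) \<Longrightarrow>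
   \<exists>i<n. \<exists>j'<length (G i). j = (\<Sum>l<i. length (G l)) + j' \<and> concat (map G [0..<n]) ! j = G i ! j'"
proof (induction n)
  case (Suc n)
  have len: "length (concat (map G [0..<n])) = (\<Sum>i<n. length (G i))"
    by (simp add: length_concat comp_def interv_sum_list_conv_sum_set_nat atLeast0LessThan)
  show ?case
  proof (cases "j < (\<Sum>i<n. length (G i))")
    case True
    with Suc obtain i j' where "i < n" "j' < length (G i)" "j = (\<Sum>l<i. length (G l)) + j'"
      "concat (map G [0..<n]) ! j = G i ! j'" by blast
    then show ?thesis using True len by (intro exI[of _ i]) (auto simp: nth_append)
  next
    case False
    then show ?thesis using Suc.prems len
      by (intro exI[of _ n]) (auto simp: nth_append intro!: exI[of _ "j - (\<Sum>i<n. length (G i))"])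
  qed
qed simp

definition opt_list :: "'a option \<Rightarrow> 'a list" where
  "opt_list k = (case k of None \<Rightarrow> [] | Some k \<Rightarrow> [k])"

definition opt_word :: "'k option \<Rightarrow> 'k word" where
  "opt_word k = (case k of None \<Rightarrow> Num 0 | Some k \<Rightarrow> Key k)"

definition array_at :: "'k memory \<Rightarrow> nat \<Rightarrow> nat \<Rightarrow> 'k list \<Rightarrow> bool" where
  "array_at \<mu> a off xs \<longleftrightarrow> (\<forall>j<length xs. \<mu> (a, off + j) = Some [Key (xs ! j)])"

lemma array_at_mono: "array_at \<mu> a off xs \<Longrightarrow> \<mu> \<subseteq>\<^sub>m \<mu>' \<Longrightarrow> array_at \<mu>' a off xs"
  by (auto simp: array_at_def dest: map_leD)

lemma array_at_concat:
  assumes "\<And>i. i < n \<Longrightarrow> array_at \<mu> a (off + (\<Sum>l<i. length (G l))) (G i)"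
  shows "array_at \<mu> a off (concat (map G [0..<n]))"
  unfolding array_at_def
proof (intro allI impI)
  fix j assume "j < length (concat (map G [0..<n]))"
  then have "j < (\<Sum>i<n. length (G i))"
    by (simp add: length_concat comp_def interv_sum_list_conv_sum_set_nat atLeast0LessThan)
  from concat_nth_sum[OF this] obtain i j' where "i < n" "j' < length (G i)" "j = (\<Sum>l<i. length (G l)) + j'"
      "concat (map G [0..<n]) ! j = G i ! j'" by blast
  then show "\<mu> (a, off + j) = Some [Key (concat (map G [0..<n]) ! j)]"
    using assms[of i] by (auto simp: array_at_def add.assoc)
qed

lemma sum_lessThan_mono:
  fixes f :: "nat \<Rightarrow> nat"
  shows "i \<le> j \<Longrightarrow> (\<Sum>l<i. f l) \<le> (\<Sum>l<j. f l)"
  by (intro sum_mono2) auto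

context union_machine begin

text \<open>The writable set is exactly the stretch of the array that the task fills. Stretches of
  consecutive children adjoin, so the writes of their tasks are disjoint although they go to the
  same region.\<close>

lemma call_flatten:
  assumes "sized \<mu> w t" "balanced B lo h t" "1 \<le> lo" "60 * B * (h + 1) < W" "off + num_keys t + 1 < W"
  shows "call (60 * B * (h + 1)) \<mu> (flatten_task (Ref a) w (num_keys t) off (opt_word k))
    ({a} \<times> {off..<off + length (inorder t @ opt_list k)}) (6 * num_keys t + length (opt_list k)) (6 * h + 1)
    (\<lambda>res \<mu>'. length res = 2 \<and> array_at \<mu>' a off (inorder t @ opt_list k))"
  using assms
proof (induction t arbitrary: \<mu> w lo h off k rule: btree.induct)
  case Ext
  define L where "L = 60 * B * (h + 1)"
  have L: "L < W" "60 * B \<le> L" using Ext by (simp_all add: L_def)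
  have "run L \<mu> (set (flatten_task (Ref a) w 0 off (opt_word k))) 8 (flatten_code (Ref a) w 0 off (opt_word k))
    ({a} \<times> {off..<off + length (opt_list k)}) (length (opt_list k)) (length (opt_list k))
    (\<lambda>res \<mu>'. length res = 2 \<and> array_at \<mu>' a off (opt_list k))"
  proof (cases k)
    case None
    then show ?thesis using L B2
      by (auto simp: flatten_code_def Let_def opt_list_def opt_word_def flatten_task_def array_at_def intro!: run_Ret)
  next
    case (Some x)
    have "run L \<mu> (set (flatten_task (Ref a) w 0 off (Key x))) 8 (St a off [Key x] (Ret [Num 0, Num 0]))
      ({a} \<times> {off..<off + 1}) (Suc 0) (Suc 0) (\<lambda>res \<mu>'. length res = 2 \<and> array_at \<mu>' a off [x])"
    proof (rule run_St)
      show "run L (\<mu>((a, off) \<mapsto> [Key x])) (set (flatten_task (Ref a) w 0 off (Key x))) (8 + 1) (Ret [Num 0, Num 0])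
        ({a} \<times> {off..<off + 1} - {(a, off)}) 0 0 (\<lambda>res \<mu>'. length res = 2 \<and> array_at \<mu>' a off [x])"
        by (rule run_Ret) (use L B2 in \<open>auto simp: array_at_def dest: map_leD\<close>)
    qed (use L B2 Ext in \<open>auto simp: flatten_task_def\<close>)
    then show ?thesis using Some by (simp add: flatten_code_def Let_def opt_list_def opt_word_def)
  qed
  then have "run L \<mu> (set (flatten_task (Ref a) w 0 off (opt_word k))) 8 (flatten_code (Ref a) w 0 off (opt_word k))
    ({a} \<times> {off..<off + length (opt_list k)}) (length (opt_list k)) (6 * h + 1)
    (\<lambda>res \<mu>'. length res = 2 \<and> array_at \<mu>' a off (opt_list k))"
    by (rule run_mono) (auto simp: opt_list_def split: option.splits)
  moreover have "length (flatten_task (Ref a) w 0 off (opt_word k)) + 2 = 8" by (simp add: flatten_task_def)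
  ultimately show ?case unfolding L_def[symmetric] num_keys.simps inorder.simps append_Nil mult_0_right add_0
    by (intro callI) (simp only: union_body_simps)
next
  case (Node ks ts)
  define L where "L = 60 * B * (h + 1)"
  define g where "g = h - 1"
  from Node.prems(2,3) have b: "0 < h" "1 \<le> length ks" "length ks \<le> B" "length ts = length ks + 1"
    "\<And>t. t \<in> set ts \<Longrightarrow> balanced B (B div 2) (h - 1) t" by auto
  have h: "h = g + 1" using b(1) by (simp add: g_def)
  have L: "L < W" "L = 60 * B * (g + 1) + 60 * B" using Node.prems(4) by (simp_all add: L_def h)
  from Node.prems(1) obtain r ws where w: "w = Ref r"
    and n: "node_at \<mu> r (map Key ks) (zip ws (map (\<lambda>t. Num (num_keys t)) ts))"
    and sz: "list_all2 (sized \<mu>) ws ts"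
    by (auto elim: sized.cases)
  define cs :: "('a word \<times> 'a word) list" where "cs = zip ws (map (\<lambda>t. Num (num_keys t)) ts)"
  have lws: "length ws = length ts" using sz by (rule list_all2_lengthD)
  have lcs: "length cs = length ts" by (simp add: cs_def lws)
  let ?n = "length ts"
  define ko where "ko = (\<lambda>i. if i < length ks then Some (ks ! i) else None)"
  define G where "G = (\<lambda>i. inorder (ts ! i) @ opt_list (ko i))"
  define S where "S = (\<lambda>i. \<Sum>l<i. length (G l))"
  have lin: "length (inorder (ts ! i)) = num_keys (ts ! i)" if "i < ?n" for i
    using length_inorder[OF b(5)[OF nth_mem[OF that]]] .
  have flat: "inorder (Node ks ts) = concat (map G [0..<?n])"
  proof -
    have "inorder (Node ks ts) = concat (map (\<lambda>i. map inorder ts ! i @ (if i < length ks then [ks ! i] else [])) [0..<?n])"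
      using mix_concat[of "map inorder ts" ks] b(4) by simp
    also have "\<dots> = concat (map G [0..<?n])"
      by (intro arg_cong[of _ _ concat] map_cong) (auto simp: G_def ko_def opt_list_def)
    finally show ?thesis .
  qed
  have Sn: "S ?n = num_keys (Node ks ts)"
  proof -
    have "S ?n = length (inorder (Node ks ts))" unfolding flat
      by (simp add: S_def length_concat comp_def interv_sum_list_conv_sum_set_nat atLeast0LessThan)
    then show ?thesis using length_inorder[OF Node.prems(2)] by simp
  qed
  have Smono: "i \<le> j \<Longrightarrow> S i \<le> S j" for i j unfolding S_def by (rule sum_lessThan_mono)
  have SSuc: "S (Suc i) = S i + length (G i)" for i by (simp add: S_def)
  have off: "(\<Sum>j<i. num (snd (cs ! j)) + 1) = S i" if "i < ?n" for i
    unfolding S_def by (rule sum.cong) (use that b(4) lws lin in \<open>auto simp: cs_def G_def ko_def opt_list_def\<close>)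
  let ?X = "{a} \<times> {off..<off + num_keys (Node ks ts)}"
  let ?Y = "\<lambda>i. {a} \<times> {off + S i..<off + S i + length (G i)}"
  let ?tasks = "\<lambda>ks (cs :: ('a word \<times> 'a word) list). map (\<lambda>i. flatten_task (Ref a) (fst (cs ! i)) (num (snd (cs ! i)))
                 (off + (\<Sum>j<i. num (snd (cs ! j)) + 1)) ((ks @ [Num 0]) ! i)) [0..<length cs]"
  let ?Q = "\<lambda>res \<mu>'. length res = 2 \<and> array_at \<mu>' a off (inorder (Node ks ts))"
  have rest: "run L \<nu> K 9 (get_node r (\<lambda>ks cs. par (?tasks ks cs) (\<lambda>_. Ret [Num 0, Num 0]))) ?X
        (5 + ((\<Sum>i<?n. 6 * num_keys (ts ! i) + length (opt_list (ko i))) + 0)) (5 + ((6 * g + 1) + 0)) ?Q"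
    if K: "Ref a \<in> K" "Ref r \<in> K" and m: "\<mu> \<subseteq>\<^sub>m \<nu>" for K \<nu>
  proof (rule run_get_node)
    show "node_at \<nu> r (map Key ks) cs" unfolding cs_def by (rule node_at_mono[OF n m])
    show "Ref r \<in> K" by fact
    show "length (map Key ks) \<le> B" "length cs \<le> B + 1" using b lcs by simp_all
    show "9 + 9 * B \<le> L" "L < W" "4 < W" using L B2 by simp_all
    define tasks where "tasks = ?tasks (map Key ks) cs"
    have ltasks: "length tasks = ?n" by (simp add: tasks_def lcs)
    have task: "tasks ! i = flatten_task (Ref a) (ws ! i) (num_keys (ts ! i)) (off + S i) (opt_word (ko i))"
      if "i < ?n" for i
    proof -
      have "tasks ! i = flatten_task (Ref a) (fst (cs ! i)) (num (snd (cs ! i)))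
                 (off + (\<Sum>j<i. num (snd (cs ! j)) + 1)) ((map Key ks @ [Num 0]) ! i)"
        using that lcs by (simp add: tasks_def)
      moreover have "(map Key ks @ [Num 0]) ! i = opt_word (ko i)"
        using that b(4) by (auto simp: ko_def opt_word_def nth_append)
      ultimately show ?thesis using off[OF that] that lws by (simp add: cs_def)
    qed
    have Sle: "S i + length (G i) \<le> num_keys (Node ks ts)" if "i < ?n" for i
      using Smono[of "Suc i" ?n] that unfolding SSuc Sn by simp
    have Gle: "num_keys (ts ! i) \<le> length (G i)" if "i < ?n" for i using lin[OF that] by (simp add: G_def)
    have "run L \<nu> (K \<union> set (map Key ks) \<union> fst ` set cs \<union> snd ` set cs) (9 + 9 * B)
      (par tasks (\<lambda>_. Ret [Num 0, Num 0])) ?X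
      ((\<Sum>i<?n. 6 * num_keys (ts ! i) + length (opt_list (ko i))) + 0) ((6 * g + 1) + 0) ?Q"
    proof (rule run_par[where L' = "60 * B * (g + 1)" and Y = ?Y
          and P = "\<lambda>i res \<mu>'. length res = 2 \<and> array_at \<mu>' a (off + S i) (G i)"])
      show "length tasks = ?n" by (rule ltasks)
      show "?n \<le> 2 * B" using b B2 by simp
      show "9 + 9 * B + 60 * B * (g + 1) + 20 * B \<le> L" "L < W" using L B2 by simp_all
      fix t assume "t \<in> set tasks"
      then obtain i where i: "i < ?n" "t = tasks ! i" by (metis ltasks in_set_conv_nth)
      have "cs ! i \<in> set cs" using i lcs by simp
      moreover have "fst (cs ! i) = ws ! i" using i lws by (simp add: cs_def)
      ultimately have "ws ! i \<in> fst ` set cs" by (metis imageI)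
      moreover have "opt_word (ko i) \<in> set (map Key ks) \<union> Num ` {..<W}"
        using L B2 by (auto simp: ko_def opt_word_def)
      moreover have "num_keys (ts ! i) < W" "off + S i < W"
        using Sle[OF i(1)] Gle[OF i(1)] Node.prems(5) by linarith+
      ultimately show "length t = 6 \<and> set t \<subseteq> K \<union> set (map Key ks) \<union> fst ` set cs \<union> snd ` set cs \<union> Num ` {..<W}"
        unfolding i(2) task[OF i(1)] using K(1) L B2 by (auto simp: flatten_task_def)
    next
      fix i assume i: "i < ?n"
      have "sized \<nu> (ws ! i) (ts ! i)" using list_all2_nthD2[OF sz i] m by (rule sized_mono)
      moreover have "off + S i + num_keys (ts ! i) + 1 < W"
        using Sle[OF i] Gle[OF i] Node.prems(5) by linarith
      ultimately show "call (60 * B * (g + 1)) \<nu> (tasks ! i) (?Y i) (6 * num_keys (ts ! i) + length (opt_list (ko i))) (6 * g + 1)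
          (\<lambda>res \<mu>'. length res = 2 \<and> array_at \<mu>' a (off + S i) (G i))"
        unfolding task[OF i] G_def
        using i b(2,3,5) L B2 by (intro Node.IH[of "ts ! i" \<nu> "ws ! i" "B div 2" g]) (auto simp: g_def)
      show "?Y i \<subseteq> ?X" using Sle[OF i] by auto
      show "?Y i \<inter> ?Y j = {}" if "j < ?n" "i \<noteq> j" for j
        using Smono[of "Suc i" j] Smono[of "Suc j" i] that unfolding SSuc by (cases "i < j") auto
    next
      fix rs :: "('a word \<times> 'a word) list" and \<nu>' assume rs: "length rs = ?n" "\<nu> \<subseteq>\<^sub>m \<nu>'"
        "\<And>i \<nu>''. i < ?n \<Longrightarrow> \<nu>' \<subseteq>\<^sub>m \<nu>'' \<Longrightarrow>
          length [fst (rs ! i), snd (rs ! i)] = 2 \<and> array_at \<nu>'' a (off + S i) (G i)"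
      show "run L \<nu>' (K \<union> set (map Key ks) \<union> fst ` set cs \<union> snd ` set cs \<union> fst ` set rs \<union> snd ` set rs)
        (9 + 9 * B + 4 * B + 3) (Ret [Num 0, Num 0]) (?X - (\<Union>i<?n. ?Y i)) 0 0 ?Q"
      proof (rule run_Ret)
        show "length [Num 0, Num 0 :: 'a word] = 2 \<and> array_at \<nu>'' a off (inorder (Node ks ts))" if "\<nu>' \<subseteq>\<^sub>m \<nu>''" for \<nu>''
          unfolding flat using rs(3)[OF _ that] by (auto intro!: array_at_concat simp: S_def)
      qed (use L B2 in auto)
    qed simp
    then show "run L \<nu> (K \<union> set (map Key ks) \<union> fst ` set cs \<union> snd ` set cs) (9 + 9 * B)
      (par (?tasks (map Key ks) cs) (\<lambda>_. Ret [Num 0, Num 0])) ?X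
      ((\<Sum>i<?n. 6 * num_keys (ts ! i) + length (opt_list (ko i))) + 0) ((6 * g + 1) + 0) ?Q"
      unfolding tasks_def .
  qed
  \<comment> \<open>Of the 6 units due to each key of the node, one is for its own store by a
    child's task; the other 5 of any one key cover the five loads.\<close>
  have work: "5 + ((\<Sum>i<?n. 6 * num_keys (ts ! i) + length (opt_list (ko i))) + 0) \<le> 6 * num_keys (Node ks ts)"
  proof -
    have "(\<Sum>i<?n. 6 * num_keys (ts ! i) + length (opt_list (ko i))) =
        6 * sum_list (map num_keys ts) + (\<Sum>i<?n. length (opt_list (ko i)))"
      by (simp add: sum.distrib sum_list_sum_nth sum_distrib_left atLeast0LessThan)
    moreover have "(\<Sum>i<?n. length (opt_list (ko i))) = length ks"
      using b(4) by (simp add: ko_def opt_list_def)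
    ultimately show ?thesis using b(2) by simp
  qed
  let ?K = "set (flatten_task (Ref a) w (num_keys (Node ks ts)) off (opt_word k))"
  have nz: "num_keys (Node ks ts) \<noteq> 0" using b(2) by auto
  define R where "R = (get_node r (\<lambda>ks cs. par (?tasks ks cs) (\<lambda>_. Ret [Num 0, Num 0])) :: 'a code)"
  have rest': "run L \<nu> ?K 9 R ?X (6 * num_keys (Node ks ts)) (6 * h) ?Q" if "\<mu> \<subseteq>\<^sub>m \<nu>" for \<nu>
    unfolding R_def by (rule run_mono[OF rest]) (use work that w h in \<open>auto simp: flatten_task_def\<close>)
  have "run L \<mu> ?K 8 (flatten_code (Ref a) w (num_keys (Node ks ts)) off (opt_word k))
    ({a} \<times> {off..<off + length (inorder (Node ks ts) @ opt_list k)}) (6 * num_keys (Node ks ts) + length (opt_list k)) (6 * h + 1)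
    (\<lambda>res \<mu>'. length res = 2 \<and> array_at \<mu>' a off (inorder (Node ks ts) @ opt_list k))"
  proof (cases k)
    case None
    have "run L \<mu> ?K 8 R ?X (6 * num_keys (Node ks ts)) (6 * h + 1) ?Q"
      by (rule run_mono[OF run_weaken[OF rest'[OF map_le_refl]]]) auto
    then show ?thesis using None nz length_inorder[OF Node.prems(2)] w
      by (simp add: flatten_code_def Let_def opt_list_def opt_word_def R_def del: num_keys.simps inorder.simps)
  next
    case (Some x)
    let ?sz = "num_keys (Node ks ts)"
    have "run L \<mu> ?K 8 (St a (off + ?sz) [Key x] R) ({a} \<times> {off..<off + (?sz + 1)}) (Suc (6 * ?sz)) (Suc (6 * h))
      (\<lambda>res \<mu>'. length res = 2 \<and> array_at \<mu>' a off (inorder (Node ks ts) @ [x]))"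
    proof (rule run_St)
      assume new: "(a, off + ?sz) \<notin> dom \<mu>"
      let ?m = "\<mu>((a, off + ?sz) \<mapsto> [Key x])"
      have "\<mu> \<subseteq>\<^sub>m ?m" by (rule map_le_upd[OF new map_le_refl])
      from rest'[OF this]
      have "run L ?m ?K 9 R ?X (6 * ?sz) (6 * h) (\<lambda>res \<mu>'. length res = 2 \<and> array_at \<mu>' a off (inorder (Node ks ts) @ [x]))"
      proof (rule run_mono)
        fix res \<mu>' assume *: "?m \<subseteq>\<^sub>m \<mu>'" "?Q res \<mu>'"
        have "\<mu>' (a, off + ?sz) = Some [Key x]" using map_leD[OF *(1)] by simp
        then show "length res = 2 \<and> array_at \<mu>' a off (inorder (Node ks ts) @ [x])"
          using *(2) length_inorder[OF Node.prems(2)]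
          by (auto simp: array_at_def nth_append less_Suc_eq simp del: num_keys.simps inorder.simps)
      qed simp_all
      then show "run L ?m ?K (8 + 1) R ({a} \<times> {off..<off + (?sz + 1)} - {(a, off + ?sz)}) (6 * ?sz) (6 * h)
         (\<lambda>res \<mu>'. length res = 2 \<and> array_at \<mu>' a off (inorder (Node ks ts) @ [x]))"
        by (rule run_weaken) auto
    qed (use L B2 Node.prems(5) Some in \<open>auto simp: flatten_task_def opt_word_def simp del: num_keys.simps\<close>)
    then show ?thesis using Some nz length_inorder[OF Node.prems(2)] w
      by (simp add: flatten_code_def Let_def opt_list_def opt_word_def R_def del: num_keys.simps inorder.simps)
  qed
  moreover have "length (flatten_task (Ref a) w (num_keys (Node ks ts)) off (opt_word k)) + 2 = 8" by (simp add: flatten_task_def)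
  ultimately show ?case unfolding L_def[symmetric]
    by (intro callI) (simp only: union_body_simps)
qed

end

section \<open>Counting by sampling\<close>

lemma nth_iff_less_count:
  "(\<And>i j. i < j \<Longrightarrow> j < length S \<Longrightarrow> P (S ! j) \<Longrightarrow> P (S ! i)) \<Longrightarrow> i < length S \<Longrightarrow>
   P (S ! i) \<longleftrightarrow> i < length (filter P S)"
proof (induction S arbitrary: i)
  case (Cons x S)
  have IH: "P (S ! i) \<longleftrightarrow> i < length (filter P S)" if "i < length S" for i
    by (rule Cons.IH[OF _ that]) (use Cons.prems(1)[of "Suc _" "Suc _"] in auto)
  show ?case
  proof (cases "P x")
    case True
    then show ?thesis using IH Cons.prems(2) by (cases i) auto
  next
    case False
    have "\<not> P y" if "y \<in> set S" for y
    proof -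
      from that obtain j where "j < length S" "y = S ! j" by (metis in_set_conv_nth)
      then show ?thesis using Cons.prems(1)[of 0 "Suc j"] False by auto
    qed
    then have "filter P S = []" by (simp add: filter_empty_conv)
    then show ?thesis using IH False Cons.prems(2) by (cases i) auto
  qed
qed simp

lemma length_filter_less_upt: "length (filter (\<lambda>i. i < M) [0..<N]) = min M N"
  by (induction N) auto

lemma length_filter_map_upt:
  assumes "\<And>i. i < N \<Longrightarrow> P (f i) \<longleftrightarrow> i < M" "M \<le> N"
  shows "length (filter P (map f [0..<N])) = M"
proof -
  have "filter P (map f [0..<N]) = map f (filter (\<lambda>i. i < M) [0..<N])"
    unfolding filter_map using assms(1) by (intro arg_cong[of _ _ "map f"] filter_cong) auto
  then show ?thesis using assms(2) by (simp add: length_filter_less_upt)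
qed

lemma mult_less_iff_less_ceiling: "1 \<le> s \<Longrightarrow> i * s < n \<longleftrightarrow> i < (n + s - 1) div (s :: nat)"
proof -
  assume s: "1 \<le> s"
  have "i < (n + s - 1) div s \<longleftrightarrow> (i + 1) * s \<le> n + s - 1"
    using s by (simp add: less_eq_div_iff_mult_less_eq flip: Suc_le_eq)
  also have "\<dots> \<longleftrightarrow> i * s < n" using s by auto
  finally show ?thesis by simp
qed

text \<open>If the prefix has length \<open>n\<close>, the number of sampled positions in it is the
  ceiling of \<open>n / s\<close>. So sample \<open>c - 1\<close> is inside and sample
  \<open>c\<close>, if any, outside, and the end of the prefix is among the \<open>s - 1\<close>
  positions in between.\<close>

lemma sampled_count:
  assumes P: "\<forall>i j. i < j \<longrightarrow> j < length S \<longrightarrow> P (S ! j) \<longrightarrow> P (S ! i)" and s: "1 \<le> s" and k: "k = length S"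
    and c: "c = length (filter P (map (\<lambda>i. S ! (i * s)) [0..<(k + s - 1) div s]))"
  shows "resume s c + length (filter P (map (\<lambda>i. S ! (resume s c + i)) [0..<remaining k s c])) = length (filter P S)"
    and "remaining k s c \<le> s - 1" "resume s c + remaining k s c \<le> k" "c \<le> k"
proof -
  let ?n = "length (filter P S)"
  have iff: "P (S ! i) \<longleftrightarrow> i < ?n" if "i < k" for i
    using nth_iff_less_count[of S P i] P that k by blast
  have nk: "?n \<le> k" using k by simp
  have c': "c = (?n + s - 1) div s" unfolding c
  proof (rule length_filter_map_upt)
    fix i assume "i < (k + s - 1) div s"
    then have "i * s < k" using mult_less_iff_less_ceiling[OF s] by simp
    then show "P (S ! (i * s)) \<longleftrightarrow> i < (?n + s - 1) div s" using iff mult_less_iff_less_ceiling[OF s] by simp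
  qed (use nk in \<open>simp add: div_le_mono\<close>)
  have lt: "i * s < ?n \<longleftrightarrow> i < c" for i using mult_less_iff_less_ceiling[OF s] c' by simp
  have ck: "c \<le> ?n"
  proof (rule ccontr)
    assume "\<not> c \<le> ?n"
    then have "?n * s < ?n" using lt by simp
    moreover have "?n * 1 \<le> ?n * s" using s by (rule mult_le_mono2)
    ultimately show False by simp
  qed
  then show "c \<le> k" using nk by simp
  show "remaining k s c \<le> s - 1" by (simp add: remaining_def)
  have "resume s c + length (filter P (map (\<lambda>i. S ! (resume s c + i)) [0..<remaining k s c])) = ?n \<and>
    resume s c + remaining k s c \<le> k"
  proof (cases "c = 0")
    case True
    then show ?thesis using lt[of 0] by (simp add: resume_def remaining_def)
  next
    case False
    then have r: "resume s c \<le> ?n" using lt[of "c - 1"] by (simp add: resume_def)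
    have "?n \<le> c * s" using lt[of c] by simp
    also have "c * s = (c - 1) * s + s" using False by (cases c) auto
    finally have n: "?n - resume s c \<le> s - 1" using False by (simp add: resume_def)
    have rem: "remaining k s c = min (s - 1) (k - resume s c)" using False by (simp add: remaining_def)
    have "length (filter P (map (\<lambda>i. S ! (resume s c + i)) [0..<remaining k s c])) = ?n - resume s c"
    proof (rule length_filter_map_upt)
      fix i assume "i < remaining k s c"
      then have "i < k - resume s c" using rem by simp
      then have "resume s c + i < k" by linarith
      then show "P (S ! (resume s c + i)) \<longleftrightarrow> i < ?n - resume s c" using iff by auto
    qed (use n nk rem in simp)
    moreover have "resume s c + remaining k s c \<le> k" using r nk unfolding rem by linarith
    ultimately show ?thesis using r by simp
  qed
  note both = this
  show "resume s c + length (filter P (map (\<lambda>i. S ! (resume s c + i)) [0..<remaining k s c])) = ?n"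
    by (rule both[THEN conjunct1])
  show "resume s c + remaining k s c \<le> k" by (rule both[THEN conjunct2])
qed

definition sample :: "'a list \<Rightarrow> nat \<Rightarrow> nat \<Rightarrow> nat \<Rightarrow> 'a list" where
  "sample xs p s n = map (\<lambda>i. xs ! (p + i * s)) [0..<n]"

lemma sample_add: "sample xs p s (m + n) = sample xs p s m @ sample xs (p + m * s) s n"
proof -
  have "sample xs p s (m + n) = sample xs p s m @ map (\<lambda>i. xs ! (p + i * s)) [m..<m + n]"
    unfolding sample_def using upt_add_eq_append[of 0 m n] by simp
  also have "map (\<lambda>i. xs ! (p + i * s)) [m..<m + n] = sample xs (p + m * s) s n"
    unfolding sample_def by (rule nth_equalityI) (simp_all add: algebra_simps)
  finally show ?thesis .
qed

definition counts :: "'a::linorder list \<Rightarrow> 'a list \<Rightarrow> 'a list \<Rightarrow> nat list" where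
  "counts xs ys zs = map (\<lambda>y. length (filter (\<lambda>x. x < y) xs)) ys @ map (\<lambda>z. length (filter (\<lambda>x. x \<le> z) xs)) zs"

lemma counts_append: "counts (xs @ xs') ys zs = map2 (+) (counts xs ys zs) (counts xs' ys zs)"
  unfolding counts_def by (simp add: zip_map1 zip_map2 zip_same_conv_map comp_def zip_append)

lemma length_counts: "length (counts xs ys zs) = length ys + length zs"
  by (simp add: counts_def)

lemma counts_le: "c \<in> set (counts xs ys zs) \<Longrightarrow> c \<le> length xs"
  by (auto simp: counts_def)

context union_machine begin

text \<open>The exponent \<open>e\<close> bounds the number of halvings and hence the stack frames.
  All reads happen at the leaves of the fork tree, one per path, which gives span 1 for every
  \<open>n\<close>.\<close>

lemma call_count:
  assumes "array_at \<mu> a 0 A" "0 < n \<Longrightarrow> p + (n - 1) * s < length A" "1 \<le> s" "n \<le> 2 ^ e"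
    "length ys + length zs \<le> 2 * B" "60 * B * (e + 1) < W" "length A < W"
  shows "call (60 * B * (e + 1)) \<mu> (count_args (Ref a) p s n (map Key ys) (map Key zs)) {} n 1
    (\<lambda>res \<mu>'. res = map Num (counts (sample A p s n) ys zs))"
  using assms(1-4,6)
proof (induction e arbitrary: n p)
  have args: "length (count_args (Ref a) p s n (map Key ys) (map Key zs)) + 2 = 8 + length ys + length zs" for p n
    by (simp add: count_args_def)
  have small: "call L \<mu> (count_args (Ref a) p s n (map Key ys) (map Key zs)) {} n 1
    (\<lambda>res \<mu>'. res = map Num (counts (sample A p s n) ys zs))"
    if n: "n \<le> 1" "0 < n \<Longrightarrow> p + (n - 1) * s < length A" and L: "60 * B \<le> L" "L < W" for L n p
  proof (rule callI, unfold union_body_simps args)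
    show "run L \<mu> (set (count_args (Ref a) p s n (map Key ys) (map Key zs))) (8 + length ys + length zs)
      (count_code (Ref a) p s n (map Key ys) (map Key zs)) {} n 1 (\<lambda>res \<mu>'. res = map Num (counts (sample A p s n) ys zs))"
    proof (cases "n = 0")
      case True
      then show ?thesis using L B2 assms(5)
        by (auto simp: count_code_def sample_def counts_def intro!: run_Ret)
    next
      case False
      then have n1: "n = 1" using n by simp
      let ?x = "A ! p"
      have p: "p < length A" using n n1 by simp
      have eq: "map (\<lambda>y. Num (if key (hd [Key ?x]) < key y then 1 else 0)) (map Key ys) @
          map (\<lambda>z. Num (if key (hd [Key ?x]) \<le> key z then 1 else 0)) (map Key zs) =
          map Num (counts (sample A p s n) ys zs)"
        by (simp add: n1 sample_def counts_def)
      have "run L \<mu> (set (count_args (Ref a) p s n (map Key ys) (map Key zs))) (8 + length ys + length zs)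
        (Ld a p (\<lambda>x. Ret (map (\<lambda>y. Num (if key (hd x) < key y then 1 else 0)) (map Key ys) @
             map (\<lambda>z. Num (if key (hd x) \<le> key z then 1 else 0)) (map Key zs)))) {} (Suc 0) (Suc 0)
        (\<lambda>res \<mu>'. res = map Num (counts (sample A p s n) ys zs))"
      proof (rule run_Ld[where blk = "[Key ?x]"])
        show "\<mu> (a, p) = Some [Key ?x]" using assms(1) p by (simp add: array_at_def)
        have "set (map Num (counts (sample A p s n) ys zs)) \<subseteq> Num ` {..<W}"
          using counts_le[of _ "sample A p s n" ys zs] n1 L B2 by (fastforce simp: sample_def)
        then show "run L \<mu> (set (count_args (Ref a) p s n (map Key ys) (map Key zs)) \<union> set [Key ?x])
          (8 + length ys + length zs + length [Key ?x] + 2) (Ret (map (\<lambda>y. Num (if key (hd [Key ?x]) < key y then 1 else 0)) (map Key ys) @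
             map (\<lambda>z. Num (if key (hd [Key ?x]) \<le> key z then 1 else 0)) (map Key zs))) {} 0 0
          (\<lambda>res \<mu>'. res = map Num (counts (sample A p s n) ys zs))"
          unfolding eq using L B2 assms(5) by (intro run_Ret) (auto simp: length_counts)
      qed (use L B2 p assms(5,7) in \<open>auto simp: count_args_def\<close>)
      then show ?thesis using n1 by (simp add: count_code_def)
    qed
  qed
  {
    case 0
    then show ?case by (intro small) auto
  next
    case (Suc e)
    define L where "L = 60 * B * (Suc e + 1)"
    have L: "L < W" "L = 60 * B * (e + 1) + 60 * B" using Suc.prems(5) by (simp_all add: L_def)
    show ?case
    proof (cases "n \<le> 1")
      case True
      then show ?thesis using Suc.prems by (intro small) auto
    next
      case False
      define m where "m = n div 2"
      have m: "0 < m" "m < n" "m \<le> 2 ^ e" "n - m \<le> 2 ^ e" "0 < n - m" using False Suc.prems(4) by (auto simp: m_def)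
      have pn: "p + (n - 1) * s < length A" using Suc.prems(2) False by simp
      have nA: "n - 1 \<le> (n - 1) * s" "s \<le> (n - 1) * s" using False Suc.prems(3) by auto
      have "(m - 1) * s \<le> (n - 1) * s" "m * s \<le> (n - 1) * s" using m by (auto intro!: mult_le_mono1)
      then have pm: "p + (m - 1) * s < length A" "p + m * s < length A" using pn by linarith+
      have "m * s + (n - m - 1) * s = (n - 1) * s" using m by (simp flip: add_mult_distrib)
      then have pm': "p + m * s + (n - m - 1) * s < length A" using pn by linarith
      let ?K = "set (count_args (Ref a) p s n (map Key ys) (map Key zs))" and ?l = "8 + length ys + length zs"
      let ?cs = "[count_args (Ref a) p s m (map Key ys) (map Key zs), count_args (Ref a) (p + m * s) s (n - m) (map Key ys) (map Key zs)]"
      let ?P = "\<lambda>(i::nat) res \<mu>'. res = map Num (counts (if i = 0 then sample A p s m else sample A (p + m * s) s (n - m)) ys zs)"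
      have code: "count_code (Ref a) p s n (map Key ys) (map Key zs) =
          Fk ?cs (\<lambda>rs. Ret (map2 (\<lambda>u v. Num (num u + num v)) (rs ! 0) (rs ! 1)))"
        using False by (simp add: count_code_def m_def)
      have numW: "p < W" "p + m * s < W" "s < W" "m < W" "n - m < W" "n < W" "length ys < W"
        using pn pm(2) nA assms(7) m L assms(5) B2 by linarith+
      have "run L \<mu> ?K ?l (count_code (Ref a) p s n (map Key ys) (map Key zs)) {}
        ((\<Sum>i<(2::nat). if i = 0 then m else n - m) + 0) (1 + 0) (\<lambda>res \<mu>'. res = map Num (counts (sample A p s n) ys zs))"
        unfolding code
      proof (rule run_Fk[where Y = "\<lambda>_. {}" and P = ?P and b = "2 * B"], goal_cases)
        case 3
        then show ?case using numW assms(5) L B2 by (auto simp: count_args_def)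
      next
        case (5 i)
        have "call (60 * B * (e + 1)) \<mu> (?cs ! i) {} (if i = 0 then m else n - m) 1 (?P i)"
          using Suc.IH[of m p] Suc.IH[of "n - m" "p + m * s"] Suc.prems pm pm' m L 5
          by (auto simp: numeral_2_eq_2 less_Suc_eq)
        then show ?case by (rule call_mono) (use L assms(5) B2 in auto)
      next
        case (6 i res \<mu>')
        then show ?case using assms(5) by (auto simp: length_counts split: if_splits)
      next
        case (12 i j)
        then show ?case by simp
      next
        case (13 rs \<nu>)
        then obtain r0 r1 where r: "rs = [r0, r1]" by (auto simp: numeral_2_eq_2 length_Suc_conv)
        have r01: "r0 = map Num (counts (sample A p s m) ys zs)" "r1 = map Num (counts (sample A (p + m * s) s (n - m)) ys zs)"
          using 13(3)[of 0 \<nu>] 13(3)[of 1 \<nu>] r by auto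
        have "sample A p s n = sample A p s m @ sample A (p + m * s) s (n - m)"
          using sample_add[of A p s m "n - m"] m by simp
        then have eq: "map2 (\<lambda>u v. Num (num u + num v)) (rs ! 0) (rs ! 1) = map Num (counts (sample A p s n) ys zs)"
          unfolding r r01 by (simp add: counts_append zip_map1 zip_map2 comp_def case_prod_unfold)
        have "set (map Num (counts (sample A p s n) ys zs)) \<subseteq> Num ` {..<W}"
          using counts_le[of _ "sample A p s n" ys zs] numW(6) by (fastforce simp: sample_def)
        then show ?case unfolding eq using L B2 assms(5) by (intro run_Ret) (auto simp: length_counts)
      qed (use L B2 assms(5) in \<open>auto simp: count_args_def\<close>)
      then have "run L \<mu> ?K ?l (count_code (Ref a) p s n (map Key ys) (map Key zs)) {} n 1
          (\<lambda>res \<mu>'. res = map Num (counts (sample A p s n) ys zs))"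
        by (rule run_mono) (use m in \<open>auto simp: numeral_2_eq_2\<close>)
      then show ?thesis unfolding L_def[symmetric] by (intro callI) (simp only: union_body_simps args)
    qed
  }
qed

text \<open>The strict and the weak rank may end in different gaps, so two gaps of fewer than
  \<open>s\<close> keys are counted in parallel. They are then combined with the sample counts by
  \<open>sampled_count\<close>.\<close>

lemma call_rank:
  assumes A: "array_at \<mu> a 0 A" "sorted_wrt (<) A" and pk: "p + k \<le> length A" "1 \<le> s" "k \<le> 2 ^ e"
    and W: "60 * B * (e + 2) < W" "length A < W"
    and c: "c = length (filter (\<lambda>x. x < y) (sample A p s ((k + s - 1) div s)))"
      "c' = length (filter (\<lambda>x. x \<le> y) (sample A p s ((k + s - 1) div s)))"
  shows "call (60 * B * (e + 2)) \<mu> (rank_args (Ref a) p k s c c' (Key y)) {} (2 * (s - 1)) 1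
    (\<lambda>res \<mu>'. res = [Num (length (filter (\<lambda>x. x < y) (slice p (p + k) A))), Num (length (filter (\<lambda>x. x \<le> y) (slice p (p + k) A)))])"
proof -
  define S where "S = slice p (p + k) A"
  define L where "L = 60 * B * (e + 2)"
  have L: "L < W" "L = 60 * B * (e + 1) + 60 * B" using W by (simp_all add: L_def)
  have lS: "length S = k" using pk by (simp add: S_def length_slice)
  have nS: "S ! i = A ! (p + i)" if "i < k" for i using that pk by (simp add: S_def nth_slice)
  have sS: "S ! i < S ! j" if "i < j" "j < k" for i j
    using that A(2) pk by (simp add: nS sorted_wrt_iff_nth_less)
  have sam: "sample A p s ((k + s - 1) div s) = map (\<lambda>i. S ! (i * s)) [0..<(k + s - 1) div s]"
    unfolding sample_def by (rule map_cong) (use mult_less_iff_less_ceiling[OF pk(2)] in \<open>auto simp: nS\<close>)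
  have sam': "sample A (p + q) 1 m = map (\<lambda>i. S ! (q + i)) [0..<m]" if "q + m \<le> k" for q m
    unfolding sample_def by (rule map_cong) (use that in \<open>auto simp: nS add.assoc\<close>)
  have "\<forall>i j. i < j \<longrightarrow> j < length S \<longrightarrow> S ! j < y \<longrightarrow> S ! i < y"
    using less_trans[OF sS] lS by simp
  note lt = sampled_count[OF this pk(2) lS[symmetric] c(1)[unfolded sam]]
  have "\<forall>i j. i < j \<longrightarrow> j < length S \<longrightarrow> S ! j \<le> y \<longrightarrow> S ! i \<le> y"
    using less_le_trans[OF sS] lS by (simp add: less_imp_le)
  note le = sampled_count[OF this pk(2) lS[symmetric] c(2)[unfolded sam]]
  have lt': "resume s c + length (filter (\<lambda>x. x < y) (sample A (p + resume s c) 1 (remaining k s c))) = length (filter (\<lambda>x. x < y) S)"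
    "remaining k s c \<le> s - 1" "resume s c + remaining k s c \<le> k"
    unfolding sam'[OF lt(3)] using lt by simp_all
  have le': "resume s c' + length (filter (\<lambda>x. x \<le> y) (sample A (p + resume s c') 1 (remaining k s c'))) = length (filter (\<lambda>x. x \<le> y) S)"
    "remaining k s c' \<le> s - 1" "resume s c' + remaining k s c' \<le> k"
    unfolding sam'[OF le(3)] using le by simp_all
  let ?K = "set (rank_args (Ref a) p k s c c' (Key y))"
  let ?cs = "[count_args (Ref a) (p + resume s c) 1 (remaining k s c) [Key y] [],
         count_args (Ref a) (p + resume s c') 1 (remaining k s c') [] [Key y]]"
  let ?P = "\<lambda>(i::nat) res \<mu>'. if i = 0 then res = [Num (length (filter (\<lambda>x. x < y) (sample A (p + resume s c) 1 (remaining k s c))))]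
      else res = [Num (length (filter (\<lambda>x. x \<le> y) (sample A (p + resume s c') 1 (remaining k s c'))))]"
  let ?Q = "\<lambda>res \<mu>'. res = [Num (length (filter (\<lambda>x. x < y) S)), Num (length (filter (\<lambda>x. x \<le> y) S))]"
  have k2: "remaining k s c \<le> 2 ^ e" "remaining k s c' \<le> 2 ^ e" using lt'(3) le'(3) pk(3) by linarith+
  have c0: "call (60 * B * (e + 1)) \<mu> (?cs ! 0) {} (s - 1) 1 (?P 0)"
  proof -
    have "call (60 * B * (e + 1)) \<mu> (count_args (Ref a) (p + resume s c) 1 (remaining k s c) (map Key [y]) (map Key [])) {} (remaining k s c) 1
        (\<lambda>res \<mu>'. res = map Num (counts (sample A (p + resume s c) 1 (remaining k s c)) [y] []))"
      by (rule call_count[OF A(1)]) (use lt'(3) pk L W B2 k2 in auto)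
    then show ?thesis using lt'(2) by (auto elim!: call_mono simp: counts_def)
  qed
  have c1: "call (60 * B * (e + 1)) \<mu> (?cs ! 1) {} (s - 1) 1 (?P 1)"
  proof -
    have "call (60 * B * (e + 1)) \<mu> (count_args (Ref a) (p + resume s c') 1 (remaining k s c') (map Key []) (map Key [y])) {} (remaining k s c') 1
        (\<lambda>res \<mu>'. res = map Num (counts (sample A (p + resume s c') 1 (remaining k s c')) [] [y]))"
      by (rule call_count[OF A(1)]) (use le'(3) pk L W B2 k2 in auto)
    then show ?thesis using le'(2) by (auto elim!: call_mono simp: counts_def)
  qed
  have "run L \<mu> ?K 10 (rank_code (Ref a) p k s c c' (Key y)) {} ((\<Sum>i<(2::nat). s - 1) + 0) (1 + 0) ?Q"
    unfolding rank_code_def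
  proof (rule run_Fk[where Y = "\<lambda>_. {}" and P = ?P and b = 1], goal_cases)
    case (3 x)
    then show ?case using lt'(3) le'(3) pk W L B2 by (auto simp: count_args_def rank_args_def)
  next
    case (5 i)
    then have "call (60 * B * (e + 1)) \<mu> (?cs ! i) {} (s - 1) 1 (?P i)"
      using c0 c1 by (auto simp: numeral_2_eq_2 less_Suc_eq)
    then show ?case by (rule call_mono) (use L B2 in auto)
  next
    case (6 i res \<mu>')
    then show ?case by (auto split: if_splits)
  next
    case (13 rs \<nu>)
    then obtain r0 r1 where r: "rs = [r0, r1]" by (auto simp: numeral_2_eq_2 length_Suc_conv)
    have r01: "r0 = [Num (length (filter (\<lambda>x. x < y) (sample A (p + resume s c) 1 (remaining k s c))))]"
      "r1 = [Num (length (filter (\<lambda>x. x \<le> y) (sample A (p + resume s c') 1 (remaining k s c'))))]"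
      using 13(3)[of 0 \<nu>] 13(3)[of 1 \<nu>] r by auto
    have fW: "length (filter Q S) < W" for Q
      using length_filter_le[of Q S] lS pk W by linarith
    show ?case unfolding r r01 using lt'(1) le'(1) L B2 fW by (intro run_Ret) auto
  qed (use L B2 in \<open>auto simp: count_args_def\<close>)
  then have "run L \<mu> ?K 10 (rank_code (Ref a) p k s c c' (Key y)) {} (2 * (s - 1)) 1 ?Q"
    by (rule run_mono) auto
  moreover have "length (rank_args (Ref a) p k s c c' (Key y)) + 2 = 10" by (simp add: rank_args_def)
  ultimately show ?thesis unfolding L_def[symmetric] S_def[symmetric] by (intro callI) (simp only: union_body_simps)
qed

end

section \<open>Planning the union\<close>

text \<open>A plan is represented by a pointer with a number of units. Inner nodes of the plan live
  in new regions, kept subtrees are shared with the input, and gaps are positions in the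
  array.\<close>

inductive planned :: "nat \<Rightarrow> 'k list \<Rightarrow> 'k memory \<Rightarrow> 'k word \<times> nat \<Rightarrow> 'k plan \<Rightarrow> bool" for B A \<mu> where
  keep: "stored \<mu> w t \<Longrightarrow> planned B A \<mu> (w, 0) (Keep t)"
| gap: "p + length xs \<le> length A \<Longrightarrow> xs = slice p (p + length xs) A \<Longrightarrow>
    planned B A \<mu> (Num p, length xs + 1) (Gap xs)"
| node: "node_at \<mu> r (map Key ks) (map (\<lambda>(w, c). (w, Num c)) ds) \<Longrightarrow> list_all2 (planned B A \<mu>) ds ps \<Longrightarrow>
    c = length (units B (PNode ks ps)) \<Longrightarrow> planned B A \<mu> (Ref r, c) (PNode ks ps)"

lemma planned_mono: "planned B A \<mu> d p \<Longrightarrow> \<mu> \<subseteq>\<^sub>m \<mu>' \<Longrightarrow> planned B A \<mu>' d p"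
proof (induction rule: planned.induct)
  case (node r ks ds ps c)
  then show ?case
    by (intro planned.node[of _ _ _ ds]) (auto intro: node_at_mono elim!: list_all2_mono)
next
  case (gap p xs)
  then show ?case by (intro planned.gap)
qed (auto intro: planned.keep stored_mono)

lemma planned_count: "planned B A \<mu> d p \<Longrightarrow> plan_ok B p \<Longrightarrow> max 1 (snd d) = length (units B p)"
proof (induction rule: planned.induct)
  case (node r ks ds ps c)
  have "units B (PNode ks ps) \<noteq> []" using closed_units_units[OF node.prems] by (simp add: closed_units_def)
  then show ?case using node.hyps by (simp add: Suc_leI max_absorb2 del: units.simps)
qed simp_all

lemma stride_pos: "1 \<le> stride k b"
  by (simp add: stride_def)

text \<open>Strides are passed in arguments and so have to be machine integers.\<close>

lemma stride_le: "1 \<le> k \<Longrightarrow> stride k b \<le> k"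
proof -
  assume k: "1 \<le> k"
  have "real k / real b \<le> real k"
    using k by (cases "b = 0") (auto simp: field_simps Suc_le_eq)
  also have "\<dots> \<le> (real k)\<^sup>2" using k by (simp add: power2_eq_square)
  finally have "sqrt (real k / real b) \<le> real k" by (simp add: real_le_lsqrt)
  then have "nat \<lfloor>sqrt (real k / real b)\<rfloor> \<le> k" by linarith
  then show ?thesis using k by (simp add: stride_def)
qed

lemma sample_1: "p + k \<le> length A \<Longrightarrow> sample A p 1 k = slice p (p + k) A"
  by (rule nth_equalityI) (simp_all add: sample_def length_slice nth_slice)

context union_machine begin

text \<open>The stack holds one frame per tree level, and below any of them the \<open>e + 1\<close>
  frames of a count or the \<open>e + 2\<close> of a rank. At every node the ranks delimit the
  shares given by \<open>splits\<close>, and the numbers of units are gathered on the way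
  back.\<close>

lemma call_plan:
  assumes "stored \<mu> w t" "balanced B lo h t" "1 \<le> lo" "sorted_wrt (<) (inorder t)"
    and "p \<le> length A" "q \<le> length A" "60 * B * (h + e + 2) < W"
    and "array_at \<mu> a 0 A" and A: "sorted_wrt (<) A" "length A \<le> 2 ^ e" "length A + 2 < W"
  shows "call (60 * B * (h + e + 2)) \<mu> (plan_task (Ref a) w p q) {} (plan_work t (slice p q A)) (10 * h)
    (\<lambda>res \<mu>'. \<exists>w' c. res = [w', Num c] \<and> planned B A \<mu>' (w', c) (make_plan t (slice p q A)))"
  using assms(1-8)
proof (induction t arbitrary: \<mu> w lo h p q rule: btree.induct)
  case Ext
  define L where "L = 60 * B * (h + e + 2)"
  have L: "L < W" "60 * B \<le> L" using Ext by (simp_all add: L_def)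
  have w: "w = Num 0" using Ext(1) by (auto elim: stored.cases)
  have "run L \<mu> (set (plan_task (Ref a) w p q)) 8 (plan_code B (Ref a) w p q) {} 0 (10 * h)
    (\<lambda>res \<mu>'. \<exists>w' c. res = [w', Num c] \<and> planned B A \<mu>' (w', c) (make_plan Ext (slice p q A)))"
  proof (cases "q \<le> p")
    case True
    then have s: "slice p q A = []" using Ext(6) by (simp add: slice_def)
    show ?thesis using True L B2 w
      by (auto simp: plan_code_def plan_task_def s intro!: run_Ret planned.keep stored.ext)
  next
    case False
    have len: "length (slice p q A) = q - p" using Ext(6) by (rule length_slice)
    then have ne: "slice p q A \<noteq> []" using False by auto
    have c: "plan_code B (Ref a) w p q = Ret [Num p, Num (q - p + 1)]" using False w by (simp add: plan_code_def)
    have g: "planned B A \<mu>' (Num p, length (slice p q A) + 1) (Gap (slice p q A))" for \<mu>'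
      using False Ext(6) len by (intro planned.gap) simp_all
    show ?thesis unfolding c
    proof (rule run_Ret)
      show "\<exists>w' c. [Num p, Num (q - p + 1)] = [w', Num c] \<and> planned B A \<mu>' (w', c) (make_plan Ext (slice p q A))" for \<mu>'
        using g[of \<mu>'] ne len by simp
    qed (use L B2 Ext A(3) in auto)
  qed
  moreover have "length (plan_task (Ref a) w p q) + 2 = 8" by (simp add: plan_task_def)
  ultimately show ?case unfolding L_def[symmetric] plan_work.simps
    by (intro callI) (simp only: union_body_simps)
next
  case (Node ks ts)
  define L where "L = 60 * B * (h + e + 2)"
  define g where "g = h - 1"
  define xs where "xs = slice p q A"
  from Node.prems(2,3) have b: "0 < h" "1 \<le> length ks" "length ks \<le> B" "length ts = length ks + 1"
    "\<And>t. t \<in> set ts \<Longrightarrow> balanced B (B div 2) (h - 1) t" by auto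
  have h: "h = g + 1" using b(1) by (simp add: g_def)
  have LW: "L < W" using Node.prems(7) by (simp add: L_def)
  have LL: "L = 60 * B * (g + e + 2) + 60 * B" by (simp add: L_def h)
  have "60 * B * (e + 2) \<le> 60 * B * (g + e + 2)" "60 * B * (e + 1) \<le> 60 * B * (g + e + 2)"
    by (rule mult_le_mono2, simp)+
  then have LL2: "60 * B * (e + 2) + 60 * B \<le> L" "60 * B * (e + 1) + 60 * B \<le> L" using LL by linarith+
  have L60: "60 * B \<le> L" using LL by simp
  from Node.prems(1) obtain r ps p' where w: "w = Ref r" and m: "\<mu> (r, 0) = Some (map Key ks)"
    "\<mu> (r, 1) = Some ps" "\<mu> (r, 2) = Some [p']" and st: "list_all2 (stored \<mu>) (ps @ [p']) ts"
    by (auto elim: stored.cases)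
  have lps: "length (ps @ [p']) = length ts" using st by (rule list_all2_lengthD)
  have lp: "length ps = length ks" using lps b(4) by simp
  let ?K = "set (plan_task (Ref a) w p q)"
  let ?Q = "\<lambda>res \<mu>'. \<exists>w' c. res = [w', Num c] \<and> planned B A \<mu>' (w', c) (make_plan (Node ks ts) xs)"
  have sorted_ks: "sorted_wrt (<) ks" and sorted_ts: "\<And>t. t \<in> set ts \<Longrightarrow> sorted_wrt (<) (inorder t)"
    using Node.prems(4) sorted_mix_iff[of "map inorder ts" ks] b(4) by auto
  have sorted_xs: "sorted_wrt (<) xs" unfolding xs_def slice_def using A(1) by (intro sorted_wrt_drop sorted_wrt_take)
  have "run L \<mu> ?K 8 (plan_code B (Ref a) w p q) {} (plan_work (Node ks ts) xs) (10 * h) ?Q"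
  proof (cases "q \<le> p")
    case True
    then have "xs = []" using Node.prems(6) by (simp add: xs_def slice_def)
    then show ?thesis using True L60 LW B2 Node.prems(1)
      by (auto simp: plan_code_def plan_task_def intro!: run_Ret planned.keep elim: stored_mono)
  next
    case False
    define k where "k = q - p"
    define s where "s = stride k (length ks)"
    define N where "N = (k + s - 1) div s"
    have k: "1 \<le> k" "p + k = q" using False by (auto simp: k_def)
    have len: "length xs = k" unfolding xs_def k_def by (rule length_slice[OF Node.prems(6)])
    have ne: "xs \<noteq> []" using len k by auto
    have s: "1 \<le> s" "s \<le> k" unfolding s_def using stride_pos stride_le[OF k(1)] by auto
    have N: "N \<le> k" "0 < N" "(N - 1) * s < k"
    proof -
      show "0 < N" using mult_less_iff_less_ceiling[OF s(1), of 0 k] k by (simp add: N_def)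
      then show "(N - 1) * s < k" using mult_less_iff_less_ceiling[OF s(1), of "N - 1" k] by (simp add: N_def)
      then show "N \<le> k" using s(1) by (cases s) auto
    qed
    have kA: "k \<le> length A" "k \<le> 2 ^ e" "k < W" "q < W" "p < W" using k Node.prems(6) A(2,3) by linarith+
    define us where "us = map (\<lambda>y. length (filter (\<lambda>x. x < y) xs)) ks"
    define vs where "vs = map (\<lambda>y. length (filter (\<lambda>x. x \<le> y) xs)) ks"
    let ?n = "length ts"
    define W' where "W' = (\<Sum>i<?n. plan_work (ts ! i) (splits ks xs ! i))"
    define M where "M = ?K \<union> set (map Key ks) \<union> set ps \<union> set [p']"
    define lo where "lo = (\<lambda>i. if i = 0 then p else p + vs ! (i - 1))"
    define hi where "hi = (\<lambda>i. if i < length ks then p + us ! i else q)"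
    define task where "task = (\<lambda>i. plan_task (Ref a) ((ps @ [p']) ! i) (lo i) (hi i))"
    \<comment> \<open>Ranks refer to the interval \<open>xs\<close>, tasks to the whole array; a
      slice of a slice shifts the bounds by \<open>p\<close>.\<close>
    have lohi: "lo i \<le> length A" "hi i \<le> length A" "slice (lo i) (hi i) A = splits ks xs ! i" if "i < ?n" for i
    proof -
      have i: "i \<le> length ks" using that b(4) by simp
      have f: "length (filter P xs) \<le> q - p" for P using length_filter_le[of P xs] len by (simp add: k_def)
      have u: "us ! j = length (filter (\<lambda>x. x < ks ! j) xs)" "vs ! j = length (filter (\<lambda>x. x \<le> ks ! j) xs)"
        if "j < length ks" for j using that by (simp_all add: us_def vs_def)
      have "slice (lo i) (hi i) A = slice (p + (if i = 0 then 0 else vs ! (i - 1))) (p + (if i < length ks then us ! i else q - p)) A"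
        using False by (simp add: lo_def hi_def)
      also have "\<dots> = slice (if i = 0 then 0 else vs ! (i - 1)) (if i < length ks then us ! i else q - p) xs"
        unfolding xs_def by (rule slice_slice[symmetric]) (use u f xs_def in auto)
      also have "\<dots> = splits ks xs ! i"
        unfolding nth_splits_slice[OF sorted_ks sorted_xs i] using i u len
        by (intro arg_cong2[of _ _ _ _ "\<lambda>i j. slice i j xs"]) (auto simp: k_def)
      finally show "slice (lo i) (hi i) A = splits ks xs ! i" .
      have "vs ! (i - 1) \<le> q - p" if "i \<noteq> 0" using u(2)[of "i - 1"] f i that by simp
      then have "lo i \<le> q" using k False by (auto simp: lo_def k_def)
      moreover have "us ! i \<le> q - p" if "i < length ks" using u(1)[of i] f that by simp
      then have "hi i \<le> q" using k False by (auto simp: hi_def k_def)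
      ultimately show "lo i \<le> length A" "hi i \<le> length A" using Node.prems(6) by simp_all
    qed
    have desc_eq: "descend_code B (Ref a) (map Key ks) (ps @ [p']) p q us vs = par (map task [0..<?n])
       (\<lambda>rs. put_node (map Key ks) rs (\<lambda>r. Ret [Ref r, Num (groups B (\<Sum>x\<leftarrow>rs. max 1 (num (snd x))))]))"
      unfolding descend_code_def task_def lo_def hi_def lps by simp
    \<comment> \<open>Shared by the direct and the sampled case and so stated for any later memory
      and history. The node, the counts and the ranks occupy at most
      \<open>(2 * B + 15) + (2 * B + 2) + (3 * B + 1)\<close> words, that is
      \<open>7 * B + 18\<close>.\<close>
    have desc: "run L \<nu> K l (descend_code B (Ref a) (map Key ks) (ps @ [p']) p q us vs) {} (W' + (5 + 0)) (10 * g + (5 + 0)) ?Q"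
      if \<nu>: "\<mu> \<subseteq>\<^sub>m \<nu>" and K: "M \<subseteq> K" and l: "l \<le> 7 * B + 18" for \<nu> K l
      unfolding desc_eq W'_def
    proof (rule run_par[where L' = "60 * B * (g + e + 2)" and Y = "\<lambda>_. {}" and
          P = "\<lambda>i res \<mu>'. \<exists>w' c. res = [w', Num c] \<and> planned B A \<mu>' (w', c) (make_plan (ts ! i) (splits ks xs ! i))"])
      show "length (map task [0..<?n]) = ?n" by simp
      show "?n \<le> 2 * B" using b B2 by simp
      show "l + 60 * B * (g + e + 2) + 20 * B \<le> L" using l LL B2 by linarith
      show "L < W" by (rule LW)
      fix t assume "t \<in> set (map task [0..<?n])"
      then obtain i where i: "i < ?n" "t = task i" by auto
      have "lo i < W" "hi i < W" using lohi[OF i(1)] A(3) by linarith+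
      moreover have "(ps @ [p']) ! i \<in> set ps \<union> set [p']" using i(1) lps nth_mem[of i "ps @ [p']"] by simp
      moreover have "Ref a \<in> M" by (simp add: M_def plan_task_def)
      ultimately show "length t = 6 \<and> set t \<subseteq> K \<union> Num ` {..<W}"
        unfolding i(2) task_def using K LW by (auto simp: plan_task_def M_def)
    next
      fix i assume i: "i < ?n"
      have "call (60 * B * (g + e + 2)) \<nu> (task i) {} (plan_work (ts ! i) (slice (lo i) (hi i) A)) (10 * g)
        (\<lambda>res \<mu>'. \<exists>w' c. res = [w', Num c] \<and> planned B A \<mu>' (w', c) (make_plan (ts ! i) (slice (lo i) (hi i) A)))"
        unfolding task_def
      proof (rule Node.IH[of "ts ! i" \<nu> _ "B div 2" g])
        show "stored \<nu> ((ps @ [p']) ! i) (ts ! i)" using list_all2_nthD2[OF st i] \<nu> by (rule stored_mono)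
        show "array_at \<nu> a 0 A" using Node.prems(8) \<nu> by (rule array_at_mono)
        show "lo i \<le> length A" "hi i \<le> length A" by (rule lohi[OF i])+
      qed (use i b(5) B2 sorted_ts LW LL in \<open>auto simp: g_def\<close>)
      then show "call (60 * B * (g + e + 2)) \<nu> (map task [0..<?n] ! i) {} (plan_work (ts ! i) (splits ks xs ! i)) (10 * g)
        (\<lambda>res \<mu>'. \<exists>w' c. res = [w', Num c] \<and> planned B A \<mu>' (w', c) (make_plan (ts ! i) (splits ks xs ! i)))"
        using i lohi(3)[OF i] by simp
    next
      fix rs :: "('a word \<times> 'a word) list" and \<nu>'
      assume rs: "length rs = ?n" "\<nu> \<subseteq>\<^sub>m \<nu>'"
        "\<And>i \<nu>''. i < ?n \<Longrightarrow> \<nu>' \<subseteq>\<^sub>m \<nu>'' \<Longrightarrow> \<exists>w' c. [fst (rs ! i), snd (rs ! i)] = [w', Num c] \<and>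
          planned B A \<nu>'' (w', c) (make_plan (ts ! i) (splits ks xs ! i))"
      define ds where "ds = map (\<lambda>x. (fst x, num (snd x))) rs"
      define pl where "pl = map (\<lambda>(t, ys). make_plan t ys) (zip ts (splits ks xs))"
      have plan: "make_plan (Node ks ts) xs = PNode ks pl" using ne by (simp add: make_plan_Node pl_def)
      have ok: "plan_ok B (PNode ks pl)" using plan_ok_make_plan[OF Node.prems(2), of xs] plan by simp
      have lpl: "length pl = ?n" using b(4) by (simp add: pl_def)
      have npl: "pl ! i = make_plan (ts ! i) (splits ks xs ! i)" if "i < ?n" for i using that b(4) by (simp add: pl_def)
      have snd: "snd (rs ! i) = Num (num (snd (rs ! i)))" if "i < ?n" for i using rs(3)[OF that map_le_refl] by auto
      have ds: "map (\<lambda>(w, c). (w, Num c)) ds = rs"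
        using snd rs(1) by (intro nth_equalityI) (auto simp: ds_def prod_eq_iff)
      have pln: "list_all2 (planned B A \<nu>'') ds pl" if "\<nu>' \<subseteq>\<^sub>m \<nu>''" for \<nu>''
        unfolding list_all2_conv_all_nth
      proof (intro conjI allI impI)
        fix i assume "i < length ds"
        then have i: "i < ?n" by (simp add: ds_def rs(1))
        from rs(3)[OF i that] show "planned B A \<nu>'' (ds ! i) (pl ! i)" using i rs(1) npl[OF i] by (auto simp: ds_def)
      qed (simp add: ds_def rs(1) lpl)
      \<comment> \<open>Numbers from the children are the lengths of their unit lists, with 0 read
        as 1; stitching adds them up, and \<open>groups\<close> counts the nodes after
        regrouping.\<close>
      have cnt: "groups B (\<Sum>x\<leftarrow>rs. max 1 (num (snd x))) = length (units B (PNode ks pl))"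
      proof -
        have closed: "\<forall>p\<in>set pl. closed_units (units B p)" using ok closed_units_units by auto
        have st: "closed_units (stitch ks (map (units B) pl))" "length (stitch ks (map (units B) pl)) = (\<Sum>p\<leftarrow>pl. length (units B p))"
          using stitch_props[of "map (units B) pl" ks] closed ok by (simp_all add: comp_def)
        have "map (\<lambda>x. max 1 (num (snd x))) rs = map (\<lambda>p. length (units B p)) pl"
        proof (rule nth_equalityI)
          fix i assume "i < length (map (\<lambda>x. max 1 (num (snd x))) rs)"
          then have i: "i < ?n" by (simp add: rs(1))
          have "planned B A \<nu>' (ds ! i) (pl ! i)" using pln[OF map_le_refl] i by (auto simp: list_all2_conv_all_nth lpl)
          moreover have "plan_ok B (pl ! i)" using ok i lpl by simp
          ultimately have "max 1 (snd (ds ! i)) = length (units B (pl ! i))" by (rule planned_count)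
          then show "map (\<lambda>x. max 1 (num (snd x))) rs ! i = map (\<lambda>p. length (units B p)) pl ! i"
            using i rs(1) lpl by (simp add: ds_def)
        qed (simp add: rs(1) lpl)
        then show ?thesis using length_regroup[OF st(1), of B] st(2) by simp
      qed
      have cW: "length (units B (PNode ks pl)) < W"
      proof -
        have "gap_keys (PNode ks pl) \<le> k" using gap_keys_make_plan[OF Node.prems(2), of xs] unfolding plan len .
        then show ?thesis using units_count_weight[OF B2 ok, THEN conjunct1] kA A(3) by linarith
      qed
      have sndW: "snd ` set rs \<subseteq> Num ` {..<W}"
      proof
        fix x assume "x \<in> snd ` set rs"
        then obtain i where i: "i < ?n" "x = snd (rs ! i)" using rs(1) by (auto simp: in_set_conv_nth)
        have oki: "plan_ok B (pl ! i)" using ok i lpl by simp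
        have "planned B A \<nu>' (ds ! i) (pl ! i)" using pln[OF map_le_refl] i by (auto simp: list_all2_conv_all_nth lpl)
        then have "max 1 (snd (ds ! i)) = length (units B (pl ! i))" using oki by (rule planned_count)
        then have "num (snd (rs ! i)) \<le> length (units B (pl ! i))" using i rs(1) by (simp add: ds_def)
        also have "\<dots> \<le> gap_keys (pl ! i) + 1" using units_count_weight[OF B2 oki] by simp
        also have "gap_keys (pl ! i) \<le> length (splits ks xs ! i)"
          unfolding npl[OF i(1)] by (rule gap_keys_make_plan[OF b(5)]) (use i in simp)
        also have "\<dots> \<le> sum_list (map length (splits ks xs))"
          by (rule member_le_sum_list) (use i b(4) in simp_all)
        also have "\<dots> \<le> k" using sum_length_splits[of ks xs] len by simp
        finally have "num (snd (rs ! i)) < W" using kA A(3) by linarith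
        then show "x \<in> Num ` {..<W}" using snd[OF i(1)] i(2) by (metis imageI lessThan_iff)
      qed
      show "run L \<nu>' (K \<union> fst ` set rs \<union> snd ` set rs) (l + 4 * B + 3)
        (put_node (map Key ks) rs (\<lambda>r. Ret [Ref r, Num (groups B (\<Sum>x\<leftarrow>rs. max 1 (num (snd x))))])) ({} - (\<Union>i<?n. {})) (5 + 0) (5 + 0) ?Q"
        unfolding empty_Diff
      proof (rule run_put_node)
        fix r' \<nu>'' assume n: "\<nu>' \<subseteq>\<^sub>m \<nu>''" "node_at \<nu>'' r' (map Key ks) rs"
        show "run L \<nu>'' (insert (Ref r') (K \<union> fst ` set rs \<union> snd ` set rs)) (l + 4 * B + 3 + 8)
          (Ret [Ref r', Num (groups B (\<Sum>x\<leftarrow>rs. max 1 (num (snd x))))]) {} 0 0 ?Q"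
          unfolding cnt
        proof (rule run_Ret)
          fix \<nu>3 assume n3: "\<nu>'' \<subseteq>\<^sub>m \<nu>3"
          have "planned B A \<nu>3 (Ref r', length (units B (PNode ks pl))) (PNode ks pl)"
            using node_at_mono[OF n(2) n3] pln[OF map_le_trans[OF n(1) n3]] ds by (intro planned.node[of _ _ _ ds]) auto
          then show "?Q [Ref r', Num (length (units B (PNode ks pl)))] \<nu>3" unfolding plan by blast
        qed (use cW LL l B2 in \<open>auto simp del: units.simps\<close>)
      next
        show "set (map Key ks) \<subseteq> K \<union> fst ` set rs \<union> snd ` set rs \<union> Num ` {..<W}" using K by (auto simp: M_def)
        show "rs \<noteq> []" using rs(1) b(4) by auto
        show "snd ` set rs \<subseteq> K \<union> fst ` set rs \<union> snd ` set rs \<union> Num ` {..<W}" using sndW by blast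
      qed (use rs(1) b LL l LW B2 in auto)
    qed auto
    define c1 where "c1 = map (\<lambda>y. length (filter (\<lambda>x. x < y) (sample A p s N))) ks"
    define c2 where "c2 = map (\<lambda>y. length (filter (\<lambda>x. x \<le> y) (sample A p s N))) ks"
    have counts: "counts (sample A p s N) ks ks = c1 @ c2" by (simp add: counts_def c1_def c2_def)
    let ?b = "length ks"
    let ?rank = "\<lambda>c j. rank_args (Ref a) p k s (c ! j) (c ! (?b + j)) (map Key ks ! j)"
    have cont: "run L \<nu> K l (if s = 1 then descend_code B (Ref a) (map Key ks) (ps @ [p']) p q (take ?b (c1 @ c2)) (drop ?b (c1 @ c2))
            else Fk (map (?rank (c1 @ c2)) [0..<?b]) (\<lambda>rs'.
              descend_code B (Ref a) (map Key ks) (ps @ [p']) p q (map (\<lambda>r. num (r ! 0)) rs') (map (\<lambda>r. num (r ! 1)) rs')))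
            {} ((if s = 1 then 0 else 2 * ?b * (s - 1)) + (W' + (5 + 0))) (1 + (10 * g + (5 + 0))) ?Q"
      if \<nu>: "\<mu> \<subseteq>\<^sub>m \<nu>" and K: "M \<subseteq> K" and l: "l \<le> 4 * B + 17" for \<nu> K l
    proof (cases "s = 1")
      case True
      \<comment> \<open>At stride 1 the sample is the whole interval, so its counts are already the
        ranks.\<close>
      have "sample A p s N = xs"
        using sample_1[of p k A] k Node.prems(6) by (simp add: True N_def xs_def)
      then have "take ?b (c1 @ c2) = us" "drop ?b (c1 @ c2) = vs" by (simp_all add: c1_def c2_def us_def vs_def)
      then show ?thesis using True run_mono[OF desc[OF \<nu> K, of l]] l by simp
    next
      case False
      have c12: "(c1 @ c2) ! j = length (filter (\<lambda>x. x < ks ! j) (sample A p s N))"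
        "(c1 @ c2) ! (?b + j) = length (filter (\<lambda>x. x \<le> ks ! j) (sample A p s N))" if "j < ?b" for j
        using that by (simp_all add: c1_def c2_def nth_append)
      have cle: "length (filter P (sample A p s N)) < W" for P
        using length_filter_le[of P "sample A p s N"] N(1) kA by (simp add: sample_def)
      have "run L \<nu> K l (Fk (map (?rank (c1 @ c2)) [0..<?b]) (\<lambda>rs'.
              descend_code B (Ref a) (map Key ks) (ps @ [p']) p q (map (\<lambda>r. num (r ! 0)) rs') (map (\<lambda>r. num (r ! 1)) rs')))
            {} ((\<Sum>j<?b. 2 * (s - 1)) + (W' + (5 + 0))) (1 + (10 * g + (5 + 0))) ?Q"
      proof (rule run_Fk[where Y = "\<lambda>_. {}" and b = 2 and
            P = "\<lambda>j res \<mu>'. res = [Num (length (filter (\<lambda>x. x < ks ! j) xs)), Num (length (filter (\<lambda>x. x \<le> ks ! j) xs))]"], goal_cases)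
        case (3 x)
        then obtain j where j: "j < ?b" "x = ?rank (c1 @ c2) j" by auto
        show ?case unfolding j(2) c12[OF j(1)] using cle kA s K j(1) LW L60 B2
          by (auto simp: rank_args_def M_def plan_task_def)
      next
        case 4
        have "(\<Sum>a\<leftarrow>map (?rank (c1 @ c2)) [0..<?b]. length a + 2) = 10 * ?b"
          by (simp add: rank_args_def comp_def sum_list_triv)
        then show ?case using b(3) L60 by linarith
      next
        case (5 j)
        have "call (60 * B * (e + 2)) \<nu> (rank_args (Ref a) p k s ((c1 @ c2) ! j) ((c1 @ c2) ! (?b + j)) (Key (ks ! j))) {} (2 * (s - 1)) 1
            (\<lambda>res \<mu>'. res = [Num (length (filter (\<lambda>x. x < ks ! j) (slice p (p + k) A))), Num (length (filter (\<lambda>x. x \<le> ks ! j) (slice p (p + k) A)))])"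
        proof (rule call_rank[OF array_at_mono[OF Node.prems(8) \<nu>] A(1)])
          show "p + k \<le> length A" using k Node.prems(6) by simp
          show "60 * B * (e + 2) < W" using LL2 LW by linarith
        qed (use s kA A(3) c12[OF 5] in \<open>auto simp: N_def\<close>)
        then have "call (60 * B * (e + 2)) \<nu> (map (?rank (c1 @ c2)) [0..<?b] ! j) {} (2 * (s - 1)) 1
            (\<lambda>res \<mu>'. res = [Num (length (filter (\<lambda>x. x < ks ! j) xs)), Num (length (filter (\<lambda>x. x \<le> ks ! j) xs))])"
          using 5 k by (simp add: xs_def)
        then show ?case by (rule call_mono) (use LL2 l B2 in auto)
      next
        case 7
        have "?b * (2 + 1) \<le> 3 * B" using b(3) by simp
        then show ?case using l L60 B2 by linarith
      next
        case (13 rs \<nu>')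
        have "map (\<lambda>r. num (r ! 0)) rs = us" "map (\<lambda>r. num (r ! 1)) rs = vs"
          using 13(1) 13(3)[OF _ map_le_refl] by (auto intro!: nth_equalityI simp: us_def vs_def)
        moreover have "?b * (2 + 1) \<le> 3 * B" using b(3) by simp
        then have "l + 1 + ?b * (2 + 1) \<le> 7 * B + 18" using l by linarith
        ultimately show ?case using desc[OF map_le_trans[OF \<nu> 13(2)], of "K \<union> (\<Union>r\<in>set rs. set r)" "l + 1 + ?b * (2 + 1)"] K by auto
      qed (use b(3) LW L60 B2 in auto)
      then show ?thesis using False by (simp add: mult.commute mult.left_commute)
    qed
    have count: "run L \<mu> M (8 + length (map Key ks) + 2 + length ps + 2 + length [p'] + 2)
        (Fk [count_args (Ref a) p s N (map Key ks) (map Key ks)] (\<lambda>rs. let c = map num (rs ! 0) in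
            if s = 1 then descend_code B (Ref a) (map Key ks) (ps @ [p']) p q (take ?b c) (drop ?b c)
            else Fk (map (?rank c) [0..<?b]) (\<lambda>rs'.
              descend_code B (Ref a) (map Key ks) (ps @ [p']) p q (map (\<lambda>r. num (r ! 0)) rs') (map (\<lambda>r. num (r ! 1)) rs'))))
        {} (N + ((if s = 1 then 0 else 2 * ?b * (s - 1)) + (W' + (5 + 0)))) (1 + (1 + (10 * g + (5 + 0)))) ?Q"
    proof (rule run_call[where b = "2 * ?b" and Y = "{}" and P = "\<lambda>res \<mu>'. res = map Num (counts (sample A p s N) ks ks)"], goal_cases)
      case 1
      then show ?case using kA s N LW L60 B2 b(3) by (auto simp: count_args_def M_def plan_task_def)
    next
      case 4
      have "call (60 * B * (e + 1)) \<mu> (count_args (Ref a) p s N (map Key ks) (map Key ks)) {} N 1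
          (\<lambda>res \<mu>'. res = map Num (counts (sample A p s N) ks ks))"
        by (rule call_count[OF Node.prems(8)]) (use k N s kA b(3) LL2 LW A(3) Node.prems(6) in auto)
      then show ?case by (rule call_mono) (use LL2 lp b(3) B2 in auto)
    next
      case (10 res \<nu>)
      have res: "map num ([res] ! 0) = c1 @ c2" using 10(2)[OF map_le_refl] counts by (simp add: comp_def)
      have "8 + length (map Key ks) + 2 + length ps + 2 + length [p'] + 2 + 2 * ?b + 2 \<le> 4 * B + 17"
        using b(3) lp by simp
      from cont[OF 10(1) _ this, of "M \<union> set res"] show ?case unfolding res Let_def by simp
    qed (use b(3) lp LW L60 B2 in \<open>auto simp: count_args_def length_counts\<close>)
    have "run L \<mu> ?K 8 (plan_code B (Ref a) w p q) {}
      (Suc (Suc (Suc (N + ((if s = 1 then 0 else 2 * ?b * (s - 1)) + (W' + (5 + 0)))))))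
      (Suc (Suc (Suc (1 + (1 + (10 * g + (5 + 0))))))) ?Q"
    proof -
      have code: "plan_code B (Ref a) w p q = Ld r 0 (\<lambda>ks. Ld r 1 (\<lambda>ps. Ld r 2 (\<lambda>p'.
          let k = q - p; b = length ks; s = stride k b in
          Fk [count_args (Ref a) p s ((k + s - 1) div s) ks ks] (\<lambda>rs.
            let c = map num (rs ! 0) in
            if s = 1 then descend_code B (Ref a) ks (ps @ p') p q (take b c) (drop b c)
            else Fk (map (\<lambda>j. rank_args (Ref a) p k s (c ! j) (c ! (b + j)) (ks ! j)) [0..<b]) (\<lambda>rs'.
              descend_code B (Ref a) ks (ps @ p') p q (map (\<lambda>r. num (r ! 0)) rs') (map (\<lambda>r. num (r ! 1)) rs'))))))"
        using False w by (simp add: plan_code_def)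
      show ?thesis unfolding code
      proof (rule run_Ld[where blk = "map Key ks"], goal_cases)
        case 6
        show ?case
        proof (rule run_Ld[where blk = ps], goal_cases)
          case 6
          show ?case
          proof (rule run_Ld[where blk = "[p']"], goal_cases)
            case 6
            show ?case using count
              by (simp only: M_def Let_def length_map k_def[symmetric] s_def[symmetric] N_def[symmetric])
          qed (use m w b LW L60 B2 lp in \<open>auto simp: plan_task_def\<close>)
        qed (use m w b LW L60 B2 lp in \<open>auto simp: plan_task_def\<close>)
      qed (use m w b LW L60 B2 in \<open>auto simp: plan_task_def\<close>)
    qed
    then show ?thesis
    proof (rule run_mono)
      have "(\<Sum>(t, ys)\<leftarrow>zip ts (splits ks xs). plan_work t ys) = W'"
        unfolding W'_def using b(4) by (simp add: sum_list_sum_nth atLeast0LessThan)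
      then show "Suc (Suc (Suc (N + ((if s = 1 then 0 else 2 * ?b * (s - 1)) + (W' + (5 + 0)))))) \<le> plan_work (Node ks ts) xs"
        using ne by (simp add: plan_work_Node node_cost_def Let_def len s_def[symmetric] N_def)
    qed (simp_all add: h)
  qed
  moreover have "length (plan_task (Ref a) w p q) + 2 = 8" by (simp add: plan_task_def)
  ultimately show ?case unfolding L_def[symmetric] xs_def
    by (intro callI) (simp only: union_body_simps)
qed

end

section \<open>Building the result\<close>

text \<open>Bounds the recursion of the building pass and with it stack and span; kept subtrees are
  not entered, and each lift adds one.\<close>

fun plan_depth_le :: "nat \<Rightarrow> 'k plan \<Rightarrow> bool" where
  "plan_depth_le d (PNode ks ps) \<longleftrightarrow> 0 < d \<and> (\<forall>p\<in>set ps. plan_depth_le (d - 1) p)"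
| "plan_depth_le d p \<longleftrightarrow> True"

lemma plan_depth_make_plan: "balanced B lo h t \<Longrightarrow> plan_depth_le h (make_plan t xs)"
proof (induction t arbitrary: lo h xs)
  case (Node ks ts)
  show ?case
  proof (cases "xs = []")
    case False
    have "plan_depth_le (h - 1) (make_plan t ys)" if "(t, ys) \<in> set (zip ts (splits ks xs))" for t ys
      using Node.IH[OF set_zip_leftD[OF that]] Node.prems set_zip_leftD[OF that] by auto
    then show ?thesis using False Node.prems by (auto simp: make_plan_Node)
  qed simp
qed simp

text \<open>A slot and a unit agree in tree and work with the unit of the child plan. The separator
  is taken from the slot if it has one, and from the child's unit otherwise.\<close>

definition slot_for :: "nat \<Rightarrow> ('k word \<times> nat \<Rightarrow> 'k plan \<Rightarrow> bool) \<Rightarrow> 'k word \<times> 'k word \<times> nat \<times> 'k word option \<Rightarrow> 'k tunit \<Rightarrow> bool" where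
  "slot_for B G s u \<longleftrightarrow> (\<exists>w c i so p. s = (w, Num c, i, so) \<and> G (w, c) p \<and> i < length (units B p) \<and>
     fst u = fst (units B p ! i) \<and> snd (snd u) = snd (snd (units B p ! i)) \<and>
     opt_word (fst (snd u)) = (case so of None \<Rightarrow> opt_word (fst (snd (units B p ! i))) | Some k \<Rightarrow> k))"

lemma slots_stitch:
  assumes "list_all2 G ds ps" "\<And>d p. G d p \<Longrightarrow> max 1 (snd d) = length (units B p)" "length ds = length ks + 1"
  shows "list_all2 (slot_for B G) (slots (map Key ks) (map (\<lambda>(w, c). (w, Num c)) ds)) (stitch ks (map (units B) ps))"
  using assms(1,3)
proof (induction ks arbitrary: ds ps)
  case Nil
  then obtain w c p where d: "ds = [(w, c)]" "ps = [p]" "G (w, c) p"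
    by (cases ds; cases ps) (auto simp: list_all2_Cons1)
  have n: "max 1 c = length (units B p)" using assms(2)[OF d(3)] by simp
  show ?case unfolding d list.map slots.simps stitch.simps prod.case num.simps n
    using d(3) by (force simp: list_all2_conv_all_nth slot_for_def)
next
  case (Cons k ks)
  then obtain w c ds' p ps' where d: "ds = (w, c) # ds'" "ps = p # ps'" "G (w, c) p" "list_all2 G ds' ps'" "length ds' = length ks + 1"
    by (cases ds; cases ps) auto
  define us where "us = units B p"
  have n: "max 1 c = length us" using assms(2)[OF d(3)] by (simp add: us_def)
  then have ne: "us \<noteq> []" by (cases us) auto
  have 1: "list_all2 (slot_for B G) (map (\<lambda>i. (w, Num c, i, if i + 1 = length us then Some (Key k) else None)) [0..<length us])
     (butlast us @ [(fst (last us), Some k, snd (snd (last us)))])"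
    unfolding list_all2_conv_all_nth
  proof (intro conjI allI impI)
    fix j assume "j < length (map (\<lambda>i. (w, Num c, i, if i + 1 = length us then Some (Key k) else None)) [0..<length us])"
    then have j: "j < length us" by simp
    show "slot_for B G (map (\<lambda>i. (w, Num c, i, if i + 1 = length us then Some (Key k) else None)) [0..<length us] ! j)
      ((butlast us @ [(fst (last us), Some k, snd (snd (last us)))]) ! j)"
    proof (cases "j + 1 = length us")
      case True
      then have "j = length us - 1" by simp
      then have "last us = us ! j" using ne by (simp add: last_conv_nth)
      moreover have "(butlast us @ [(fst (last us), Some k, snd (snd (last us)))]) ! j = (fst (last us), Some k, snd (snd (last us)))"
        using \<open>j = length us - 1\<close> by (simp add: nth_append)
      ultimately show ?thesis using d(3) j True unfolding slot_for_def us_def by (auto simp: opt_word_def)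
    next
      case False
      then have "j < length us - 1" using j by simp
      then have "(butlast us @ [(fst (last us), Some k, snd (snd (last us)))]) ! j = us ! j"
        by (simp add: nth_append nth_butlast)
      then show ?thesis using d(3) j False unfolding slot_for_def us_def by auto
    qed
  qed (use ne in simp)
  have "slots (map Key (k # ks)) (map (\<lambda>(w, c). (w, Num c)) ds) =
      map (\<lambda>i. (w, Num c, i, if i + 1 = length us then Some (Key k) else None)) [0..<length us] @
      slots (map Key ks) (map (\<lambda>(w, c). (w, Num c)) ds')"
    using n by (simp add: d(1))
  moreover have "stitch (k # ks) (map (units B) ps) = (butlast us @ [(fst (last us), Some k, snd (snd (last us)))]) @ stitch ks (map (units B) ps')"
    by (simp add: d(2) us_def)
  ultimately show ?case using list_all2_appendI[OF 1 Cons.IH[OF d(4,5)]] by simp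
qed

lemma slots_set: "(w, c, i, so) \<in> set (slots ks cs) \<Longrightarrow> (w, c) \<in> set cs \<and> (\<forall>k. so = Some k \<longrightarrow> k \<in> set ks)"
  by (induction ks cs rule: slots.induct) (auto split: if_splits)

context union_machine begin

text \<open>The work recorded in a unit is what building it costs, so the amortized bound on
  \<open>weight\<close> applies to the program. Per level there are five loads and three stores; the
  extra 1 in the span is the read of a separator from the array.\<close>

lemma call_build:
  assumes "planned B A \<mu> (w, c) p" "plan_ok B p" "plan_depth_le d p" "i < length (units B p)"
    "array_at \<mu> a 0 A" "length A + 2 < W" "gap_keys p + 2 < W" "60 * B * (d + 1) < W"
  shows "call (60 * B * (d + 1)) \<mu> (build_task (Ref a) w (Num c) i) {} (snd (snd (units B p ! i))) (8 * d + 1)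
    (\<lambda>res \<mu>'. \<exists>w'. res = [w', opt_word (fst (snd (units B p ! i)))] \<and> stored \<mu>' w' (fst (units B p ! i)))"
  using assms(1-5,7,8)
proof (induction p arbitrary: \<mu> w c d i rule: plan.induct)
  case (Keep t)
  then have c: "c = 0" "stored \<mu> w t" by (auto elim: planned.cases)
  have "60 * B \<le> 60 * B * (d + 1)" by simp
  then show ?case using Keep B2 c
    by (intro callI, unfold union_body_simps build_code_def)
      (auto simp: build_task_def opt_word_def intro!: run_Ret elim: stored_mono)
next
  case (Gap xs)
  then obtain p where w: "w = Num p" "c = length xs + 1" "p + length xs \<le> length A" "xs = slice p (p + length xs) A"
    by (auto elim: planned.cases)
  define L where "L = 60 * B * (d + 1)"
  have L: "60 * B \<le> L" "L < W" using Gap(7) by (simp_all add: L_def)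
  have "run L \<mu> (set (build_task (Ref a) w (Num c) i)) 8 (build_code B (Ref a) w c i) {} (snd (snd (units B (Gap xs) ! i))) (8 * d + 1)
    (\<lambda>res \<mu>'. \<exists>w'. res = [w', opt_word (fst (snd (units B (Gap xs) ! i)))] \<and> stored \<mu>' w' (fst (units B (Gap xs) ! i)))"
  proof (cases "i < length xs")
    case True
    have x: "xs ! i = A ! (p + i)" using w(3) True by (subst w(4)) (simp add: nth_slice)
    have u: "units B (Gap xs) ! i = (Ext, Some (A ! (p + i)), 1)" using True x by (simp add: nth_append)
    have "run L \<mu> (set (build_task (Ref a) w (Num c) i)) 8 (Ld a (p + i) (\<lambda>x. Ret [Num 0, hd x])) {} (Suc 0) (Suc (8 * d))
      (\<lambda>res \<mu>'. \<exists>w'. res = [w', opt_word (Some (A ! (p + i)))] \<and> stored \<mu>' w' Ext)"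
    proof (rule run_Ld[where blk = "[Key (A ! (p + i))]"])
      show "\<mu> (a, p + i) = Some [Key (A ! (p + i))]" using Gap(5) w(3) True by (simp add: array_at_def)
      show "run L \<mu> (set (build_task (Ref a) w (Num c) i) \<union> set [Key (A ! (p + i))]) (8 + length [Key (A ! (p + i))] + 2)
        (Ret [Num 0, hd [Key (A ! (p + i))]]) {} 0 (8 * d) (\<lambda>res \<mu>'. \<exists>w'. res = [w', opt_word (Some (A ! (p + i)))] \<and> stored \<mu>' w' Ext)"
        using L B2 by (intro run_Ret) (auto simp: opt_word_def intro: stored.ext)
    qed (use L B2 w True assms(6) in \<open>auto simp: build_task_def\<close>)
    then show ?thesis unfolding u using w True by (simp add: build_code_def)
  next
    case False
    then have i: "i = length xs" using Gap(4) by simp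
    have u: "units B (Gap xs) ! i = (Ext, None, 0)" by (simp add: i nth_append)
    show ?thesis unfolding u using w i L B2
      by (auto simp: build_code_def opt_word_def intro!: run_Ret stored.ext)
  qed
  moreover have "length (build_task (Ref a) w (Num c) i) + 2 = 8" by (simp add: build_task_def)
  ultimately show ?case unfolding L_def[symmetric]
    by (intro callI) (simp only: union_body_simps)
next
  case (PNode ks ps)
  from PNode.prems(1) obtain r ds where w: "w = Ref r" and n: "node_at \<mu> r (map Key ks) (map (\<lambda>(w, c). (w, Num c)) ds)"
    and pl: "list_all2 (planned B A \<mu>) ds ps" and c: "c = length (units B (PNode ks ps))"
    by (auto elim: planned.cases)
  have ok: "length ks \<le> B" "length ps = length ks + 1" "\<And>p. p \<in> set ps \<Longrightarrow> plan_ok B p" using PNode.prems(2) by auto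
  have d: "0 < d" "\<And>p. p \<in> set ps \<Longrightarrow> plan_depth_le (d - 1) p" using PNode.prems(3) by auto
  define L where "L = 60 * B * (d + 1)"
  define g where "g = d - 1"
  have dg: "d = g + 1" using d(1) by (simp add: g_def)
  have LW: "L < W" using PNode.prems(7) by (simp add: L_def)
  have LL: "L = 60 * B * (g + 1) + 60 * B" by (simp add: L_def dg)
  have L60: "60 * B \<le> L" using LL by simp
  define cs :: "('a word \<times> 'a word) list" where "cs = map (\<lambda>(w, c). (w, Num c)) ds"
  have lds: "length ds = length ks + 1" using list_all2_lengthD[OF pl] ok(2) by simp
  define G where "G = (\<lambda>d p. planned B A \<mu> d p \<and> p \<in> set ps)"
  have G: "list_all2 G ds ps" using pl by (auto simp: G_def list_all2_conv_all_nth)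
  have Gn: "max 1 (snd d) = length (units B p)" if "G d p" for d p
    using planned_count[of B A \<mu> d p] that ok(3) by (simp add: G_def)
  have Glen: "length (units B p) < W" if "p \<in> set ps" for p
  proof -
    have "gap_keys p \<le> sum_list (map gap_keys ps)" by (rule member_le_sum_list) (use that in simp_all)
    then show ?thesis using units_count_weight[OF B2 ok(3)[OF that]] PNode.prems(6) by simp
  qed
  define us where "us = stitch ks (map (units B) ps)"
  define ss where "ss = slots (map Key ks) cs"
  have su: "list_all2 (slot_for B G) ss us" unfolding ss_def us_def cs_def by (rule slots_stitch[OF G Gn lds])
  have lsu: "length ss = length us" using su by (rule list_all2_lengthD)
  have closed: "closed_units us"
    using stitch_props[of "map (units B) ps" ks] ok(2,3) closed_units_units unfolding us_def by auto
  have un: "units B (PNode ks ps) = regroup B us" by (simp add: us_def)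
  have i: "i < groups B (length us)" using PNode.prems(4) unfolding un length_regroup[OF closed] .
  have C: "0 < length us" using closed by (simp add: closed_units_def)
  define lo hi where "lo = cut B (length us) i" and "hi = cut B (length us) (Suc i)"
  have lohi: "lo < hi" "hi \<le> length us" "hi \<le> lo + (B + 1)"
    using cut_strict[OF C] cut_le[OF C, of "Suc i" B] cut_step(2)[OF C, of B i] i by (simp_all add: lo_def hi_def)
  define sub where "sub = slice lo hi ss"
  define grp where "grp = slice lo hi us"
  have sg: "list_all2 (slot_for B G) sub grp" unfolding sub_def grp_def using su by (rule list_all2_slice)
  let ?n = "length grp"
  have lgrp: "?n = hi - lo" "length sub = ?n"
    using length_slice[OF lohi(2), of lo] list_all2_lengthD[OF sg] by (simp_all add: grp_def)
  have n1: "0 < ?n" "?n \<le> B + 1" using lgrp lohi by simp_all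
  have sep: "separated grp" unfolding grp_def using closed lohi(2) by (intro separated_slice) (auto simp: closed_units_def)
  have u: "units B (PNode ks ps) ! i = join_units grp"
    using i unfolding un by (simp add: regroup_def grp_def lo_def hi_def)
  have slot: "slot_for B G (sub ! j) (grp ! j)" if "j < ?n" for j using list_all2_nthD2[OF sg that] .
  have slot_in: "sub ! j \<in> set ss" if "j < ?n" for j
  proof -
    have "sub ! j \<in> set sub" using that lgrp by simp
    then show ?thesis using set_slice_subset unfolding sub_def by fast
  qed
  let ?K = "set (build_task (Ref a) w (Num c) i)"
  let ?Q = "\<lambda>res \<mu>'. \<exists>w'. res = [w', opt_word (fst (snd (join_units grp)))] \<and> stored \<mu>' w' (fst (join_units grp))"
  define M where "M = ?K \<union> set (map Key ks) \<union> fst ` set cs \<union> snd ` set cs"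
  define fin where "fin = (\<lambda>vs :: ('a word \<times> 'a word) list. Al (\<lambda>r. St r 0 (map snd (butlast vs)) (St r 1 (map fst (butlast vs)) (St r 2 [fst (last vs)]
            (Ret [Ref r, snd (last vs)])))))"
  have fin: "run L \<nu> K l (fin vs) {} 3 3 ?Q"
    if vs: "length vs = ?n" "\<And>j \<nu>'. j < ?n \<Longrightarrow> \<nu> \<subseteq>\<^sub>m \<nu>' \<Longrightarrow> stored \<nu>' (fst (vs ! j)) (fst (grp ! j))"
      "\<And>j. j < ?n \<Longrightarrow> snd (vs ! j) = opt_word (fst (snd (grp ! j)))"
      and K: "fst ` set vs \<subseteq> K \<union> Num ` {..<W}" "snd ` set vs \<subseteq> K \<union> Num ` {..<W}" and l: "l + 10 \<le> L"
    for \<nu> K l vs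
  proof -
    have ne: "vs \<noteq> []" "grp \<noteq> []" using vs(1) n1 by auto
    have lst: "last vs = vs ! (?n - 1)" "last grp = grp ! (?n - 1)" using ne vs(1) by (simp_all add: last_conv_nth)
    have bl: "set (butlast vs) \<subseteq> set vs" by (meson in_set_butlastD subsetI)
    have bl1: "fst ` set (butlast vs) \<subseteq> K \<union> Num ` {..<W}" "snd ` set (butlast vs) \<subseteq> K \<union> Num ` {..<W}"
      using K image_mono[OF bl] by (meson order_trans)+
    have l1: "fst (last vs) \<in> K \<union> Num ` {..<W}" "snd (last vs) \<in> K \<union> Num ` {..<W}"
      using K last_in_set[OF ne(1)] by (meson imageI subsetD)+
    have lb: "length (butlast vs) \<le> B" using vs(1) n1 by simp
    \<comment> \<open>Only the last unit of a group may lack a separator, and that one is returned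
      instead of being stored.\<close>
    have keys: "map snd (butlast vs) = map Key (map (the \<circ> fst \<circ> snd) (butlast grp))"
    proof (rule nth_equalityI)
      fix j assume "j < length (map snd (butlast vs))"
      then have j: "j + 1 < ?n" using vs(1) by simp
      then have "fst (snd (grp ! j)) \<noteq> None" using sep by (simp add: separated_def)
      then show "map snd (butlast vs) ! j = map Key (map (the \<circ> fst \<circ> snd) (butlast grp)) ! j"
        using j vs(1) vs(3)[of j] by (auto simp: nth_butlast opt_word_def)
    qed (simp add: vs(1))
    have B0: "1 \<le> B" using B2 by simp
    have "run L \<nu> K l (fin vs) {} (Suc (Suc (Suc 0))) (Suc (Suc (Suc 0))) ?Q"
      unfolding fin_def
    proof (rule run_Al)
      fix r
      let ?m0 = "\<nu>((r, 0) \<mapsto> map snd (butlast vs))"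
      let ?m1 = "?m0((r, 1) \<mapsto> map fst (butlast vs))"
      let ?m2 = "?m1((r, 2) \<mapsto> [fst (last vs)])"
      show "run L \<nu> (insert (Ref r) K) (l + 3) (St r 0 (map snd (butlast vs)) (St r 1 (map fst (butlast vs)) (St r 2 [fst (last vs)]
            (Ret [Ref r, snd (last vs)])))) ({} \<union> {r} \<times> UNIV) (Suc (Suc (Suc 0))) (Suc (Suc (Suc 0))) ?Q"
      proof ((rule run_St[rotated -1]), goal_cases)
        case 1
        note f0 = 1
        show ?case
        proof ((rule run_St[rotated -1]), goal_cases)
          case 1
          note f1 = 1
          show ?case
          proof ((rule run_St[rotated -1]), goal_cases)
            case 1
            have m: "\<nu> \<subseteq>\<^sub>m ?m2" using f0 f1 1 by (intro map_le_upd) auto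
            show ?case
            proof (rule run_Ret)
              fix \<nu>' assume n': "?m2 \<subseteq>\<^sub>m \<nu>'"
              have "\<nu>' (r, 0) = Some (map snd (butlast vs))" "\<nu>' (r, 1) = Some (map fst (butlast vs))" "\<nu>' (r, 2) = Some [fst (last vs)]"
                by (rule map_leD[OF n'], simp)+
              moreover have "list_all2 (stored \<nu>') (map fst (butlast vs) @ [fst (last vs)]) (map fst grp)"
              proof -
                have "map fst (butlast vs) @ [fst (last vs)] = map fst vs"
                  using ne(1) by (metis append_butlast_last_id list.map(1,2) map_append)
                then show ?thesis using vs(1) vs(2)[OF _ map_le_trans[OF m n']] by (simp add: list_all2_conv_all_nth)
              qed
              ultimately have "stored \<nu>' (Ref r) (fst (join_units grp))"
                unfolding keys join_units_def fst_conv by (intro stored.node)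
              moreover have "snd (last vs) = opt_word (fst (snd (join_units grp)))"
                using lst vs(3)[of "?n - 1"] n1 by (simp add: join_units_def)
              ultimately show "?Q [Ref r, snd (last vs)] \<nu>'" by simp
            qed (use l1 l in auto)
          qed (use bl1 l1 lb l L60 LW B0 in auto)
        qed (use bl1 l1 lb l L60 LW B0 in auto)
      qed (use bl1 l1 lb l L60 LW B0 in auto)
    qed (use l LW in auto)
    then show ?thesis by (simp add: numeral_eq_Suc)
  qed
  define tasks where "tasks = map (\<lambda>(w, c, i, _). build_task (Ref a) w c i) sub"
  have par: "run L \<mu> M (8 + 9 * B) (par tasks (\<lambda>rs. fin (map2 (\<lambda>(_, _, _, s) (p, s'). (p, case s of None \<Rightarrow> s' | Some k \<Rightarrow> k)) sub rs)))
      {} ((\<Sum>j<?n. snd (snd (grp ! j))) + 3) ((8 * g + 1) + 3) ?Q"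
  \<comment> \<open>If the slot supplies the separator, the word returned by the child is ignored;
    \<open>res ! 1\<close> in that case makes the condition on it trivial.\<close>
  proof (rule run_par[where L' = "60 * B * (g + 1)" and Y = "\<lambda>_. {}" and
        P = "\<lambda>j res \<mu>'. \<exists>w'. res = [w', (case snd (snd (snd (sub ! j))) of None \<Rightarrow> opt_word (fst (snd (grp ! j))) | Some _ \<Rightarrow> res ! 1)] \<and> stored \<mu>' w' (fst (grp ! j))"])
    show "length tasks = ?n" by (simp add: tasks_def lgrp(2))
    show "?n \<le> 2 * B" using n1 B2 by simp
    show "8 + 9 * B + 60 * B * (g + 1) + 20 * B \<le> L" using LL B2 by linarith
    show "L < W" by (rule LW)
    fix t assume "t \<in> set tasks"
    then obtain j where j: "j < ?n" "t = (\<lambda>(w, c, i, _). build_task (Ref a) w c i) (sub ! j)"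
      unfolding tasks_def using lgrp(2) by (auto simp: in_set_conv_nth)
    from slot[OF j(1)] obtain w' c' i' so p where s: "sub ! j = (w', Num c', i', so)" "G (w', c') p" "i' < length (units B p)"
      unfolding slot_for_def by blast
    have "(w', Num c') \<in> set cs" using slots_set slot_in[OF j(1)] unfolding s(1) ss_def by fast
    then have "w' \<in> M" "Num c' \<in> M" unfolding M_def by force+
    moreover have "i' < W" using s(2,3) Glen by (fastforce simp: G_def)
    moreover have "Ref a \<in> M" by (simp add: M_def build_task_def)
    ultimately show "length t = 6 \<and> set t \<subseteq> M \<union> Num ` {..<W}" using LW L60 B2 by (auto simp: j(2) s(1) build_task_def)
  next
    fix j assume j: "j < ?n"
    from slot[OF j] obtain w' c' i' so p where s: "sub ! j = (w', Num c', i', so)" "G (w', c') p" "i' < length (units B p)"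
      "fst (grp ! j) = fst (units B p ! i')" "snd (snd (grp ! j)) = snd (snd (units B p ! i'))"
      "opt_word (fst (snd (grp ! j))) = (case so of None \<Rightarrow> opt_word (fst (snd (units B p ! i'))) | Some k \<Rightarrow> k)"
      unfolding slot_for_def by blast
    have p: "p \<in> set ps" "planned B A \<mu> (w', c') p" using s(2) by (simp_all add: G_def)
    have gp: "gap_keys p + 2 < W"
    proof -
      have "gap_keys p \<le> sum_list (map gap_keys ps)" by (rule member_le_sum_list) (use p(1) in simp_all)
      then show ?thesis using PNode.prems(6) by simp
    qed
    have "call (60 * B * (g + 1)) \<mu> (build_task (Ref a) w' (Num c') i') {} (snd (snd (units B p ! i'))) (8 * g + 1)
      (\<lambda>res \<mu>'. \<exists>w'. res = [w', opt_word (fst (snd (units B p ! i')))] \<and> stored \<mu>' w' (fst (units B p ! i')))"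
      by (rule PNode.IH[OF p(1) p(2) ok(3)[OF p(1)] _ s(3) PNode.prems(5) gp])
        (use d(2)[OF p(1)] LW LL in \<open>simp_all add: g_def\<close>)
    moreover have "tasks ! j = build_task (Ref a) w' (Num c') i'" using j s(1) lgrp(2) by (simp add: tasks_def)
    ultimately show "call (60 * B * (g + 1)) \<mu> (tasks ! j) {} (snd (snd (grp ! j))) (8 * g + 1)
      (\<lambda>res \<mu>'. \<exists>w'. res = [w', (case snd (snd (snd (sub ! j))) of None \<Rightarrow> opt_word (fst (snd (grp ! j))) | Some _ \<Rightarrow> res ! 1)] \<and> stored \<mu>' w' (fst (grp ! j)))"
      using s by (auto elim!: call_mono split: option.splits)
    show "length res = 2" if "\<exists>w'. res = [w', (case snd (snd (snd (sub ! j))) of None \<Rightarrow> opt_word (fst (snd (grp ! j)))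
        | Some _ \<Rightarrow> res ! 1)] \<and> stored \<mu>' w' (fst (grp ! j))" for res \<mu>'
    proof -
      from that obtain w' x where "res = [w', x]" by blast
      then show ?thesis by simp
    qed
  next
    fix rs :: "('a word \<times> 'a word) list" and \<nu>
    assume rs: "length rs = ?n" "\<mu> \<subseteq>\<^sub>m \<nu>"
      "\<And>j \<nu>'. j < ?n \<Longrightarrow> \<nu> \<subseteq>\<^sub>m \<nu>' \<Longrightarrow> \<exists>w'. [fst (rs ! j), snd (rs ! j)] =
         [w', (case snd (snd (snd (sub ! j))) of None \<Rightarrow> opt_word (fst (snd (grp ! j))) | Some _ \<Rightarrow> [fst (rs ! j), snd (rs ! j)] ! 1)] \<and>
         stored \<nu>' w' (fst (grp ! j))"
    define vs where "vs = map2 (\<lambda>(_, _, _, s) (p, s'). (p, case s of None \<Rightarrow> s' | Some k \<Rightarrow> k)) sub rs"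
    have lvs: "length vs = ?n" by (simp add: vs_def rs(1) lgrp(2))
    have vsj: "fst (vs ! j) = fst (rs ! j)" "snd (vs ! j) = (case snd (snd (snd (sub ! j))) of None \<Rightarrow> snd (rs ! j) | Some k \<Rightarrow> k)"
      if "j < ?n" for j using that rs(1) lgrp(2) by (auto simp: vs_def case_prod_unfold split: option.split)
    have seps: "snd (vs ! j) = opt_word (fst (snd (grp ! j)))" if j: "j < ?n" for j
    proof -
      from slot[OF j] obtain w' c' i' so p where s: "sub ! j = (w', Num c', i', so)"
        "opt_word (fst (snd (grp ! j))) = (case so of None \<Rightarrow> opt_word (fst (snd (units B p ! i'))) | Some k \<Rightarrow> k)"
        unfolding slot_for_def by blast
      show ?thesis using rs(3)[OF j map_le_refl] vsj(2)[OF j] s by (cases so) auto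
    qed
    have st: "stored \<nu>' (fst (vs ! j)) (fst (grp ! j))" if "j < ?n" "\<nu> \<subseteq>\<^sub>m \<nu>'" for j \<nu>'
      using rs(3)[OF that] vsj(1)[OF that(1)] by auto
    have in1: "fst ` set vs \<subseteq> fst ` set rs"
    proof -
      have "map fst vs = map fst rs" using lvs rs(1) vsj(1) by (intro nth_equalityI) simp_all
      then show ?thesis by (metis list.set_map subset_refl)
    qed
    have in2: "snd ` set vs \<subseteq> snd ` set rs \<union> set (map Key ks)"
    proof
      fix x assume "x \<in> snd ` set vs"
      then obtain j where j: "j < ?n" "x = snd (vs ! j)" using lvs by (auto simp: in_set_conv_nth)
      show "x \<in> snd ` set rs \<union> set (map Key ks)"
      proof (cases "snd (snd (snd (sub ! j)))")
        case None
        then show ?thesis using j vsj(2)[OF j(1)] rs(1) by simp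
      next
        case (Some k)
        obtain w' c' i' so where s: "sub ! j = (w', c', i', so)" by (metis prod_cases4)
        have "k \<in> set (map Key ks)" using slots_set[of w' c' i' so "map Key ks" cs] slot_in[OF j(1)] Some unfolding s ss_def by auto
        then show ?thesis using j vsj(2)[OF j(1)] Some by simp
      qed
    qed
    have "run L \<nu> (M \<union> fst ` set rs \<union> snd ` set rs) (8 + 9 * B + 4 * B + 3) (fin vs) {} 3 3 ?Q"
      by (rule fin[OF lvs st seps]) (use in1 in2 L60 B2 in \<open>auto simp: M_def\<close>)
    then show "run L \<nu> (M \<union> fst ` set rs \<union> snd ` set rs) (8 + 9 * B + 4 * B + 3)
      (fin (map2 (\<lambda>(_, _, _, s) (p, s'). (p, case s of None \<Rightarrow> s' | Some k \<Rightarrow> k)) sub rs)) ({} - (\<Union>i<?n. {})) 3 3 ?Q"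
      unfolding vs_def empty_Diff .
  qed auto
  have "c \<noteq> 0" using c PNode.prems(4) by linarith
  then have code: "build_code B (Ref a) w c i = get_node r (\<lambda>ks cs.
        let ss = slots ks cs; sub = slice (cut B (length ss) i) (cut B (length ss) (Suc i)) ss in
        par (map (\<lambda>(w, c, i, _). build_task (Ref a) w c i) sub) (\<lambda>rs.
          let us = map2 (\<lambda>(_, _, _, s) (p, s'). (p, case s of None \<Rightarrow> s' | Some k \<Rightarrow> k)) sub rs in fin us))"
    by (simp add: build_code_def w fin_def)
  have "run L \<mu> ?K 8 (build_code B (Ref a) w c i) {} (5 + ((\<Sum>j<?n. snd (snd (grp ! j))) + 3)) (5 + ((8 * g + 1) + 3)) ?Q"
    unfolding code
  proof (rule run_get_node)
    show "node_at \<mu> r (map Key ks) cs" using n by (simp add: cs_def)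
    show "run L \<mu> (?K \<union> set (map Key ks) \<union> fst ` set cs \<union> snd ` set cs) (8 + 9 * B)
      (let ss = slots (map Key ks) cs; sub = slice (cut B (length ss) i) (cut B (length ss) (Suc i)) ss in
        par (map (\<lambda>(w, c, i, _). build_task (Ref a) w c i) sub) (\<lambda>rs.
          let us = map2 (\<lambda>(_, _, _, s) (p, s'). (p, case s of None \<Rightarrow> s' | Some k \<Rightarrow> k)) sub rs in fin us))
      {} ((\<Sum>j<?n. snd (snd (grp ! j))) + 3) ((8 * g + 1) + 3) ?Q"
      using par by (simp only: Let_def M_def tasks_def sub_def lo_def hi_def lsu ss_def[symmetric])
  qed (use w ok(1) lds LW L60 B2 in \<open>auto simp: cs_def build_task_def\<close>)
  then have "run L \<mu> ?K 8 (build_code B (Ref a) w c i) {} (snd (snd (join_units grp))) (8 * d + 1) ?Q"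
    by (rule run_mono) (simp_all add: join_units_def weight_def sum_list_sum_nth atLeast0LessThan dg)
  moreover have "length (build_task (Ref a) w (Num c) i) + 2 = 8" by (simp add: build_task_def)
  ultimately show ?case unfolding L_def[symmetric] u
    by (intro callI) (simp only: union_body_simps)
qed

text \<open>A new level costs five stores and deepens the plan by one. It takes one stack frame for
  the recursive call and one for the longer building pass, and adds \<open>5 + 8\<close> to the
  span. The induction is on \<open>c\<close>, which at least halves.\<close>

lemma call_lift:
  assumes "planned B A \<mu> (w, c) p" "fit_plan B h zs p" "plan_depth_le d p" "length (units B p) = max 1 c"
    "array_at \<mu> a 0 A" "length A + 2 < W" "gap_keys p + 2 < W" "60 * B * (d + 2 * levels B c + 2) < W"
  shows "call (60 * B * (d + 2 * levels B c + 2)) \<mu> (lift_args (Ref a) w c) {}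
    (weight (units B p) + 8 * length (units B p) + 5 * levels B c) (13 * levels B c + 8 * d + 1)
    (\<lambda>res \<mu>'. \<exists>w' t h'. res = [w'] \<and> stored \<mu>' w' t \<and> balanced B 1 h' t \<and> inorder t = zs)"
  using assms(1-5,7,8)
proof (induction c arbitrary: \<mu> w p h d rule: less_induct)
  case (less c)
  define L where "L = 60 * B * (d + 2 * levels B c + 2)"
  have LW: "L < W" using less.prems(7) by (simp add: L_def)
  have ok: "plan_ok B p" using less.prems(2) by (simp add: fit_plan_def)
  have closed: "closed_units (units B p)" by (rule closed_units_units[OF ok])
  let ?Q = "\<lambda>res \<mu>'. \<exists>w' t h'. res = [w'] \<and> stored \<mu>' w' t \<and> balanced B 1 h' t \<and> inorder t = zs"
  let ?K = "set (lift_args (Ref a) w c)"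
  have cW: "c < W"
    using less.prems(4,6) units_count_weight[OF B2 ok, THEN conjunct1] by simp
  have "run L \<mu> ?K 6 (lift_code B (Ref a) w c) {}
    (weight (units B p) + 8 * length (units B p) + 5 * levels B c) (13 * levels B c + 8 * d + 1) ?Q"
  proof (cases "c \<le> 1")
    case True
    then have lev: "levels B c = 0" by (subst levels.simps) simp
    have one: "length (units B p) = 1" using less.prems(4) True by simp
    then obtain u where u: "units B p = [u]" by (auto simp: length_Suc_conv)
    have uN: "fst (snd u) = None" using closed by (simp add: u closed_units_def)
    have uflat: "inorder (fst u) = zs" "balanced B 1 h (fst u)"
      using less.prems(2) uN by (simp_all add: fit_plan_def u)
    have LL: "L = 60 * B * (d + 1) + 60 * B" by (simp add: L_def lev)
    have "run L \<mu> ?K 6 (Fk [build_task (Ref a) w (Num c) 0] (\<lambda>rs. Ret [rs ! 0 ! 0])) {}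
      (snd (snd u) + 0) (8 * d + 1 + 0) ?Q"
    proof (rule run_call[where b = 2 and Y = "{}" and
          P = "\<lambda>res \<mu>'. \<exists>w'. res = [w', opt_word (fst (snd u))] \<and> stored \<mu>' w' (fst u)"], goal_cases)
      case 1
      then show ?case using LW LL B2 cW by (auto simp: build_task_def lift_args_def)
    next
      case 4
      have "call (60 * B * (d + 1)) \<mu> (build_task (Ref a) w (Num c) 0) {} (snd (snd (units B p ! 0))) (8 * d + 1)
        (\<lambda>res \<mu>'. \<exists>w'. res = [w', opt_word (fst (snd (units B p ! 0)))] \<and> stored \<mu>' w' (fst (units B p ! 0)))"
        by (rule call_build[OF less.prems(1) ok less.prems(3) _ less.prems(5) assms(6) less.prems(6)])
          (use LW LL one in simp_all)
      then show ?case unfolding u nth_Cons_0 by (rule call_mono) (use LL B2 in auto)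
    next
      case (10 res \<nu>)
      from 10(2)[OF map_le_refl] obtain w' where w': "res = [w', opt_word (fst (snd u))]" by blast
      show ?case
      proof (rule run_Ret)
        fix \<nu>' assume "\<nu> \<subseteq>\<^sub>m \<nu>'"
        from 10(2)[OF this] w' have "stored \<nu>' w' (fst u)" by auto
        then show "?Q [[res] ! 0 ! 0] \<nu>'" using uflat w' by auto
      qed (use w' LL B2 in auto)
    qed (use LW LL B2 in \<open>auto simp: build_task_def\<close>)
    then show ?thesis using True
      by (simp add: lift_code_def) (erule run_mono, auto simp: u)
  next
    case False
    let ?p = "PNode [] [p]" and ?c = "groups B c"
    have lev: "levels B c = Suc (levels B ?c)" using False B2 by (subst levels.simps) simp
    have LL: "L = 60 * B * ((d + 1) + 2 * levels B ?c + 2) + 60 * B" by (simp add: L_def lev algebra_simps)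
    have c: "length (units B p) = c" using less.prems(4) False by simp
    have c2: "2 * ?c \<le> c" by (rule groups_double) (use B2 False in simp_all)
    have lc: "length (units B ?p) = ?c" unfolding units_lift length_regroup[OF closed] c ..
    have cpos: "1 \<le> ?c" using groups_pos[of c B] False by simp
    have cont: "run L \<nu> (insert (Ref r) ?K) 14 (Fk [lift_args (Ref a) (Ref r) ?c] (\<lambda>rs. Ret [rs ! 0 ! 0])) {}
      ((weight (units B ?p) + 8 * length (units B ?p) + 5 * levels B ?c) + 0) ((13 * levels B ?c + 8 * (d + 1) + 1) + 0) ?Q"
      if \<nu>: "\<mu> \<subseteq>\<^sub>m \<nu>" "node_at \<nu> r [] [(w, Num c)]" for r \<nu>
    proof (rule run_call[where b = 1 and Y = "{}" and P = ?Q], goal_cases)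
      case 1
      then show ?case using LW LL B2 c2 cW by (auto simp: lift_args_def)
    next
      case 4
      have "planned B A \<nu> (Ref r, length (units B ?p)) ?p"
      proof (rule planned.node)
        show "node_at \<nu> r (map Key []) (map (\<lambda>(w, c). (w, Num c)) [(w, c)])" using \<nu>(2) by simp
        show "list_all2 (planned B A \<nu>) [(w, c)] [p]" using planned_mono[OF less.prems(1) \<nu>(1)] by simp
      qed simp
      then have pl: "planned B A \<nu> (Ref r, ?c) ?p" unfolding lc .
      have "call (60 * B * ((d + 1) + 2 * levels B ?c + 2)) \<nu> (lift_args (Ref a) (Ref r) ?c) {}
        (weight (units B ?p) + 8 * length (units B ?p) + 5 * levels B ?c) (13 * levels B ?c + 8 * (d + 1) + 1) ?Q"
      proof (rule less.IH[OF _ pl fit_plan_lift[OF B2 less.prems(2)]])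
        show "?c < c" using c2 False by simp
        show "2 \<le> length (units B p)" using c False by simp
        show "plan_depth_le (d + 1) ?p" using less.prems(3) by simp
        show "length (units B ?p) = max 1 ?c" using lc cpos by simp
        show "array_at \<nu> a 0 A" using less.prems(5) \<nu>(1) by (rule array_at_mono)
        show "gap_keys ?p + 2 < W" using less.prems(6) by simp
        show "60 * B * ((d + 1) + 2 * levels B ?c + 2) < W" using LW LL by linarith
      qed
      then show ?case by (rule call_mono) (use LL B2 in auto)
    next
      case (10 res \<nu>')
      from 10(2)[OF map_le_refl] obtain w' where w': "res = [w']" by blast
      show ?case
      proof (rule run_Ret)
        fix \<nu>'' assume "\<nu>' \<subseteq>\<^sub>m \<nu>''"
        from 10(2)[OF this] show "?Q [[res] ! 0 ! 0] \<nu>''" using w' by auto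
      qed (use w' LL B2 in auto)
    qed (use LW LL B2 in \<open>auto simp: lift_args_def\<close>)
    have "run L \<mu> ?K 6 (put_node [] [(w, Num c)] (\<lambda>r. Fk [lift_args (Ref a) (Ref r) ?c] (\<lambda>rs. Ret [rs ! 0 ! 0]))) {}
      (5 + ((weight (units B ?p) + 8 * length (units B ?p) + 5 * levels B ?c) + 0)) (5 + ((13 * levels B ?c + 8 * (d + 1) + 1) + 0)) ?Q"
    proof (rule run_put_node)
      fix r \<mu>' assume "\<mu> \<subseteq>\<^sub>m \<mu>'" "node_at \<mu>' r [] [(w, Num c)]"
      from cont[OF this] show "run L \<mu>' (insert (Ref r) ?K) (6 + 8) (Fk [lift_args (Ref a) (Ref r) ?c] (\<lambda>rs. Ret [rs ! 0 ! 0])) {}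
        ((weight (units B ?p) + 8 * length (units B ?p) + 5 * levels B ?c) + 0) ((13 * levels B ?c + 8 * (d + 1) + 1) + 0) ?Q" by simp
    qed (use LW LL B2 cW in \<open>auto simp: lift_args_def\<close>)
    moreover have "weight (units B ?p) = 8 * ?c + weight (units B p)"
      unfolding units_lift weight_regroup[OF closed] c ..
    ultimately show ?thesis using False lev lc c c2
      by (simp add: lift_code_def del: units.simps) (erule run_mono, simp_all)
  qed
  moreover have "length (lift_args (Ref a) w c) + 2 = 6" by (simp add: lift_args_def)
  ultimately show ?case unfolding L_def[symmetric]
    by (intro callI) (simp only: union_body_simps)
qed

text \<open>The span collects \<open>8 * h1\<close> for sizes, \<open>6 * h1 + 1\<close> for
  flattening, \<open>10 * h2\<close> for planning and \<open>8 * h2 + 1\<close> for building,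
  besides 13 per added level.\<close>

lemma call_union:
  fixes t1 t2 :: "'a::linorder btree"
  assumes t1: "stored \<mu> p1 t1" "balanced B 1 h1 t1" "sorted_wrt (<) (inorder t1)" "t1 \<noteq> Ext"
    and t2: "stored \<mu> p2 t2" "balanced B 1 h2 t2" "sorted_wrt (<) (inorder t2)"
    and m: "num_keys t1 = m" "m \<le> 2 ^ e" and c: "c = length (units B (make_plan t2 (inorder t1)))"
    and L: "L = 60 * B * (h1 + h2 + e + 2 * levels B c + 4)" "L < W" "m + 2 < W"
  shows "call L \<mu> [Num 0, p1, p2] {} (28 * m + 4 * plan_work t2 (inorder t1) + 8)
    (14 * h1 + 18 * h2 + 13 * levels B c + 2)
    (\<lambda>res \<mu>'. \<exists>w t h. res = [w] \<and> stored \<mu>' w t \<and> balanced B 1 h t \<and> sorted_wrt (<) (inorder t) \<and>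
      set (inorder t) = keys t2 \<union> keys t1)"
proof -
  define A where "A = inorder t1"
  define p where "p = make_plan t2 A"
  define C where "C = weight (units B p) + 8 * length (units B p) + 5 * levels B c"
  have lA: "length A = m" using length_inorder[OF t1(2)] m(1) by (simp add: A_def)
  have A0: "A \<noteq> []" using num_keys_pos[OF t1(2)] t1(4) lA m(1) by auto
  have sl: "slice 0 m A = A" using lA by (simp add: slice_def)
  have ok: "plan_ok B p" unfolding p_def by (rule plan_ok_make_plan[OF t2(2)])
  have gap: "gap_keys p \<le> m" using gap_keys_make_plan[OF t2(2), of A] lA by (simp add: p_def)
  have closed: "closed_units (units B p)" by (rule closed_units_units[OF ok])
  have fit: "fit_plan B h2 (flat (units B p)) p"
    and fl: "sorted_wrt (<) (flat (units B p))" "set (flat (units B p)) = keys t2 \<union> keys t1"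
    using make_plan_correct[OF t2(2) _ t2(3) t1(3)] B2 ok set_inorder[OF t1(2)] unfolding fit_plan_def p_def A_def by auto
  have depth: "plan_depth_le h2 p" unfolding p_def by (rule plan_depth_make_plan[OF t2(2)])
  have c': "c = length (units B p)" by (simp add: c p_def A_def)
  have c1: "1 \<le> c" using closed c' by (simp add: closed_units_def Suc_le_eq)
  have cW: "c < W" using units_count_weight[OF B2 ok, THEN conjunct1] gap L(3) c' by simp
  have LL: "60 * B * (h1 + 1) + 60 * B \<le> L" "60 * B * (h2 + e + 2) + 60 * B \<le> L"
    "60 * B * (h2 + 2 * levels B c + 2) + 60 * B \<le> L"
  proof -
    have x: "60 * B * x + 60 * B \<le> L" if "x + 1 \<le> h1 + h2 + e + 2 * levels B c + 4" for x
    proof -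
      have "60 * B * (x + 1) \<le> L" unfolding L(1) using that by (rule mult_le_mono2)
      then show ?thesis by simp
    qed
    show "60 * B * (h1 + 1) + 60 * B \<le> L" "60 * B * (h2 + e + 2) + 60 * B \<le> L"
      "60 * B * (h2 + 2 * levels B c + 2) + 60 * B \<le> L" by (rule x, simp)+
  qed
  have LW: "L < W" and mW: "m + 2 < W" by (rule L)+
  have L60: "60 * B \<le> L" using LL(1) by linarith
  let ?Q = "\<lambda>res \<mu>'. \<exists>w t h. res = [w] \<and> stored \<mu>' w t \<and> balanced B 1 h t \<and> sorted_wrt (<) (inorder t) \<and>
      set (inorder t) = keys t2 \<union> keys t1"
  let ?QL = "\<lambda>res \<mu>'. \<exists>w' t h'. res = [w'] \<and> stored \<mu>' w' t \<and> balanced B 1 h' t \<and> inorder t = flat (units B p)"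
  have lift: "run L \<nu> K 30 (Fk [lift_args (Ref a) w c] (\<lambda>rs. Ret [rs ! 0 ! 0])) X (C + 0) ((13 * levels B c + 8 * h2 + 1) + 0) ?Q"
    if pl: "planned B A \<nu> (w, c) p" and arr: "array_at \<nu> a 0 A" and K: "Ref a \<in> K" "w \<in> K" for \<nu> K a w X
  proof (rule run_call[where b = 1 and Y = "{}" and P = ?QL], goal_cases)
    case 1
    then show ?case using LW mW L60 B2 cW K by (auto simp: lift_args_def)
  next
    case 4
    have "call (60 * B * (h2 + 2 * levels B c + 2)) \<nu> (lift_args (Ref a) w c) {} C (13 * levels B c + 8 * h2 + 1) ?QL"
      unfolding C_def
      by (rule call_lift[OF pl fit depth _ arr]) (use c' c1 lA LW mW gap LL in auto)
    then show ?case by (rule call_mono) (use LL B2 in auto)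
  next
    case (10 res \<nu>')
    from 10(2)[OF map_le_refl] obtain w' where w': "res = [w']" by blast
    show ?case
    proof (rule run_Ret)
      fix \<nu>'' assume "\<nu>' \<subseteq>\<^sub>m \<nu>''"
      from 10(2)[OF this] show "?Q [[res] ! 0 ! 0] \<nu>''" using w' fl by auto
    qed (use w' L60 B2 in auto)
  qed (use LW mW L60 B2 in \<open>auto simp: lift_args_def\<close>)
  have plan: "run L \<nu> K 20 (Fk [plan_task (Ref a) p2 0 m] (\<lambda>rs'.
        Fk [lift_args (Ref a) (rs' ! 0 ! 0) (num (rs' ! 0 ! 1))] (\<lambda>rs''. Ret [rs'' ! 0 ! 0]))) X
      (plan_work t2 A + (C + 0)) (10 * h2 + ((13 * levels B c + 8 * h2 + 1) + 0)) ?Q"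
    if arr: "array_at \<nu> a 0 A" and m2: "\<mu> \<subseteq>\<^sub>m \<nu>" and K: "Ref a \<in> K" "p2 \<in> K" for \<nu> K a X
  proof (rule run_call[where b = 2 and Y = "{}" and
        P = "\<lambda>res \<mu>'. \<exists>w' c. res = [w', Num c] \<and> planned B A \<mu>' (w', c) p"], goal_cases)
    case 1
    then show ?case using LW mW L60 B2 K by (auto simp: plan_task_def)
  next
    case 4
    have "call (60 * B * (h2 + e + 2)) \<nu> (plan_task (Ref a) p2 0 m) {} (plan_work t2 (slice 0 m A)) (10 * h2)
      (\<lambda>res \<mu>'. \<exists>w' c. res = [w', Num c] \<and> planned B A \<mu>' (w', c) (make_plan t2 (slice 0 m A)))"
      by (rule call_plan[OF stored_mono[OF t2(1) m2] t2(2) _ t2(3) _ _ _ arr])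
        (use lA m LW mW LL t1(3) in \<open>auto simp: A_def\<close>)
    then show ?case unfolding sl p_def by (rule call_mono) (use LL B2 in auto)
  next
    case (10 res \<nu>')
    from 10(2)[OF map_le_refl] obtain w' c'' where r: "res = [w', Num c'']" "planned B A \<nu>' (w', c'') p" by blast
    \<comment> \<open>As the array is nonempty, the plan of the whole tree is not
      \<open>Keep\<close>; so the number returned is the true number of units and not the marker
      0.\<close>
    have pn: "p = PNode ks ps \<Longrightarrow> c'' = c" for ks ps using r(2) by (auto elim: planned.cases simp: c')
    have "make_plan t2 A = Gap A \<or> (\<exists>ks ps. p = PNode ks ps)"
      using A0 by (cases t2) (auto simp: make_plan_Node p_def)
    then have "c'' = c"
    proof
      assume "make_plan t2 A = Gap A"
      then show ?thesis using r(2) by (auto elim: planned.cases simp: c' p_def)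
    qed (use pn in auto)
    then have r': "res = [w', Num c]" "planned B A \<nu>' (w', c) p" using r by simp_all
    have "run L \<nu>' (K \<union> set res) 30 (Fk [lift_args (Ref a) w' c] (\<lambda>rs. Ret [rs ! 0 ! 0])) (X - {}) (C + 0) ((13 * levels B c + 8 * h2 + 1) + 0) ?Q"
      by (rule lift[OF r'(2) array_at_mono[OF arr 10(1)]]) (use K r' in auto)
    moreover have "[[w', Num c]] ! 0 ! 0 = w'" "num ([[w', Num c]] ! 0 ! 1) = c" by simp_all
    ultimately show ?case unfolding r' by (simp only:) (erule run_weaken, auto)
  qed (use LW mW L60 B2 in \<open>auto simp: plan_task_def\<close>)
  have flatten: "run L \<nu> K 16 (Fk [flatten_task (Ref a) w m 0 (Num 0)] (\<lambda>_. Fk [plan_task (Ref a) p2 0 m] (\<lambda>rs'.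
        Fk [lift_args (Ref a) (rs' ! 0 ! 0) (num (rs' ! 0 ! 1))] (\<lambda>rs''. Ret [rs'' ! 0 ! 0])))) ({} \<union> {a} \<times> UNIV)
      ((6 * m + 0) + (plan_work t2 A + (C + 0))) ((6 * h1 + 1) + (10 * h2 + ((13 * levels B c + 8 * h2 + 1) + 0))) ?Q"
    if sz: "sized \<nu> w t1" and m2: "\<mu> \<subseteq>\<^sub>m \<nu>" and K: "Ref a \<in> K" "p2 \<in> K" "w \<in> K" for \<nu> K a w
  proof (rule run_call[where b = 2 and Y = "{a} \<times> {0..<m}" and
        P = "\<lambda>res \<mu>'. length res = 2 \<and> array_at \<mu>' a 0 A"], goal_cases)
    case 1
    then show ?case using LW mW L60 B2 K by (auto simp: flatten_task_def)
  next
    case 4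
    have "call (60 * B * (h1 + 1)) \<nu> (flatten_task (Ref a) w (num_keys t1) 0 (opt_word None))
      ({a} \<times> {0..<0 + length (inorder t1 @ opt_list None)}) (6 * num_keys t1 + length (opt_list (None :: 'a option))) (6 * h1 + 1)
      (\<lambda>res \<mu>'. length res = 2 \<and> array_at \<mu>' a 0 (inorder t1 @ opt_list None))"
      by (rule call_flatten[OF sz t1(2)]) (use LW mW LL m B2 in auto)
    then show ?case using LL B2 lA m by (auto elim!: call_mono simp: opt_list_def opt_word_def A_def)
  next
    case (10 res \<nu>')
    have "run L \<nu>' (K \<union> set res) 20 (Fk [plan_task (Ref a) p2 0 m] (\<lambda>rs'.
        Fk [lift_args (Ref a) (rs' ! 0 ! 0) (num (rs' ! 0 ! 1))] (\<lambda>rs''. Ret [rs'' ! 0 ! 0]))) ({} \<union> {a} \<times> UNIV - {a} \<times> {0..<m})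
      (plan_work t2 A + (C + 0)) (10 * h2 + ((13 * levels B c + 8 * h2 + 1) + 0)) ?Q"
      by (rule plan) (use 10(2)[OF map_le_refl] map_le_trans[OF m2 10(1)] K in auto)
    then show ?case by simp
  qed (use LW mW L60 B2 in \<open>auto simp: flatten_task_def\<close>)
  have p1: "is_ref p1" using t1(1,4) by (auto elim: stored.cases)
  have "run L \<mu> (set [Num 0, p1, p2]) 5 (union_code p1 p2) {}
      (8 * m + ((6 * m + 0) + (plan_work t2 A + (C + 0)))) (8 * h1 + ((6 * h1 + 1) + (10 * h2 + ((13 * levels B c + 8 * h2 + 1) + 0)))) ?Q"
    unfolding union_code_def if_P[OF p1]
  proof (rule run_call[where b = 2 and Y = "{}" and
        P = "\<lambda>res \<mu>'. \<exists>w'. res = [w', Num m] \<and> sized \<mu>' w' t1"], goal_cases)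
    case 1
    then show ?case using LW mW L60 B2 by (auto simp: annotate_task_def)
  next
    case 4
    have "call (60 * B * (h1 + 1)) \<mu> (annotate_task p1) {} (8 * num_keys t1) (8 * h1)
      (\<lambda>res \<mu>'. \<exists>w'. res = [w', Num (num_keys t1)] \<and> sized \<mu>' w' t1)"
      by (rule call_annotate[OF t1(1,2)]) (use LW mW LL m in auto)
    then show ?case unfolding m(1) by (rule call_mono) (use LL B2 in auto)
  next
    case (10 res \<nu>)
    from 10(2)[OF map_le_refl] obtain w' where w': "res = [w', Num m]" "sized \<nu> w' t1" by blast
    show ?case unfolding empty_Diff
    proof (rule run_Al)
      fix a
      have *: "run L \<nu> (insert (Ref a) (set [Num 0, p1, p2] \<union> set res)) 16 (Fk [flatten_task (Ref a) w' m 0 (Num 0)] (\<lambda>_. Fk [plan_task (Ref a) p2 0 m] (\<lambda>rs'.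
        Fk [lift_args (Ref a) (rs' ! 0 ! 0) (num (rs' ! 0 ! 1))] (\<lambda>rs''. Ret [rs'' ! 0 ! 0])))) ({} \<union> {a} \<times> UNIV)
        ((6 * m + 0) + (plan_work t2 A + (C + 0))) ((6 * h1 + 1) + (10 * h2 + ((13 * levels B c + 8 * h2 + 1) + 0))) ?Q"
        by (rule flatten[OF w'(2) 10(1)]) (use w' in auto)
      show "run L \<nu> (insert (Ref a) (set [Num 0, p1, p2] \<union> set res)) (5 + 2 + 2 + 3)
        (Fk [flatten_task (Ref a) ([res] ! 0 ! 0) (num ([res] ! 0 ! 1)) 0 (Num 0)] (\<lambda>_. Fk [plan_task (Ref a) p2 0 (num ([res] ! 0 ! 1))] (\<lambda>rs'.
        Fk [lift_args (Ref a) (rs' ! 0 ! 0) (num (rs' ! 0 ! 1))] (\<lambda>rs''. Ret [rs'' ! 0 ! 0])))) ({} \<union> {a} \<times> UNIV)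
        ((6 * m + 0) + (plan_work t2 A + (C + 0))) ((6 * h1 + 1) + (10 * h2 + ((13 * levels B c + 8 * h2 + 1) + 0))) ?Q"
      proof -
        have "[[w', Num m]] ! 0 ! 0 = w'" "num ([[w', Num m]] ! 0 ! 1) = m" by simp_all
        then show ?thesis using * unfolding w'(1) by (simp only:) (erule run_weaken, auto)
      qed
    qed (use LW mW L60 B2 in auto)
  qed (use LW mW L60 B2 in \<open>auto simp: annotate_task_def\<close>)
  \<comment> \<open>\<open>28 = 8 + 6 + 9 + 5\<close>: sizes, flattening, gap keys and added levels,
    the last two being at most \<open>m\<close> in number. The 24 per touched node adds
    \<open>3 * plan_work\<close> to the planning itself.\<close>
  moreover have "8 * m + ((6 * m + 0) + (plan_work t2 A + (C + 0))) \<le> 28 * m + 4 * plan_work t2 A + 8"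
  proof -
    have "weight (units B p) + 8 * length (units B p) \<le> 9 * gap_keys p + 24 * touched p + 8"
      using units_count_weight[OF B2 ok] by blast
    moreover have "8 * touched p \<le> plan_work t2 A" unfolding p_def by (rule touched_le_plan_work)
    moreover have "levels B c \<le> m"
      using levels_le[OF B2, of c] units_count_weight[OF B2 ok, THEN conjunct1] gap c' by linarith
    ultimately show ?thesis using gap unfolding C_def by linarith
  qed
  ultimately have "run L \<mu> (set [Num 0, p1, p2]) 5 (union_code p1 p2) {}
      (28 * m + 4 * plan_work t2 A + 8) (14 * h1 + 18 * h2 + 13 * levels B c + 2) ?Q"
    by (elim run_mono) auto
  moreover have "length [Num 0, p1, p2] + 2 = 5" by simp
  ultimately show ?thesis unfolding A_def
    by (intro callI) (simp only: union_body_simps)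
qed

end

section \<open>Cost bounds\<close>

text \<open>A root may have as few as two children, so the top level contributes 2 where the others
  contribute \<open>B div 2 + 1\<close>.\<close>

lemma root_power_le:
  assumes "balanced B 1 (Suc g) t"
  shows "2 * (B div 2 + 1) ^ g \<le> num_keys t + 1"
proof (cases t)
  case (Node ks ts)
  have "2 * (B div 2 + 1) ^ g \<le> length ts * (B div 2 + 1) ^ g"
    using assms Node by (intro mult_le_mono1) simp
  also have "\<dots> = (\<Sum>t\<leftarrow>ts. (B div 2 + 1) ^ g)" by (simp add: sum_list_triv)
  also have "\<dots> \<le> (\<Sum>t\<leftarrow>ts. num_keys t + 1)"
    by (rule sum_list_mono) (use assms Node num_keys_ge_power in auto)
  also have "\<dots> = num_keys t + 1" using assms Node by (simp add: sum_list_Suc)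
  finally show ?thesis .
qed (use assms in simp)

text \<open>For \<open>D = B div 2 + 1\<close> one has \<open>B < 2 * D <= D * D\<close>, so
  changing the base from \<open>D\<close> to \<open>B\<close> costs a factor of 2, uniformly down to
  \<open>B = 2\<close>.\<close>

lemma log_half_le:
  assumes "2 \<le> B" "1 \<le> x"
  shows "log (real (B div 2 + 1)) x \<le> 2 * log (real B) x"
proof -
  define D where "D = B div 2 + 1"
  have D: "2 \<le> D" using assms by (simp add: D_def)
  have "B < 2 * D" by (simp add: D_def)
  also have "\<dots> \<le> D * D" using D by (intro mult_le_mono1)
  finally have "real B \<le> real D ^ 2" by (simp add: power2_eq_square flip: of_nat_mult)
  then have "ln (real B) \<le> 2 * ln (real D)"
    using assms D by (metis ln_le_cancel_iff ln_realpow of_nat_0_less_iff of_nat_numeral pos2 less_le_trans zero_less_power)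
  then have "ln x * ln (real B) \<le> ln x * (2 * ln (real D))" using assms by (intro mult_left_mono) auto
  moreover have "0 < ln (real B)" "0 < ln (real D)" using assms D by (auto intro!: ln_gt_zero)
  ultimately have "ln x / ln (real D) \<le> 2 * (ln x / ln (real B))" by (simp add: field_simps)
  then show ?thesis by (simp add: log_def D_def)
qed

lemma exponent_le_log:
  assumes "2 \<le> b" "b ^ k \<le> n"
  shows "real k \<le> log (real b) (real n)"
proof -
  have "real b ^ k \<le> real n" using assms(2) by (metis of_nat_le_iff of_nat_power)
  moreover have "1 < real b" using assms(1) by simp
  moreover have "0 < real b ^ k" using assms(1) by simp
  ultimately show ?thesis by (metis le_log_of_power)
qed

lemma height_le_lg:
  assumes "2 \<le> B" "balanced B 1 h t" "num_keys t \<le> n" "1 \<le> n"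
  shows "real h \<le> 3 * lg B n"
proof (cases h)
  case 0
  then show ?thesis by (simp add: lg_def)
next
  case (Suc g)
  have "2 * (B div 2 + 1) ^ g \<le> num_keys t + 1" using root_power_le assms(2) Suc by blast
  then have "(B div 2 + 1) ^ g \<le> n" using assms(3,4) by linarith
  moreover have "2 \<le> B div 2 + 1" using assms(1) by simp
  ultimately have "real g \<le> log (real (B div 2 + 1)) (real n)" by (intro exponent_le_log)
  also have "\<dots> \<le> 2 * log (real B) (real n)" using assms by (intro log_half_le) auto
  finally have "real g \<le> 2 * lg B n" by (simp add: lg_def)
  moreover have "1 \<le> lg B n" by (simp add: lg_def)
  ultimately show ?thesis using Suc by simp
qed

text \<open>Stack room is measured with binary logarithms, the span in base \<open>B\<close>; hence
  bounds of both kinds for heights and levels.\<close>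

lemma height_le_2:
  assumes "2 \<le> B" "balanced B 1 h t" "num_keys t \<le> n" "1 \<le> n" "n \<le> 2 ^ N"
  shows "h \<le> N + 1"
proof (cases h)
  case (Suc g)
  have "2 ^ g \<le> (B div 2 + 1) ^ g" using assms(1) by (intro power_mono) auto
  moreover have "2 * (B div 2 + 1) ^ g \<le> num_keys t + 1" using root_power_le assms(2) Suc by blast
  ultimately have "2 ^ g \<le> (2::nat) ^ N" using assms(3-5) by linarith
  then show ?thesis using Suc by simp
qed simp

lemma levels_le_lg:
  assumes "2 \<le> B" "c \<le> n + 1" "1 \<le> n"
  shows "real (levels B c) \<le> 2 * lg B n" "n \<le> 2 ^ N \<Longrightarrow> levels B c \<le> N + 1"
proof -
  have *: "(B + 1) ^ (levels B c - 1) \<le> n"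
  proof (cases "2 \<le> c")
    case True
    then show ?thesis using power_levels[OF assms(1) True] assms(2) by linarith
  next
    case False
    then have "levels B c = 0" by (subst levels.simps) simp
    then show ?thesis using assms(3) by simp
  qed
  have "B ^ (levels B c - 1) \<le> (B + 1) ^ (levels B c - 1)" by (intro power_mono) auto
  then have "real (levels B c - 1) \<le> log (real B) (real n)" using * assms(1) by (intro exponent_le_log) auto
  then show "real (levels B c) \<le> 2 * lg B n" by (simp add: lg_def)
  show "levels B c \<le> N + 1" if "n \<le> 2 ^ N"
  proof -
    have "2 ^ (levels B c - 1) \<le> (B + 1) ^ (levels B c - 1)" using assms(1) by (intro power_mono) auto
    then have "2 ^ (levels B c - 1) \<le> (2::nat) ^ N" using * that by linarith
    then show ?thesis by simp
  qed
qed

lemma program_of_start: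
  assumes "p1 \<noteq> Num 1"
  shows "program_of body [p1, p2] = Alloc (\<lambda>_. enc_state [Num 0, p1, p2] [])"
proof -
  have "\<not> (\<exists>a hs. [p1, p2] = enc_state a hs)" using assms by (auto simp: enc_state_def)
  then show ?thesis by (simp add: program_of_def)
qed

text \<open>The entry step is an allocation, so the main procedure runs with the enumeration
  \<open>free \<circ> Suc\<close>; work and span are unaffected.\<close>

lemma exec_start:
  assumes W: "3 < W" "5 \<le> L" and p1: "p1 \<noteq> Num 1" and free: "inj free" "\<forall>r i. (r, i) \<in> dom \<mu> \<longrightarrow> r \<notin> range free"
    and call: "machine.call B W body L \<mu> [Num 0, p1, p2] {} w d Q"
  shows "\<exists>res R U w' d'. exec B W (program_of body) L free \<mu> [p1, p2] (Outcome res R U w' d') \<and>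
    w' \<le> w \<and> d' \<le> d \<and> Q res (\<mu> ++ U)"
proof -
  have "fresh (free \<circ> Suc) \<mu> {}"
  proof -
    have "(free j, i) \<notin> dom \<mu>" for i j using free(2) by blast
    moreover have "inj (free \<circ> Suc)" by (rule inj_compose[OF free(1) inj_Suc])
    ultimately show ?thesis unfolding fresh_iff by simp
  qed
  then have "machine.spec B W body L (free \<circ> Suc) \<mu> (enc_state [Num 0, p1, p2] []) {} w d Q"
    using call unfolding machine.call_def by blast
  then obtain res R U w' d' where
    e: "exec B W (program_of body) L (free \<circ> Suc) \<mu> (enc_state [Num 0, p1, p2] []) (Outcome res R U w' d')"
    and *: "w' \<le> w" "d' \<le> d" "\<forall>\<mu>'. \<mu> ++ U \<subseteq>\<^sub>m \<mu>' \<longrightarrow> Q res \<mu>'"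
    unfolding machine.spec_def by blast
  have "exec B W (program_of body) L free \<mu> [p1, p2] (Outcome res R U w' d')"
  proof (rule exec.alloc)
    show "program_of body [p1, p2] = Alloc (\<lambda>_. enc_state [Num 0, p1, p2] [])" by (rule program_of_start[OF p1])
    show "derivable L W ([p1, p2] @ [Ref (free 0)]) (enc_state [Num 0, p1, p2] [])"
      using W by (auto simp: derivable_def enc_state_def enc_list_def)
  qed (fact e)
  then show ?thesis using * map_le_refl by blast
qed

section \<open>Choice of constants and the final bounds\<close>

lemma union_in_bounds:
  fixes t1 t2 :: "'k::linorder btree"
  assumes c: "1000 \<le> c" and B: "2 \<le> B" and bt: "is_btree B t1" "is_btree B t2"
    and mn: "num_keys t1 = m" "num_keys t2 = n" "m \<le> n"
    and st: "stored \<mu> p1 t1" "stored \<mu> p2 t2"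
    and free: "inj free" "\<forall>r i. (r, i) \<in> dom \<mu> \<longrightarrow> r \<notin> range free"
  shows "\<exists>p R U work span t.
         exec B ((n + B) ^ c) (program_of (union_body B)) (B * (c * nat \<lceil>lg 2 n\<rceil>)) free \<mu> [p1, p2]
           (Outcome [p] R U work span) \<and>
         is_btree B t \<and> keys t = keys t1 \<union> keys t2 \<and> stored (\<mu> ++ U) p t \<and>
         real work \<le> c * (m * lg B (n / m)) \<and>
         real span \<le> c * (lg B m * lg 2 (lg B n) + lg B n)"
proof -
  define N where "N = nat \<lceil>lg 2 n\<rceil>"
  define W where "W = (n + B) ^ c"
  interpret union_machine B W by unfold_locales (rule B)
  have N1: "1 \<le> N" unfolding N_def lg_def by linarith
  obtain h1 where h1: "balanced B 1 h1 t1" "sorted_wrt (<) (inorder t1)" using bt(1) unfolding is_btree_iff by blast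
  obtain h2 where h2: "balanced B 1 h2 t2" "sorted_wrt (<) (inorder t2)" using bt(2) unfolding is_btree_iff by blast
  have p1: "p1 \<noteq> Num 1" using st(1) by (auto elim: stored.cases)
  \<comment> \<open>Twelve factors suffice: ten of them make at least 1024, the other two bound
    \<open>B * N\<close>, so \<open>W\<close> exceeds a stack of \<open>780 * (B * N)\<close>
    words.\<close>
  have Wge: "(n + B) ^ 12 \<le> W" unfolding W_def using c B by (intro power_increasing) auto
  have nb: "2 \<le> n + B" using B by simp
  have "2 ^ 10 * (n + B) ^ 2 \<le> (n + B) ^ 10 * (n + B) ^ 2" using nb by (intro mult_le_mono1 power_mono) auto
  also have "\<dots> = (n + B) ^ 12" by (simp flip: power_add)
  finally have "2 ^ 10 * (n + B) ^ 2 \<le> W" using Wge by (rule order_trans)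
  define X where "X = (n + B) * (n + B)"
  have W1: "1024 * X \<le> W" using \<open>2 ^ 10 * (n + B) ^ 2 \<le> W\<close> by (simp add: X_def power2_eq_square)
  have "2 * (n + B) \<le> X" unfolding X_def using nb by (rule mult_le_mono1)
  then have nbb: "2 * n + 2 * B \<le> X" by simp
  have "4 \<le> X" using nbb nb by linarith
  then have "X < W" using W1 by linarith
  have W3: "3 < W" using \<open>4 \<le> X\<close> \<open>X < W\<close> by linarith
  have mW: "m + 2 < W" using nbb mn(3) B \<open>X < W\<close> by linarith
  have Bc: "1000 * (B * N) \<le> B * (c * N)"
  proof -
    have "(B * N) * 1000 \<le> (B * N) * c" using c by (rule mult_le_mono2)
    then show ?thesis by (simp add: ac_simps)
  qed
  have BN: "2 \<le> B * N" using mult_le_mono[OF B N1] by simp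
  have L5: "5 \<le> B * (c * N)" using Bc BN by linarith
  show ?thesis
  proof (cases "t1 = Ext")
    case True
    then have m0: "m = 0" and p1': "\<not> is_ref p1" using mn(1) st(1) by (auto elim: stored.cases)
    \<comment> \<open>For \<open>m = 0\<close> the work bound is 0, so no block may be transferred
      and the second pointer itself is the answer.\<close>
    have "call (B * (c * N)) \<mu> [Num 0, p1, p2] {} 0 0 (\<lambda>res \<mu>'. res = [p2] \<and> stored \<mu>' p2 t2)"
    proof (rule callI, unfold union_body_simps union_code_def if_not_P[OF p1'], rule run_Ret)
      note L5
      moreover have "length [Num 0, p1, p2] + 2 = 5" "length [p2] = 1" by simp_all
      ultimately show "length [Num 0, p1, p2] + 2 \<le> B * (c * N)" "length [p2] \<le> B * (c * N)" by linarith+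
    qed (use stored_mono[OF st(2)] in auto)
    from exec_start[OF W3 L5 p1 free this] obtain res R U w' d' where
      e: "exec B W (program_of (union_body B)) (B * (c * N)) free \<mu> [p1, p2] (Outcome res R U w' d')"
      "w' \<le> 0" "d' \<le> 0" "res = [p2] \<and> stored (\<mu> ++ U) p2 t2" by auto
    have "0 \<le> lg B m * lg 2 (lg B n) + lg B n" by (simp add: lg_def)
    then have "exec B W (program_of (union_body B)) (B * (c * N)) free \<mu> [p1, p2] (Outcome [p2] R U 0 0) \<and>
      is_btree B t2 \<and> keys t2 = keys t1 \<union> keys t2 \<and> stored (\<mu> ++ U) p2 t2 \<and>
      real 0 \<le> c * (m * lg B (n / m)) \<and> real 0 \<le> c * (lg B m * lg 2 (lg B n) + lg B n)"
      using e bt(2) True m0 by simp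
    then show ?thesis unfolding N_def W_def by blast
  next
    case False
    then have m1: "1 \<le> m" using num_keys_pos[OF h1(1)] mn(1) by (cases "m = 0") auto
    then have n1: "1 \<le> n" using mn(3) by simp
    have "log 2 (real n) \<le> real N" unfolding N_def lg_def by linarith
    then have "real n \<le> 2 powr (real N)" using n1 by (simp add: log_le_iff)
    then have "real n \<le> real (2 ^ N)" by (simp add: powr_realpow)
    then have nN: "n \<le> 2 ^ N" unfolding of_nat_le_iff .
    have Nn: "N \<le> n"
    proof -
      have "log 2 (real n) \<le> real n"
      proof -
        have "real n \<le> real (2 ^ n)" unfolding of_nat_le_iff by (rule less_imp_le[OF less_exp])
        then have "real n \<le> 2 powr (real n)" by (simp add: powr_realpow)
        then show ?thesis using n1 by (simp add: log_le_iff)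
      qed
      then have "lg 2 n \<le> real n" using n1 by (simp add: lg_def)
      then show ?thesis unfolding N_def by linarith
    qed
    define c' where "c' = length (units B (make_plan t2 (inorder t1)))"
    have c'm: "c' \<le> m + 1"
      using units_count_weight[OF B plan_ok_make_plan[OF h2(1)], THEN conjunct1, of "inorder t1"]
        gap_keys_make_plan[OF h2(1), of "inorder t1"] length_inorder[OF h1(1)] mn(1) unfolding c'_def by linarith
    then have c'n: "c' \<le> n + 1" using mn(3) by simp
    define L where "L = 60 * B * (h1 + h2 + N + 2 * levels B c' + 4)"
    have "h1 \<le> N + 1" using height_le_2[OF B h1(1) _ n1 nN] mn by simp
    moreover have "h2 \<le> N + 1" using height_le_2[OF B h2(1) _ n1 nN] mn by simp
    moreover have "levels B c' \<le> N + 1" using levels_le_lg(2)[OF B c'n n1 nN] .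
    \<comment> \<open>The sum is at most \<open>5 * N + 8\<close>, and
      \<open>N >= 1\<close>.\<close>
    ultimately have "h1 + h2 + N + 2 * levels B c' + 4 \<le> 13 * N" using N1 by linarith
    then have "60 * B * (h1 + h2 + N + 2 * levels B c' + 4) \<le> 60 * B * (13 * N)" by (rule mult_le_mono2)
    then have L: "L \<le> 780 * (B * N)" by (simp add: L_def)
    have "B * N \<le> X" unfolding X_def using Nn by (intro mult_le_mono) auto
    then have LW: "L < W" using L W1 nbb nb by linarith
    have LBc: "L \<le> B * (c * N)" using L Bc by linarith
    have mN: "m \<le> 2 ^ N" using nN mn(3) by simp
    let ?Q = "\<lambda>res \<mu>'. \<exists>w t h. res = [w] \<and> stored \<mu>' w t \<and> balanced B 1 h t \<and> sorted_wrt (<) (inorder t) \<and>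
      set (inorder t) = keys t2 \<union> keys t1"
    have "call L \<mu> [Num 0, p1, p2] {} (28 * m + 4 * plan_work t2 (inorder t1) + 8)
      (14 * h1 + 18 * h2 + 13 * levels B c' + 2) ?Q"
      by (rule call_union[OF st(1) h1 False st(2) h2 mn(1) mN c'_def L_def LW mW])
    then have "call (B * (c * N)) \<mu> [Num 0, p1, p2] {} (28 * m + 4 * plan_work t2 (inorder t1) + 8)
      (14 * h1 + 18 * h2 + 13 * levels B c' + 2) ?Q"
      by (rule call_mono[OF _ LBc]) simp_all
    from exec_start[OF W3 L5 p1 free this] obtain res R U w' d' where
      e: "exec B W (program_of (union_body B)) (B * (c * N)) free \<mu> [p1, p2] (Outcome res R U w' d')"
      "w' \<le> 28 * m + 4 * plan_work t2 (inorder t1) + 8" "d' \<le> 14 * h1 + 18 * h2 + 13 * levels B c' + 2"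
      "?Q res (\<mu> ++ U)" by blast
    then obtain p t h where t: "res = [p]" "stored (\<mu> ++ U) p t" "balanced B 1 h t" "sorted_wrt (<) (inorder t)"
      "set (inorder t) = keys t2 \<union> keys t1" by blast
    have bt': "is_btree B t" unfolding is_btree_iff using t by blast
    have keys: "keys t = keys t1 \<union> keys t2" using set_inorder[OF t(3)] t(5) by blast
    have work: "real w' \<le> c * (m * lg B (n / m))"
    proof -
      \<comment> \<open>Rounding the logarithm up gives \<open>n <= m * D ^ J\<close> for
        \<open>D = B div 2 + 1\<close>, the cutoff height for
        \<open>plan_work_linear\<close>.\<close>
      define J where "J = nat \<lceil>log (real (B div 2 + 1)) (real n / real m)\<rceil>"
      have nm: "1 \<le> real n / real m" using m1 mn(3) by simp
      have D: "1 < real (B div 2 + 1)" using B by simp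
      have l0: "0 \<le> log (real (B div 2 + 1)) (real n / real m)" using D nm by simp
      have "log (real (B div 2 + 1)) (real n / real m) \<le> real J" unfolding J_def by linarith
      then have "real n / real m \<le> real (B div 2 + 1) powr (real J)" using D nm by (subst (asm) log_le_iff) auto
      then have "real n / real m \<le> real (B div 2 + 1) ^ J" using D by (subst (asm) powr_realpow) auto
      then have "real n \<le> real m * real (B div 2 + 1) ^ J" using m1 by (simp add: field_simps)
      then have "real n \<le> real (m * (B div 2 + 1) ^ J)" by simp
      then have "num_keys t2 \<le> m * (B div 2 + 1) ^ J" unfolding of_nat_le_iff mn(2) .
      from plan_work_linear[OF B h2(1) order_refl this _ m1, of "inorder t1"]
      have "plan_work t2 (inorder t1) \<le> 12 * m * (J + 11)" using length_inorder[OF h1(1)] mn(1) by simp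
      then have "w' \<le> 28 * m + 4 * (12 * m * (J + 11)) + 8 * m" using e(2) m1 by linarith
      also have "\<dots> = m * (48 * J + 564)" by (simp add: algebra_simps)
      finally have "real w' \<le> real (m * (48 * J + 564))" unfolding of_nat_le_iff .
      then have 1: "real w' \<le> m * (48 * real J + 564)" by simp
      have "real J \<le> log (real (B div 2 + 1)) (real n / real m) + 1" unfolding J_def using l0 by linarith
      also have "log (real (B div 2 + 1)) (real n / real m) \<le> 2 * log (real B) (real n / real m)" by (rule log_half_le[OF B nm])
      finally have "real J \<le> 3 * lg B (n / m)" by (simp add: lg_def max_def)
      moreover have "1 \<le> lg B (n / m)" by (simp add: lg_def)
      moreover have "1000 * lg B (n / m) \<le> c * lg B (n / m)" using c by (intro mult_right_mono) (auto simp: lg_def)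
      \<comment> \<open>\<open>J\<close> is at most three times a logarithm that is at least 1, and
        \<open>48 * 3 + 564 = 708\<close>.\<close>
      ultimately have "48 * real J + 564 \<le> c * lg B (n / m)" by linarith
      then have "m * (48 * real J + 564) \<le> m * (c * lg B (n / m))" by (intro mult_left_mono) auto
      then show ?thesis using 1 by (simp add: ac_simps)
    qed
    have span: "real d' \<le> c * (lg B m * lg 2 (lg B n) + lg B n)"
    proof -
      have "real h1 \<le> 3 * lg B n" by (rule height_le_lg[OF B h1(1) _ n1]) (use mn in simp)
      moreover have "real h2 \<le> 3 * lg B n" by (rule height_le_lg[OF B h2(1) _ n1]) (use mn in simp)
      moreover have "real (levels B c') \<le> 2 * lg B n" by (rule levels_le_lg(1)[OF B c'n n1])
      moreover have "1 \<le> lg B n" by (simp add: lg_def)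
      moreover have "real d' \<le> real (14 * h1 + 18 * h2 + 13 * levels B c' + 2)" using e(3) unfolding of_nat_le_iff .
      \<comment> \<open>The coefficients add up to
        \<open>14 * 3 + 18 * 3 + 13 * 2 + 2 = 124\<close>; the span is within the summand
        \<open>lg B n\<close> of the bound.\<close>
      ultimately have "real d' \<le> 1000 * lg B n" by simp
      also have "\<dots> \<le> c * lg B n" using c by (intro mult_right_mono) (auto simp: lg_def)
      also have "\<dots> \<le> c * (lg B m * lg 2 (lg B n) + lg B n)"
        by (intro mult_left_mono) (auto simp: lg_def)
      finally show ?thesis .
    qed
    show ?thesis
      using e(1) t(2) bt' keys work span unfolding t(1) W_def N_def by blast
  qed
qed

theorem mainTheorem1:
  shows "\<exists>(c::nat) (alg :: nat \<Rightarrow> 'k::linorder program).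
    \<forall>(B::nat) (m::nat) (n::nat) (t1 :: 'k btree) (t2 :: 'k btree) \<mu> p1 p2 free.
      B \<ge> 2 \<and> is_btree B t1 \<and> is_btree B t2 \<and>
      num_keys t1 = m \<and> num_keys t2 = n \<and> n \<ge> m \<and>
      block_memory B \<mu> \<and> stored \<mu> p1 t1 \<and> stored \<mu> p2 t2 \<and>
      inj free \<and> (\<forall>r i. (r, i) \<in> dom \<mu> \<longrightarrow> r \<notin> range free) \<longrightarrow>
      (\<exists>p R U work span t.
         exec B ((n + B) ^ c) (alg B) (B * (c * nat \<lceil>lg 2 n\<rceil>)) free \<mu> [p1, p2]
           (Outcome [p] R U work span) \<and>
         is_btree B t \<and> keys t = keys t1 \<union> keys t2 \<and> stored (\<mu> ++ U) p t \<and>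
         real work \<le> c * (m * lg B (n / m)) \<and>
         real span \<le> c * (lg B m * lg 2 (lg B n) + lg B n))"
proof (intro exI[of _ 1000] exI[of _ "\<lambda>B. program_of (union_body B)"] allI impI, elim conjE)
  fix B m n :: nat and t1 t2 :: "'k btree" and \<mu> p1 p2 and free :: "nat \<Rightarrow> nat"
  assume "2 \<le> B" "is_btree B t1" "is_btree B t2" "num_keys t1 = m" "num_keys t2 = n" "m \<le> n"
    "stored \<mu> p1 t1" "stored \<mu> p2 t2" "inj free" "\<forall>r i. (r, i) \<in> dom \<mu> \<longrightarrow> r \<notin> range free"
  from union_in_bounds[OF order_refl this]
  show "\<exists>p R U work span t.
         exec B ((n + B) ^ 1000) (program_of (union_body B)) (B * (1000 * nat \<lceil>lg 2 n\<rceil>)) free \<mu> [p1, p2]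
           (Outcome [p] R U work span) \<and>
         is_btree B t \<and> keys t = keys t1 \<union> keys t2 \<and> stored (\<mu> ++ U) p t \<and>
         real work \<le> real 1000 * (m * lg B (n / m)) \<and>
         real span \<le> real 1000 * (lg B m * lg 2 (lg B n) + lg B n)" .
qed

end
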